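(* Let $A$ be a connected graded commutative ring that is a finitely generated free abelian group in each degree. Then $J^{\vee}(A)$ is a polynomial algebra over $\mathbb Z$ if and only if for all primes $p$ and all $x\in A$, $x^p\equiv 0 \bmod p$ implies $x\equiv 0\bmod p$.
   Context: Everything is non-negatively graded, with graded tensor product over $\mathbb Z$ and braiding $x\otimes y\mapsto(-1)^{|x||y|}y\otimes x$; "commutative" means graded commutative, and "connected" means the degree $0$ part is $\mathbb Z$. $\mathcal A^*(\mathbb Z)$ and $\mathcal H^*(\mathbb Z)$ are the categories of connected graded commutative algebras, respectively Hopf algebras, over $\mathbb Z$ that are finitely generated free abelian groups in each degree. $J^{\vee}:\mathcal A^*(\mathbb Z)\to\mathcal H^*(\mathbb Z)$ is the right adjoint of the forgetful functor. Explicitly, with $\bar A$ the positive degree part of $A$, $J^{\vee}(A)=\bigoplus_{r\ge 0}\bar A^{\otimes r}$ with deconcatenation coproduct and with the quasi-shuffle product: the component $\bar A^{\otimes l}\otimes\bar A^{\otimes m}\to\bar A^{\otimes n}$ of the product is the sum, over all pairs of order preserving injections $\alpha:\{1,\dots,l\}\to\{1,\dots,n\}$, $\beta:\{1,\dots,m\}\to\{1,\dots,n\}$ whose images together cover $\{1,\dots,n\}$, of the map sending $a_1\otimes\cdots\otimes a_{l+m}$ to $\bigotimes_{i=1}^n\prod_{j\in\gamma^{-1}(i)}a_j$ (with Koszul signs), where $\gamma$ is $\alpha$ on the first $l$ elements and $\beta$ on the last $m$. "Polynomial" means isomorphic as a graded ring to a polynomial ring over $\mathbb Z$ on homogeneous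 generators of positive degree. *)

theory Defs
  imports "HOL-Algebra.Algebra" "HOL-Library.FuncSet" "HOL-Library.Poly_Mapping"
begin

section \<open>Graded rings\<close>

locale graded_ring = ring A for A (structure) +
  fixes G :: "nat \<Rightarrow> 'a set"
  assumes grade_subgroup: "additive_subgroup (G n) A"
    and one_grade: "\<one> \<in> G 0"
    and mult_grade: "\<lbrakk>x \<in> G m; y \<in> G n\<rbrakk> \<Longrightarrow> x \<otimes> y \<in> G (m + n)"
    and direct_sum: "x \<in> carrier A \<Longrightarrow>
      \<exists>!f. (\<forall>n. f n \<in> G n) \<and> finite {n. f n \<noteq> \<zero>} \<and> x = (\<Oplus>n\<in>{n. f n \<noteq> \<zero>}. f n)"

text \<open>The objects of $\mathcal{A}^*(\mathbb{Z})$.\<close>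

locale connected_graded_comm_ring = graded_ring +
  assumes graded_comm: "\<lbrakk>x \<in> G m; y \<in> G n\<rbrakk> \<Longrightarrow> x \<otimes> y = add_pow A ((-1::int) ^ (m * n)) (y \<otimes> x)"
    and connected: "int_ring \<simeq> A\<lparr>carrier := G 0\<rparr>"
    and finite_free: "\<exists>k::nat. free_Abelian_group {..<k} \<cong> add_monoid (A\<lparr>carrier := G n\<rparr>)"

definition zero_mod :: "('a, 'm) ring_scheme \<Rightarrow> nat \<Rightarrow> 'a \<Rightarrow> bool" where
  "zero_mod A p x \<longleftrightarrow> (\<exists>y\<in>carrier A. x = add_pow A p y)"


section \<open>Polynomial rings as graded rings\<close>

text \<open>The ordinary (strictly commutative) polynomial ring over the integers with variables
  indexed by \<open>I\<close>. A monomial is a finitely supported exponent function \<open>'i \<Rightarrow>\<^sub>0 nat\<close>; the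
  multiplication on \<open>('i \<Rightarrow>\<^sub>0 nat) \<Rightarrow>\<^sub>0 int\<close> is convolution, i.e. multiplication of polynomials.\<close>

definition int_mpoly_ring :: "'i set \<Rightarrow> (('i \<Rightarrow>\<^sub>0 nat) \<Rightarrow>\<^sub>0 int) ring" where
  "int_mpoly_ring I =
     \<lparr>carrier = {f. \<forall>m\<in>Poly_Mapping.keys f. Poly_Mapping.keys m \<subseteq> I},
      monoid.mult = (*), one = 1, ring.zero = 0, ring.add = (+)\<rparr>"

definition monom_degree :: "('i \<Rightarrow> nat) \<Rightarrow> ('i \<Rightarrow>\<^sub>0 nat) \<Rightarrow> nat" where
  "monom_degree d m = (\<Sum>i\<in>Poly_Mapping.keys m. Poly_Mapping.lookup m i * d i)"

definition int_mpoly_grade ::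
    "'i set \<Rightarrow> ('i \<Rightarrow> nat) \<Rightarrow> nat \<Rightarrow> (('i \<Rightarrow>\<^sub>0 nat) \<Rightarrow>\<^sub>0 int) set" where
  "int_mpoly_grade I d n =
     {f \<in> carrier (int_mpoly_ring I). \<forall>m\<in>Poly_Mapping.keys f. monom_degree d m = n}"

text \<open>Taking the variables from the element type of \<open>R\<close> is no restriction: an isomorphism
  from a polynomial ring sends distinct variables to distinct elements of \<open>R\<close>, so its
  variables may be relabelled by these. There is no other relation between the variables and
  the elements of \<open>R\<close> that name them.\<close>

definition polynomial_graded_ring :: "('r, 'm) ring_scheme \<Rightarrow> (nat \<Rightarrow> 'r set) \<Rightarrow> bool" where
  "polynomial_graded_ring R H \<longleftrightarrow>
     (\<exists>(I :: 'r set) d \<phi>. (\<forall>i\<in>I. 0 < d i) \<and> \<phi> \<in> ring_iso (int_mpoly_ring I) R \<and>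
        (\<forall>n. \<phi> ` int_mpoly_grade I d n = H n))"


section \<open>The graded ring $J^\vee(A)$\<close>

text \<open>A letter \<open>(n, a)\<close> stands for the element \<open>a\<close> of degree \<open>n\<close> (the degree is recorded since
  zero has every degree), and a word \<open>[(n\<^sub>1, a\<^sub>1), \<dots>, (n\<^sub>r, a\<^sub>r)]\<close> for the elementary tensor
  $a_1 \otimes \cdots \otimes a_r$ in the \<open>r\<close>-th tensor power of the positive degree part of \<open>A\<close>.\<close>

type_synonym 'a word = "(nat \<times> 'a) list"

definition words :: "(nat \<Rightarrow> 'a set) \<Rightarrow> 'a word set" where
  "words G = {w. \<forall>(n, a)\<in>set w. 0 < n \<and> a \<in> G n}"

definition word_degree :: "'a word \<Rightarrow> nat" where
  "word_degree w = sum_list (map fst w)"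

definition letter_prod :: "('a, 'm) ring_scheme \<Rightarrow> 'a word \<Rightarrow> nat \<times> 'a" where
  "letter_prod A w = (word_degree w, foldr (\<lambda>x y. snd x \<otimes>\<^bsub>A\<^esub> y) w \<one>\<^bsub>A\<^esub>)"

text \<open>For a map \<open>\<gamma>\<close> from the positions of \<open>w\<close> to \<open>{0..<n}\<close>, the word whose letter at \<open>i\<close> is the
  product, in increasing order of \<open>j\<close>, of the letters of \<open>w\<close> at the positions \<open>j\<close> with
  \<open>\<gamma> j = i\<close>; the Koszul sign has a factor for each pair of letters that \<open>\<gamma>\<close> moves past each
  other.\<close>

definition collapse :: "('a, 'm) ring_scheme \<Rightarrow> 'a word \<Rightarrow> (nat \<Rightarrow> nat) \<Rightarrow> nat \<Rightarrow> 'a word" where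
  "collapse A w \<gamma> n =
     map (\<lambda>i. letter_prod A (map ((!) w) (filter (\<lambda>j. \<gamma> j = i) [0..<length w]))) [0..<n]"

definition koszul_sign :: "'a word \<Rightarrow> (nat \<Rightarrow> nat) \<Rightarrow> int" where
  "koszul_sign w \<gamma> =
     (\<Prod>(j, k)\<in>{(j, k). j < k \<and> k < length w \<and> \<gamma> k < \<gamma> j}. (-1) ^ (fst (w ! j) * fst (w ! k)))"

definition quasi_shuffles :: "nat \<Rightarrow> nat \<Rightarrow> nat \<Rightarrow> ((nat \<Rightarrow> nat) \<times> (nat \<Rightarrow> nat)) set" where
  "quasi_shuffles l m n =
     {(\<alpha>, \<beta>). \<alpha> \<in> {..<l} \<rightarrow>\<^sub>E {..<n} \<and> strict_mono_on {..<l} \<alpha> \<and>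
              \<beta> \<in> {..<m} \<rightarrow>\<^sub>E {..<n} \<and> strict_mono_on {..<m} \<beta> \<and>
              \<alpha> ` {..<l} \<union> \<beta> ` {..<m} = {..<n}}"

definition glue :: "nat \<Rightarrow> (nat \<Rightarrow> nat) \<Rightarrow> (nat \<Rightarrow> nat) \<Rightarrow> nat \<Rightarrow> nat" where
  "glue l \<alpha> \<beta> j = (if j < l then \<alpha> j else \<beta> (j - l))"

text \<open>There are no quasi-shuffles for \<open>n > length u + length v\<close>, so the sum is over all \<open>n\<close>.\<close>

definition word_mult :: "('a, 'm) ring_scheme \<Rightarrow> 'a word \<Rightarrow> 'a word \<Rightarrow> ('a word \<Rightarrow>\<^sub>0 int)" where
  "word_mult A u v =
     (\<Sum>n\<le>length u + length v. \<Sum>(\<alpha>, \<beta>)\<in>quasi_shuffles (length u) (length v) n.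
        frag_cmul (koszul_sign (u @ v) (glue (length u) \<alpha> \<beta>))
          (frag_of (collapse A (u @ v) (glue (length u) \<alpha> \<beta>) n)))"

text \<open>The free abelian group on words with the quasi-shuffle product, extended bilinearly.\<close>

definition word_ring :: "('a, 'm) ring_scheme \<Rightarrow> (nat \<Rightarrow> 'a set) \<Rightarrow> ('a word \<Rightarrow>\<^sub>0 int) ring" where
  "word_ring A G =
     \<lparr>carrier = carrier (free_Abelian_group (words G)),
      monoid.mult = (\<lambda>x y. frag_extend (\<lambda>u. frag_extend (\<lambda>v. word_mult A u v) y) x),
      one = frag_of [], ring.zero = 0, ring.add = (+)\<rparr>"

text \<open>The relations presenting the tensor powers over the integers: additivity in each letter.\<close>

definition tensor_relators :: "('a, 'm) ring_scheme \<Rightarrow> (nat \<Rightarrow> 'a set) \<Rightarrow> ('a word \<Rightarrow>\<^sub>0 int) set" where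
  "tensor_relators A G =
     {frag_of (u @ (n, a \<oplus>\<^bsub>A\<^esub> b) # v) - frag_of (u @ (n, a) # v) - frag_of (u @ (n, b) # v)
      | u v n a b. u \<in> words G \<and> v \<in> words G \<and> 0 < n \<and> a \<in> G n \<and> b \<in> G n}"

definition tensor_relations :: "('a, 'm) ring_scheme \<Rightarrow> (nat \<Rightarrow> 'a set) \<Rightarrow> ('a word \<Rightarrow>\<^sub>0 int) set" where
  "tensor_relations A G = generate (add_monoid (word_ring A G)) (tensor_relators A G)"

text \<open>The quotient additive group is the direct sum of the tensor powers; \<open>tensor_relations A G\<close>
  is the additive subgroup generated by the relators, and the product of \<open>Quot\<close> is the one
  induced on cosets. The grading is by total degree, not by length of words.\<close>

definition J_ring :: "('a, 'm) ring_scheme \<Rightarrow> (nat \<Rightarrow> 'a set) \<Rightarrow> ('a word \<Rightarrow>\<^sub>0 int) set ring" where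
  "J_ring A G = word_ring A G Quot tensor_relations A G"

definition J_grade ::
    "('a, 'm) ring_scheme \<Rightarrow> (nat \<Rightarrow> 'a set) \<Rightarrow> nat \<Rightarrow> ('a word \<Rightarrow>\<^sub>0 int) set set" where
  "J_grade A G n =
     {tensor_relations A G +>\<^bsub>word_ring A G\<^esub> f | f.
        f \<in> carrier (word_ring A G) \<and> (\<forall>w\<in>Poly_Mapping.keys f. word_degree w = n)}"

end

theory Submission
  imports Defs "HOL-Library.Multiset" "HOL-Computational_Algebra.Primes"
begin

text \<open>Modulo a prime \<open>p\<close>, the \<open>p\<close>-th power of a word in $J^\vee(A)$ is the word of the \<open>p\<close>-th powers of
  its letters, so Frobenius is injective on $J^\vee(A)/p$ if and only if it is injective on \<open>A/p\<close>; and it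
  is injective on a polynomial ring over the field with \<open>p\<close> elements. Each side of the equivalence
  forces \<open>A\<close> to vanish in odd degrees, because squares of odd elements are zero.

  Conversely, choose elements \<open>x\<^sub>i\<close> of $J^\vee(A)$ lifting a basis of the indecomposables modulo torsion,
  and functionals \<open>\<xi>\<^sub>i\<close> dual to them that vanish on decomposables. Then \<open>(id \<otimes> \<xi>\<^sub>i) \<circ> \<Delta>\<close> is a derivation,
  and these derivations form a unitriangular system on the \<open>x\<^sub>i\<close>. A polynomial relation modulo \<open>p\<close>
  between the \<open>x\<^sub>i\<close> of least degree therefore has vanishing partial derivatives, so it is a \<open>p\<close>-th
  power, and injectivity of Frobenius yields a smaller relation. Hence the \<open>x\<^sub>i\<close> are algebraically
  independent modulo every prime, and the subring they generate is saturated; by induction on the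
  degree it is everything.\<close>

\<comment> \<open>Long computations need a ring that is a type, so J(A) is reached from a larger
  one. Letters become formal products of homogeneous elements, words in them form the commutative
  ring \<open>qsh\<close>, and J(A) is \<open>qsh\<close> modulo \<open>null\<close>, the joint
  kernel of the functionals \<open>coef K k\<close>. These are the coordinates with respect to
  tensor words on a homogeneous basis of A, so vanishing, degree and divisibility by p are all
  tested by integers. Koszul signs never enter \<open>qsh\<close>: it is used only once A is known
  to vanish in odd degrees. The merging of letters is what makes Frobenius on words nontrivial: in a
  plain shuffle ring the p-th power of a nonempty word would vanish modulo p. Injectivity passes
  from A/p to J(A)/p because Frobenius on each degree of A/p is linear over the prime field and so
  has a left inverse, which can be applied one letter at a time. Indecomposables may a priori have
  torsion. So the generators account for an element only up to a nonzero multiple, and independence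
  modulo every prime is what removes that multiple.\<close>
alias keys = Poly_Mapping.keys
alias lookup = Poly_Mapping.lookup
alias single = Poly_Mapping.single

section \<open>Additive maps and linear extension of functions on a basis to a ring\<close>

lemma additive_of_int:
  fixes f :: "'a::ring_1 \<Rightarrow> 'b::ring_1"
  assumes "additive f"
  shows "f (of_int c * x) = of_int c * f x"
proof -
  interpret additive f by (fact assms)
  have nat: "f (of_nat n * x) = of_nat n * f x" for n
    by (induction n) (simp_all add: zero add distrib_right)
  show ?thesis
    by (cases c rule: int_cases2) (simp_all add: nat minus)
qed

lemma additive_comp: "additive f \<Longrightarrow> additive g \<Longrightarrow> additive (\<lambda>x. f (g x))"
  by (simp add: additive_def)

definition int_extend :: "('k \<Rightarrow> 'r) \<Rightarrow> ('k \<Rightarrow>\<^sub>0 int) \<Rightarrow> 'r::ring_1"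
  where "int_extend h f = (\<Sum>k\<in>keys f. of_int (lookup f k) * h k)"

lemma int_extend_superset:
  assumes "finite S" "keys f \<subseteq> S"
  shows "int_extend h f = (\<Sum>k\<in>S. of_int (lookup f k) * h k)"
  unfolding int_extend_def
  by (rule sum.mono_neutral_left) (use assms in \<open>auto simp: in_keys_iff\<close>)

lemma int_extend_frag_of [simp]: "int_extend h (frag_of k) = h k"
  by (simp add: int_extend_def)

lemma int_extend_additive: "additive (int_extend h)"
proof
  fix f g :: "'a \<Rightarrow>\<^sub>0 int"
  let ?S = "keys f \<union> keys g"
  have "keys (f + g) \<subseteq> ?S" by (rule keys_add)
  then show "int_extend h (f + g) = int_extend h f + int_extend h g"
    by (subst (1 2 3) int_extend_superset[where S = ?S])
      (auto simp: lookup_add distrib_right sum.distrib)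
qed

lemmas int_extend_add = additive.add[OF int_extend_additive]
  and int_extend_0 [simp] = additive.zero[OF int_extend_additive]
  and int_extend_diff = additive.diff[OF int_extend_additive]

lemma int_extend_frag_cmul: "int_extend h (frag_cmul c f) = of_int c * int_extend h f"
proof (cases "c = 0")
  case False
  then have "keys (frag_cmul c f) = keys f" by auto
  then show ?thesis
    by (simp add: int_extend_def sum_distrib_left mult.assoc)
qed simp

section \<open>Quasi-shuffle rings over commutative semigroups\<close>

text \<open>Finitely supported functions already carry convolution as their product, so the
  quasi-shuffle product is put on a copy of the type.\<close>

typedef 'b qsh = "UNIV :: ('b list \<Rightarrow>\<^sub>0 int) set" ..

text \<open>The front letter of a quasi-shuffle is the first letter of one factor, or both first
  letters merged. Merging is written \<open>+\<close> because commutative semigroups are an additive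
  class here; it stands for the product of A.\<close>

fun qs_words :: "'b::ab_semigroup_add list \<Rightarrow> 'b list \<Rightarrow> ('b list \<Rightarrow>\<^sub>0 int)" where
  "qs_words [] v = frag_of v"
| "qs_words (a # u) [] = frag_of (a # u)"
| "qs_words (a # u) (b # v) =
     frag_extend (\<lambda>w. frag_of (a # w)) (qs_words u (b # v)) +
     frag_extend (\<lambda>w. frag_of (b # w)) (qs_words (a # u) v) +
     frag_extend (\<lambda>w. frag_of ((a + b) # w)) (qs_words u v)"

instantiation qsh :: (ab_semigroup_add) "{ab_group_add, one, times}"
begin
definition "0 = Abs_qsh 0"
definition "1 = Abs_qsh (frag_of [])"
definition "x + y = Abs_qsh (Rep_qsh x + Rep_qsh y)"
definition "x - y = Abs_qsh (Rep_qsh x - Rep_qsh y)"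
definition "- x = Abs_qsh (- Rep_qsh x)"
definition "x * y = Abs_qsh (frag_extend (\<lambda>u. frag_extend (qs_words u) (Rep_qsh y)) (Rep_qsh x))"
instance
  by standard
    (simp_all add: plus_qsh_def zero_qsh_def minus_qsh_def uminus_qsh_def Abs_qsh_inverse
      Rep_qsh_inverse add.assoc add.commute add.left_commute)
end

lemmas qsh_rep_simps = plus_qsh_def zero_qsh_def minus_qsh_def uminus_qsh_def times_qsh_def
  one_qsh_def Abs_qsh_inverse Rep_qsh_inverse

definition word :: "'b list \<Rightarrow> 'b qsh" where "word w = Abs_qsh (frag_of w)"

lemma qsh_induct [case_names zero word diff]:
  assumes "P 0" "\<And>w. P (word w)" "\<And>x y. P x \<Longrightarrow> P y \<Longrightarrow> P (x - y)"
  shows "P (x :: 'b::ab_semigroup_add qsh)"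
proof -
  have "P (Abs_qsh f)" for f
    using subset_UNIV[of "keys f"]
  proof (induction f rule: frag_induction)
    case zero then show ?case using assms(1) by (simp add: zero_qsh_def)
  next
    case (one x) then show ?case using assms(2) by (simp add: word_def)
  next
    case (diff a b) then show ?case using assms(3)[of "Abs_qsh a" "Abs_qsh b"]
      by (simp add: minus_qsh_def Abs_qsh_inverse)
  qed
  from this[of "Rep_qsh x"] show ?thesis by (simp add: Rep_qsh_inverse)
qed

lemma qsh_distrib_right: "(x + y) * z = x * z + y * (z :: 'b::ab_semigroup_add qsh)"
  by (simp add: qsh_rep_simps frag_extend_add)

lemma qsh_distrib_left: "z * (x + y) = z * x + z * (y :: 'b::ab_semigroup_add qsh)"
proof -
  have "frag_extend (\<lambda>u. f u + g u) t = frag_extend f t + frag_extend g t"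
    for f g :: "'b list \<Rightarrow> 'b list \<Rightarrow>\<^sub>0 int" and t
    by (simp add: frag_extend_def frag_cmul_distrib2 sum.distrib)
  then show ?thesis by (simp add: qsh_rep_simps frag_extend_add)
qed

lemma qsh_additive_eq:
  fixes x :: "'b::ab_semigroup_add qsh"
  assumes f: "additive f" and g: "additive g" and "\<And>w. f (word w) = g (word w)"
  shows "f x = g x"
proof (induction x rule: qsh_induct)
  case (diff x y) then show ?case by (simp add: additive.diff[OF f] additive.diff[OF g])
qed (simp_all add: assms additive.zero[OF f] additive.zero[OF g])

text \<open>Left multiplication by a letter in the tensor algebra, not in the quasi-shuffle ring.\<close>

definition pre :: "'b \<Rightarrow> 'b qsh \<Rightarrow> 'b::ab_semigroup_add qsh"
  where "pre a x = Abs_qsh (frag_extend (\<lambda>w. frag_of (a # w)) (Rep_qsh x))"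

lemma pre_additive: "additive (pre a)"
  by (simp add: additive_def pre_def qsh_rep_simps frag_extend_add)

lemmas pre_add = additive.add[OF pre_additive]
  and pre_zero [simp] = additive.zero[OF pre_additive]
  and pre_diff = additive.diff[OF pre_additive]
  and pre_sum = additive.sum[OF pre_additive]

lemma pre_word [simp]: "pre a (word w) = word (a # w)"
  by (simp add: pre_def word_def Abs_qsh_inverse)

lemma word_Nil: "word [] = 1" by (simp add: word_def one_qsh_def)

lemma word_mult_Rep: "word u * word v = Abs_qsh (qs_words u v)"
  by (simp add: word_def times_qsh_def Abs_qsh_inverse)

lemma word_Nil_mult: "word [] * word v = word v" "word v * word [] = word v"
  by (simp_all add: word_mult_Rep) (cases v; simp add: word_def)+

lemma word_Cons_mult:
  "word (a # u) * word (b # v) = pre a (word u * word (b # v)) + pre b (word (a # u) * word v)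
     + pre (a + b) (word u * word v)"
  by (simp add: word_mult_Rep pre_def plus_qsh_def Abs_qsh_inverse)

lemma qsh_additive2_eq:
  fixes x y :: "'b::ab_semigroup_add qsh"
  assumes "\<And>y. additive (\<lambda>x. f x y)" "\<And>y. additive (\<lambda>x. g x y)"
    and "\<And>x. additive (f x)" "\<And>x. additive (g x)"
    and "\<And>u v. f (word u) (word v) = g (word u) (word v)"
  shows "f x y = g x y"
proof -
  have w: "f (word u) y = g (word u) y" for u
    by (rule qsh_additive_eq[where f = "f (word u)"]) (use assms in auto)
  show ?thesis
    by (rule qsh_additive_eq[where f = "\<lambda>x. f x y"]) (use assms w in auto)
qed

text \<open>The recursion of \<open>qs_words\<close> in bilinear form: the tails may now be
  arbitrary elements instead of words.\<close>

lemma pre_mult: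
  "pre a x * pre b y = pre a (x * pre b y) + pre b (pre a x * y) + pre (a + b) (x * y)"
proof (rule qsh_additive2_eq[where f = "\<lambda>x y. pre a x * pre b y"])
  fix u v
  show "pre a (word u) * pre b (word v) = pre a (word u * pre b (word v)) +
    pre b (pre a (word u) * word v) + pre (a + b) (word u * word v)"
    by (simp only: pre_word word_Cons_mult)
qed (simp_all only: additive_def pre_add qsh_distrib_right qsh_distrib_left, simp_all only: add_ac simp_thms)

lemma qsh_mult_1: "1 * x = (x :: 'b::ab_semigroup_add qsh)" "x * 1 = x"
  by (rule qsh_additive_eq[where x = x]; 
      simp add: additive_def qsh_distrib_right qsh_distrib_left word_Nil_mult flip: word_Nil)+

lemma qsh_mult_commute: "x * y = y * (x :: 'b::ab_semigroup_add qsh)"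
proof (rule qsh_additive2_eq[where f = "\<lambda>x y. x * y"])
  fix u v :: "'b list"
  show "word u * word v = word v * word u"
  proof (induction u v rule: qs_words.induct)
    case (3 a u b v)
    then show ?case by (simp add: word_Cons_mult add_ac)
  qed (simp_all add: word_Nil_mult)
qed (simp_all add: additive_def qsh_distrib_right qsh_distrib_left)

text \<open>Both bracketings expand into seven groups of terms, one for each nonempty set of first
  letters that merge in front; each group is an instance of associativity for shorter words.\<close>

lemma word_mult_assoc:
  "(word u * word v) * word w = word u * (word v * (word w :: 'b::ab_semigroup_add qsh))"
proof (induction "length u + length v + length w" arbitrary: u v w rule: less_induct)
  case less
  consider "u = [] \<or> v = [] \<or> w = []" | a u' b v' c w' where "u = a # u'" "v = b # v'" "w = c # w'"
    by (cases u; cases v; cases w) auto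
  then show ?case
  proof cases
    case 1 then show ?thesis by (auto simp: word_Nil qsh_mult_1)
  next
    case 2
    define U V W where "U = word u'" and "V = word v'" and "W = word w'"
    have eq: "word u' = U" "word v' = V" "word w' = W"
      "word (a # u') = pre a U" "word (b # v') = pre b V" "word (c # w') = pre c W"
      by (simp_all add: U_def V_def W_def)
    have IH: "U * pre b V * pre c W = U * (pre b V * pre c W)"
      "pre a U * V * pre c W = pre a U * (V * pre c W)"
      "pre a U * pre b V * W = pre a U * (pre b V * W)"
      "U * V * pre c W = U * (V * pre c W)"
      "U * pre b V * W = U * (pre b V * W)"
      "pre a U * V * W = pre a U * (V * W)"
      "U * V * W = U * (V * W)"
      using less[of u' "b # v'" "c # w'"] less[of "a # u'" v' "c # w'"] less[of "a # u'" "b # v'" w']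
        less[of u' v' "c # w'"] less[of u' "b # v'" w'] less[of "a # u'" v' w'] less[of u' v' w']
      by (simp_all add: 2 eq)
    have l: "pre a U * pre b V * pre c W = 
        pre a ((U * pre b V) * pre c W) + pre c (pre a (U * pre b V) * W) + pre (a + c) (U * pre b V * W)
      + (pre b ((pre a U * V) * pre c W) + pre c (pre b (pre a U * V) * W) + pre (b + c) (pre a U * V * W))
      + (pre (a + b) ((U * V) * pre c W) + pre c (pre (a + b) (U * V) * W) + pre (a + b + c) (U * V * W))"
      by (simp only: pre_mult[of a U b V] qsh_distrib_right pre_mult)
    \<comment> \<open>The three summands led by \<open>c\<close> alone recombine into one product;
      \<open>r'\<close> does the same for those led by \<open>a\<close> on the other side. The
      remaining groups match term by term.\<close>
    have l': "pre c (pre a (U * pre b V) * W) + pre c (pre b (pre a U * V) * W) + pre c (pre (a + b) (U * V) * W)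
       = pre c (pre a U * (pre b V * W))"
      by (simp only: IH(3)[symmetric] pre_mult[of a U b V] qsh_distrib_right pre_add)
    have r: "pre a U * (pre b V * pre c W) =
        pre a (U * pre b (V * pre c W)) + pre b (pre a U * (V * pre c W)) + pre (a + b) (U * (V * pre c W))
      + (pre a (U * pre c (pre b V * W)) + pre c (pre a U * (pre b V * W)) + pre (a + c) (U * (pre b V * W)))
      + (pre a (U * pre (b + c) (V * W)) + pre (b + c) (pre a U * (V * W)) + pre (a + (b + c)) (U * (V * W)))"
      by (simp only: pre_mult[of b V c W] qsh_distrib_left pre_mult)
    have r': "pre a (U * pre b (V * pre c W)) + pre a (U * pre c (pre b V * W)) + pre a (U * pre (b + c) (V * W))
       = pre a ((U * pre b V) * pre c W)"
      by (simp only: IH(1) pre_mult[of b V c W] qsh_distrib_left pre_add)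
    have "pre a U * pre b V * pre c W = pre a U * (pre b V * pre c W)"
      unfolding l r IH using l' r' unfolding IH by (simp add: add_ac)
    then show ?thesis unfolding 2 eq .
  qed
qed

lemma qsh_mult_assoc: "(x * y) * z = x * (y * (z :: 'b::ab_semigroup_add qsh))"
proof -
  have w: "word u * word v * z = word u * (word v * z)" for u v
    by (rule qsh_additive_eq[where x = z]) 
      (simp_all add: additive_def qsh_distrib_right qsh_distrib_left word_mult_assoc)
  show ?thesis
    by (rule qsh_additive2_eq[where f = "\<lambda>x y. x * y * z"])
      (simp_all add: w additive_def qsh_distrib_right qsh_distrib_left)
qed

instance qsh :: (ab_semigroup_add) comm_ring_1
proof
  have "Rep_qsh (0 :: 'a qsh) \<noteq> Rep_qsh 1"
    by (simp add: zero_qsh_def one_qsh_def Abs_qsh_inverse frag_of_nonzero[symmetric] del: frag_of_nonzero)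
  then show "(0 :: 'a qsh) \<noteq> 1" by auto
qed (simp_all add: qsh_mult_assoc qsh_mult_1 qsh_distrib_right, simp add: qsh_mult_commute)

definition qsh_extend :: "('b::ab_semigroup_add list \<Rightarrow> 'r) \<Rightarrow> 'b qsh \<Rightarrow> 'r::ring_1"
  where "qsh_extend h x = int_extend h (Rep_qsh x)"

lemma qsh_extend_additive: "additive (qsh_extend h)"
  by (simp add: additive_def qsh_extend_def plus_qsh_def Abs_qsh_inverse int_extend_add)

lemmas qsh_extend_zero [simp] = additive.zero[OF qsh_extend_additive]

lemma qsh_extend_word [simp]: "qsh_extend h (word w) = h w"
  by (simp add: qsh_extend_def word_def Abs_qsh_inverse)

lemma qsh_extend_1 [simp]: "qsh_extend h 1 = h []"
  using qsh_extend_word[of h "[]"] by (simp add: word_Nil)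

lemma pre_of_int: "pre a (of_int c * x) = of_int c * pre a x"
  by (rule additive_of_int[OF pre_additive])

lemma pre_of_nat: "pre a (of_nat c * x) = of_nat c * pre a x"
  using pre_of_int[of a "int c" x] by simp

section \<open>Powers modulo a prime\<close>

text \<open>A semigroup has no empty sum, so the index is one less than the number of summands; the
  p-fold sum is \<open>repeat_add (p - 1)\<close>.\<close>

primrec repeat_add :: "nat \<Rightarrow> 'b \<Rightarrow> 'b::ab_semigroup_add" where
  "repeat_add 0 a = a"
| "repeat_add (Suc k) a = a + repeat_add k a"

text \<open>Of the \<open>Suc k\<close> factors, some \<open>Suc j\<close> contribute their first
  letters to the front, where these merge. The binomial coefficient counts the choices, the opened
  factors leave \<open>x ^ Suc j\<close>, and the others stay intact.\<close>

lemma pre_power_Suc: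
  "pre a x ^ Suc k =
    (\<Sum>j\<le>k. of_nat (Suc k choose Suc j) * pre (repeat_add j a) (x ^ Suc j * pre a x ^ (k - j)))"
proof (induction k)
  case 0 then show ?case by simp
next
  case (Suc k)
  define z where "z = pre a x"
  define ra where "ra j = repeat_add j a" for j
  define t where "t j = pre (ra j) (x ^ Suc j * z ^ (Suc k - j))" for j
  let ?c = "\<lambda>j. of_nat (Suc k choose Suc j) :: 'a qsh"
  have IH: "z ^ Suc k = (\<Sum>j\<le>k. ?c j * pre (ra j) (x ^ Suc j * z ^ (k - j)))"
    using Suc by (simp add: z_def ra_def)
  have step: "z * pre (ra j) (x ^ Suc j * z ^ (k - j)) =
      pre a (x * pre (ra j) (x ^ Suc j * z ^ (k - j))) + t j + t (Suc j)" if "j \<le> k" for j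
  proof -
    have "z * (x ^ Suc j * z ^ (k - j)) = x ^ Suc j * z ^ (Suc k - j)"
      using that by (simp add: Suc_diff_le mult_ac)
    then show ?thesis
      unfolding z_def by (subst pre_mult) (simp add: t_def ra_def z_def mult_ac)
  qed
  have "z ^ Suc (Suc k) = z * (\<Sum>j\<le>k. ?c j * pre (ra j) (x ^ Suc j * z ^ (k - j)))"
    using IH by simp
  also have "\<dots> = (\<Sum>j\<le>k. ?c j * (z * pre (ra j) (x ^ Suc j * z ^ (k - j))))"
    by (simp add: sum_distrib_left mult_ac)
  also have "\<dots> = (\<Sum>j\<le>k. ?c j * pre a (x * pre (ra j) (x ^ Suc j * z ^ (k - j))))
      + (\<Sum>j\<le>k. ?c j * t j) + (\<Sum>j\<le>k. ?c j * t (Suc j))"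
    unfolding sum.distrib[symmetric]
    by (intro sum.cong refl) (simp only: atMost_iff step distrib_left)
  also have "(\<Sum>j\<le>k. ?c j * pre a (x * pre (ra j) (x ^ Suc j * z ^ (k - j)))) = pre a (x * z ^ Suc k)"
    unfolding IH sum_distrib_left pre_sum
    by (intro sum.cong refl) (simp only: mult.left_commute[of x "of_nat _"] pre_of_nat)
  also have "pre a (x * z ^ Suc k) = t 0" by (simp add: t_def ra_def)
  \<comment> \<open>Both sums are extended to \<open>Suc k\<close> so that Pascal's rule applies
    termwise; the term added to the first has the coefficient
    \<open>Suc k choose Suc (Suc k)\<close>, which is 0.\<close>
  also have "t 0 + (\<Sum>j\<le>k. ?c j * t j) + (\<Sum>j\<le>k. ?c j * t (Suc j))
     = (\<Sum>j\<le>Suc k. ?c j * t j) + (\<Sum>j\<le>Suc k. of_nat (Suc k choose j) * t j)"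
  proof -
    have "(\<Sum>j\<le>Suc k. of_nat (Suc k choose j) * t j) = t 0 + (\<Sum>j\<le>k. ?c j * t (Suc j))"
      by (subst sum.atMost_Suc_shift) simp
    moreover have "(\<Sum>j\<le>Suc k. ?c j * t j) = (\<Sum>j\<le>k. ?c j * t j)"
      by (simp add: binomial_eq_0 del: binomial_Suc_Suc)
    ultimately show ?thesis by (simp add: add_ac)
  qed
  also have "\<dots> = (\<Sum>j\<le>Suc k. of_nat (Suc (Suc k) choose Suc j) * t j)"
    unfolding sum.distrib[symmetric] by (intro sum.cong) (simp_all add: algebra_simps)
  finally show ?case by (simp only: z_def t_def ra_def)
qed

lemma of_nat_dvd_of_natI: "m dvd n \<Longrightarrow> (of_nat m :: 'a::comm_semiring_1) dvd of_nat n"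
  by (auto elim!: dvdE)

text \<open>In \<open>pre_power_Suc\<close> all binomial coefficients are divisible by p except the
  one for all p first letters merging.\<close>

lemma prime_dvd_pre_power:
  assumes p: "Factorial_Ring.prime p"
  shows "of_nat p dvd pre a x ^ p - pre (repeat_add (p - 1) a) (x ^ p)"
proof -
  obtain k where k: "p = Suc k" using prime_gt_0_nat[OF p] by (cases p) auto
  have "pre a x ^ p - pre (repeat_add k a) (x ^ p) =
     (\<Sum>j<k. of_nat (p choose Suc j) * pre (repeat_add j a) (x ^ Suc j * pre a x ^ (k - j)))"
    unfolding k pre_power_Suc by (simp add: lessThan_Suc_atMost[symmetric] del: binomial_Suc_Suc)
  moreover have "of_nat p dvd (of_nat (p choose Suc j) :: 'a qsh)" if "j < k" for j
    by (intro of_nat_dvd_of_natI dvd_choose_prime) (use p k that in auto)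
  ultimately show ?thesis by (auto intro!: dvd_sum dvd_mult2 simp: k)
qed

lemma additive_of_nat_dvd:
  fixes f :: "'a::comm_ring_1 \<Rightarrow> 'b::comm_ring_1"
  assumes "additive f" "of_nat p dvd x"
  shows "of_nat p dvd f x"
  using assms additive_of_int[OF assms(1), of "int p"] by auto

lemma prime_dvd_word_power:
  assumes p: "Factorial_Ring.prime p"
  shows "of_nat p dvd word w ^ p - word (map (repeat_add (p - 1)) w)"
proof (induction w)
  case Nil then show ?case by (simp add: word_Nil)
next
  case (Cons a w)
  have "of_nat p dvd pre (repeat_add (p - 1) a) (word w ^ p - word (map (repeat_add (p - 1)) w))"
    by (rule additive_of_nat_dvd[OF pre_additive Cons])
  from dvd_add[OF prime_dvd_pre_power[OF p, of a "word w"] this]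
  show ?case by (simp add: pre_diff)
qed

lemma prime_dvd_power_add:
  fixes x y :: "'a::comm_ring_1"
  assumes p: "Factorial_Ring.prime p"
  shows "of_nat p dvd (x + y) ^ p - (x ^ p + y ^ p)"
proof -
  obtain k where k: "p = Suc k" using prime_gt_0_nat[OF p] by (cases p) auto
  have "(x + y) ^ p - (x ^ p + y ^ p) = (\<Sum>j<k. of_nat (p choose Suc j) * x ^ Suc j * y ^ (p - Suc j))"
  proof -
    have "(x + y) ^ p = (\<Sum>j\<le>p. of_nat (p choose j) * x ^ j * y ^ (p - j))" by (rule binomial_ring)
    also have "\<dots> = y ^ p + (\<Sum>j\<le>k. of_nat (p choose Suc j) * x ^ Suc j * y ^ (p - Suc j))"
      unfolding k by (subst sum.atMost_Suc_shift) simp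
    finally show ?thesis by (simp add: k lessThan_Suc_atMost[symmetric] del: binomial_Suc_Suc)
  qed
  moreover have "of_nat p dvd (of_nat (p choose Suc j) :: 'a)" if "j < k" for j
    by (intro of_nat_dvd_of_natI dvd_choose_prime) (use p k that in auto)
  ultimately show ?thesis by (auto intro!: dvd_sum dvd_mult2)
qed

lemma prime_dvd_power_sum:
  fixes f :: "'i \<Rightarrow> 'a::comm_ring_1"
  assumes p: "Factorial_Ring.prime p" and "finite S"
  shows "of_nat p dvd sum f S ^ p - (\<Sum>i\<in>S. f i ^ p)"
  using assms(2)
proof (induction S)
  case empty then show ?case using prime_gt_0_nat[OF p] by (simp add: zero_power)
next
  case (insert i S)
  from dvd_add[OF prime_dvd_power_add[OF p, of "f i" "sum f S"] insert.IH]
  show ?case using insert.hyps by (simp add: algebra_simps)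
qed

text \<open>Fermat's little theorem, by induction from additivity of the p-th power modulo
  p.\<close>

lemma prime_dvd_power_diff_self:
  assumes p: "Factorial_Ring.prime p"
  shows "int p dvd c ^ p - c"
proof -
  have nat: "int p dvd int n ^ p - int n" for n
  proof (induction n)
    case 0 then show ?case using prime_gt_0_nat[OF p] by (simp add: zero_power)
  next
    case (Suc n)
    from dvd_add[OF prime_dvd_power_add[OF p, of "int n" 1] Suc] show ?case by (simp add: algebra_simps)
  qed
  \<comment> \<open>Expanding the power of a zero sum relates c to -c for every prime at once, so
    the sign for p = 2 needs no separate case.\<close>
  have "int p dvd (c + (- c)) ^ p - (c ^ p + (- c) ^ p)"
    using prime_dvd_power_add[OF p, of c "- c"] by simp
  moreover have "(c + (- c)) ^ p = 0" using prime_gt_0_nat[OF p] by simp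
  ultimately have neg: "int p dvd c ^ p + (- c) ^ p" by (metis diff_0 dvd_minus_iff)
  show ?thesis
  proof (cases "c \<ge> 0")
    case True then show ?thesis using nat[of "nat c"] by simp
  next
    case False
    then have "int p dvd (- c) ^ p - (- c)" using nat[of "nat (- c)"] by simp
    from dvd_diff[OF neg this] show ?thesis by simp
  qed
qed

text \<open>An additive lift of Frobenius. The p-th power itself is additive only modulo p, whereas
  this map can be compared with integer valued functionals.\<close>

definition qsh_frob :: "nat \<Rightarrow> 'b::ab_semigroup_add qsh \<Rightarrow> 'b qsh"
  where "qsh_frob p = qsh_extend (\<lambda>w. word (map (repeat_add (p - 1)) w))"

lemma qsh_frob_additive: "additive (qsh_frob p)"
  unfolding qsh_frob_def by (rule qsh_extend_additive)

lemma prime_dvd_power_qsh_frob: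
  assumes p: "Factorial_Ring.prime p"
  shows "of_nat p dvd x ^ p - qsh_frob p x"
proof (induction x rule: qsh_induct)
  case zero then show ?case using prime_gt_0_nat[OF p]
    by (simp add: zero_power additive.zero[OF qsh_frob_additive])
next
  case (word w) then show ?case using prime_dvd_word_power[OF p] by (simp add: qsh_frob_def)
next
  case (diff x y)
  have "of_nat p dvd x ^ p - ((x - y) ^ p + y ^ p)" using prime_dvd_power_add[OF p, of "x - y" y] by simp
  from dvd_diff[OF diff(1) dvd_add[OF this diff(2)]]
  show ?case by (simp add: additive.diff[OF qsh_frob_additive] algebra_simps)
qed

section \<open>Left derivatives and coefficient functionals\<close>

text \<open>The counit of the deconcatenation coproduct.\<close>

definition qsh_eps :: "'b::ab_semigroup_add qsh \<Rightarrow> int"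
  where "qsh_eps = qsh_extend (\<lambda>w. if w = [] then 1 else 0)"

text \<open>Contraction of the first letter: (f \<otimes> id) after the coproduct, with f extended
  by 0 to words of length other than one.\<close>

definition lderiv :: "('b \<Rightarrow> int) \<Rightarrow> 'b::ab_semigroup_add qsh \<Rightarrow> 'b qsh"
  where "lderiv f = qsh_extend (\<lambda>w. case w of [] \<Rightarrow> 0 | a # w' \<Rightarrow> of_int (f a) * word w')"

lemma qsh_eps_additive: "additive qsh_eps"
  unfolding qsh_eps_def by (rule qsh_extend_additive)

lemma lderiv_additive: "additive (lderiv f)"
  unfolding lderiv_def by (rule qsh_extend_additive)

lemmas lderiv_add = additive.add[OF lderiv_additive]
  and lderiv_0 [simp] = additive.zero[OF lderiv_additive]
  and lderiv_of_int = additive_of_int[OF lderiv_additive]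

lemma qsh_eps_simps [simp]: "qsh_eps 1 = 1" "qsh_eps (pre a x) = 0"
proof -
  show "qsh_eps (pre a x) = 0"
    by (rule qsh_additive_eq[where f = "\<lambda>x. qsh_eps (pre a x)" and g = "\<lambda>_. 0"])
      (simp_all add: additive_def pre_add additive.add[OF qsh_eps_additive], simp add: qsh_eps_def)
qed (simp add: qsh_eps_def)

lemma lderiv_simps [simp]: "lderiv f 1 = 0" "lderiv f (pre a x) = of_int (f a) * x"
proof -
  show "lderiv f (pre a x) = of_int (f a) * x"
    by (rule qsh_additive_eq[where f = "\<lambda>x. lderiv f (pre a x)"])
      (simp_all add: additive_def pre_add lderiv_add distrib_left, simp add: lderiv_def)
qed (simp add: lderiv_def)

lemma lderiv_of_int_1 [simp]: "lderiv f (of_int c) = 0"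
  using lderiv_of_int[of f c 1] by simp

lemma qsh_eps_of_int [simp]: "qsh_eps (of_int c) = c"
  using additive_of_int[OF qsh_eps_additive, of c 1] by simp

lemma qsh_pre_cases [case_names one pre]:
  assumes "w = [] \<Longrightarrow> word w = 1 \<Longrightarrow> P" "\<And>a u. w = a # u \<Longrightarrow> word w = pre a (word u) \<Longrightarrow> P"
  shows P
  using assms by (cases w) (auto simp: word_Nil)

lemma qsh_eps_mult: "qsh_eps (x * y) = qsh_eps x * qsh_eps y"
proof (rule qsh_additive2_eq[where f = "\<lambda>x y. qsh_eps (x * y)"])
  fix u v :: "'a list"
  show "qsh_eps (word u * word v) = qsh_eps (word u) * qsh_eps (word v)"
    by (cases u rule: qsh_pre_cases; cases v rule: qsh_pre_cases)
      (simp_all add: pre_mult additive.add[OF qsh_eps_additive] del: pre_word)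
qed (simp_all add: additive_def additive.add[OF qsh_eps_additive] algebra_simps)

text \<open>The front letter of a product comes from x, from y, or is merged from both. In the last
  case the hypothesis, a coproduct dual to the merging of letters, splits f.\<close>

lemma lderiv_mult:
  assumes f: "\<And>a b. f (a + b) = (\<Sum>t\<in>T. s t * g t a * h t b)"
  shows "lderiv f (x * y) = lderiv f x * y + x * lderiv f y
    + (\<Sum>t\<in>T. of_int (s t) * lderiv (g t) x * lderiv (h t) y)"
proof (rule qsh_additive2_eq[where f = "\<lambda>x y. lderiv f (x * y)"])
  fix u v :: "'a list"
  show "lderiv f (word u * word v) = lderiv f (word u) * word v + word u * lderiv f (word v)
    + (\<Sum>t\<in>T. of_int (s t) * lderiv (g t) (word u) * lderiv (h t) (word v))"
    by (cases u rule: qsh_pre_cases; cases v rule: qsh_pre_cases)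
      (simp_all add: pre_mult lderiv_add f of_int_sum sum_distrib_right sum_distrib_left algebra_simps del: pre_word)
qed (simp_all add: additive_def lderiv_add algebra_simps sum.distrib)

primrec lderivs :: "('c \<Rightarrow> 'b \<Rightarrow> int) \<Rightarrow> 'c list \<Rightarrow> 'b::ab_semigroup_add qsh \<Rightarrow> 'b qsh" where
  "lderivs K [] x = x"
| "lderivs K (c # k) x = lderivs K k (lderiv (K c) x)"

text \<open>The tensor product of the functionals \<open>K c\<close>. Building it from left
  derivatives lets the product rule be used in inductions on k.\<close>

definition coef :: "('c \<Rightarrow> 'b \<Rightarrow> int) \<Rightarrow> 'c list \<Rightarrow> 'b::ab_semigroup_add qsh \<Rightarrow> int"
  where "coef K k x = qsh_eps (lderivs K k x)"

lemma lderivs_additive: "additive (lderivs K k)"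
  by (induction k) (auto simp: additive_def lderiv_add)

lemma coef_additive: "additive (coef K k)"
  unfolding coef_def by (rule additive_comp[OF qsh_eps_additive lderivs_additive])

lemma coef_Nil: "coef K [] x = qsh_eps x" and coef_Cons: "coef K (c # k) x = coef K k (lderiv (K c) x)"
  by (simp_all add: coef_def)

lemma coef_append: "coef K (k @ l) x = coef K l (lderivs K k x)"
  by (induction k arbitrary: x) (simp_all add: coef_Cons)

lemmas coef_of_int = additive_of_int[OF coef_additive]

lemma coef_word:
  "coef K k (word w) = (if length k = length w then \<Prod>i<length w. K (k ! i) (w ! i) else 0)"
proof (induction k arbitrary: w)
  case Nil
  then show ?case by (cases w) (auto simp: coef_Nil qsh_eps_def)
next
  case (Cons c k)
  show ?case
  proof (cases w rule: qsh_pre_cases)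
    case one
    then show ?thesis by (simp add: coef_Cons additive.zero[OF coef_additive])
  next
    case (pre a u)
    then show ?thesis using Cons[of u]
      by (simp add: coef_Cons coef_of_int lessThan_Suc_eq_insert_0 prod.reindex zero_notin_Suc_image
        del: prod.lessThan_Suc pre_word)
  qed
qed

section \<open>Derivations\<close>

text \<open>The derivation \<open>qsh_der f\<close> is \<open>(id \<otimes> f) \<circ> \<Delta>\<close> for the deconcatenation coproduct \<open>\<Delta>\<close>.\<close>

primrec word_der :: "('b qsh \<Rightarrow> int) \<Rightarrow> 'b::ab_semigroup_add list \<Rightarrow> 'b qsh" where
  "word_der f [] = 0"
| "word_der f (a # w) = pre a (word_der f w) + of_int (f (word (a # w)))"

definition qsh_der :: "('b qsh \<Rightarrow> int) \<Rightarrow> 'b::ab_semigroup_add qsh \<Rightarrow> 'b qsh"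
  where "qsh_der f = qsh_extend (word_der f)"

lemma qsh_der_additive: "additive (qsh_der f)"
  unfolding qsh_der_def by (rule qsh_extend_additive)

lemmas qsh_der_add = additive.add[OF qsh_der_additive]
  and qsh_der_of_int = additive_of_int[OF qsh_der_additive]

lemma qsh_der_1 [simp]: "qsh_der f 1 = 0" by (simp add: qsh_der_def)

lemma qsh_der_pre:
  assumes f: "additive f"
  shows "qsh_der f (pre a x) = pre a (qsh_der f x) + of_int (f (pre a x))"
proof (rule qsh_additive_eq[where f = "\<lambda>x. qsh_der f (pre a x)"])
  show "additive (\<lambda>x. qsh_der f (pre a x))"
    by (rule additive_comp[OF qsh_der_additive pre_additive])
  show "additive (\<lambda>x. pre a (qsh_der f x) + of_int (f (pre a x)))"
    using f by (simp add: additive_def qsh_der_add pre_add)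
qed (simp add: qsh_der_def)

text \<open>The coproduct is multiplicative, so (id \<otimes> f) after it obeys the Leibniz rule
  when f kills products of two elements of the augmentation ideal; that ideal is spanned by elements
  \<open>pre a x\<close>.\<close>

lemma qsh_der_mult:
  assumes f: "additive f" and dec: "\<And>a x b y. f (pre a x * pre b y) = 0"
  shows "qsh_der f (x * y) = qsh_der f x * y + x * qsh_der f y"
proof (rule qsh_additive2_eq[where f = "\<lambda>x y. qsh_der f (x * y)"])
  fix u v :: "'a list"
  show "qsh_der f (word u * word v) = qsh_der f (word u) * word v + word u * qsh_der f (word v)"
  proof (induction u v rule: qs_words.induct)
    case (3 a u b v)
    define U V where "U = word u" and "V = word v"
    define D where "D = qsh_der f"
    have D: "D (x + y) = D x + D y" "D (pre c x) = pre c (D x) + of_int (f (pre c x))" for x y c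
      by (simp_all add: D_def qsh_der_add qsh_der_pre[OF f])
    have IH: "D (U * pre b V) = D U * pre b V + U * D (pre b V)"
      "D (pre a U * V) = D (pre a U) * V + pre a U * D V" "D (U * V) = D U * V + U * D V"
      using 3 by (simp_all add: D_def U_def V_def)
    \<comment> \<open>These are the scalar terms that \<open>qsh_der\<close> produces from the three
      parts of the product; together they are f of the product.\<close>
    have "f (pre a (U * pre b V)) + f (pre b (pre a U * V)) + f (pre (a + b) (U * V)) = 0"
      using dec[of a U b V] by (simp add: pre_mult additive.add[OF f])
    then have "of_int (f (pre a (U * pre b V)) + f (pre b (pre a U * V)) + f (pre (a + b) (U * V))) = (0 :: 'a qsh)"
      by simp
    then have f0: "of_int (f (pre a (U * pre b V))) + of_int (f (pre b (pre a U * V)))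
        + of_int (f (pre (a + b) (U * V))) = (0 :: 'a qsh)"
      by simp
    have "D (pre a U * pre b V) = pre a (D (U * pre b V)) + pre b (D (pre a U * V)) + pre (a + b) (D (U * V))"
      using f0 by (simp add: pre_mult D add_ac)
    also have "\<dots> = D (pre a U) * pre b V + pre a U * D (pre b V)"
    proof -
      define \<alpha> \<beta> where "\<alpha> = f (pre a U)" and "\<beta> = f (pre b V)"
      have "pre a (U * (pre b (D V) + of_int \<beta>)) = pre a (U * pre b (D V)) + of_int \<beta> * pre a U"
        "pre b ((pre a (D U) + of_int \<alpha>) * V) = pre b (pre a (D U) * V) + of_int \<alpha> * pre b V"
        by (simp_all add: distrib_left distrib_right pre_add pre_of_int mult.commute[of _ "of_int _"])
      moreover have "(pre a (D U) + of_int \<alpha>) * pre b V =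
          pre a (D U * pre b V) + pre b (pre a (D U) * V) + pre (a + b) (D U * V) + of_int \<alpha> * pre b V"
        "pre a U * (pre b (D V) + of_int \<beta>) =
          pre a (U * pre b (D V)) + pre b (pre a U * D V) + pre (a + b) (U * D V) + of_int \<beta> * pre a U"
        by (simp_all only: distrib_left distrib_right pre_mult mult.commute[of _ "of_int _"])
      ultimately show ?thesis
        unfolding IH D \<alpha>_def[symmetric] \<beta>_def[symmetric] pre_add by simp
    qed
    finally show ?case by (simp add: D_def U_def V_def)
  qed (simp_all add: word_Nil)
qed (simp_all add: additive_def qsh_der_add algebra_simps)

text \<open>Coassociativity: one operator acts on the left end of a word, the other on the right
  end.\<close>

lemma lderiv_qsh_der:
  assumes f: "additive f"
  shows "lderiv g (qsh_der f x) = qsh_der f (lderiv g x)"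
proof (rule qsh_additive_eq[where f = "\<lambda>x. lderiv g (qsh_der f x)"])
  fix w
  show "lderiv g (qsh_der f (word w)) = qsh_der f (lderiv g (word w))"
    by (cases w rule: qsh_pre_cases)
      (simp_all add: qsh_der_pre[OF f] lderiv_add qsh_der_of_int additive.zero[OF qsh_der_additive] del: pre_word)
qed (auto intro!: additive_comp[OF lderiv_additive qsh_der_additive] additive_comp[OF qsh_der_additive lderiv_additive])

lemma qsh_eps_qsh_der:
  assumes f: "additive f" and "f 1 = 0"
  shows "qsh_eps (qsh_der f x) = f x"
proof (rule qsh_additive_eq[where f = "\<lambda>x. qsh_eps (qsh_der f x)"])
  fix w
  show "qsh_eps (qsh_der f (word w)) = f (word w)"
    by (cases w rule: qsh_pre_cases)
      (simp_all add: assms qsh_der_pre[OF f] additive.add[OF qsh_eps_additive] additive.zero[OF qsh_eps_additive]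
        del: pre_word)
qed (auto intro!: f additive_comp[OF qsh_eps_additive qsh_der_additive])

text \<open>Reduces every coordinate of \<open>qsh_der f x\<close> to a value of f on a left
  derivative of x, where degrees can be compared.\<close>

lemma coef_qsh_der:
  assumes f: "additive f" "f 1 = 0"
  shows "coef K k (qsh_der f x) = f (lderivs K k x)"
proof (induction k arbitrary: x)
  case Nil show ?case by (simp add: coef_Nil qsh_eps_qsh_der[OF f])
next
  case (Cons c k) then show ?case by (simp add: coef_Cons lderiv_qsh_der[OF f(1)])
qed

section \<open>Dual systems\<close>

text \<open>Vectors independent over the field with p elements have dual functionals; Gaussian
  elimination, one vector of S at a time.\<close>

lemma left_inverse_mod_prime:
  fixes v :: "'i \<Rightarrow> 'd \<Rightarrow> int"
  assumes p: "Factorial_Ring.prime p" and "finite S" "finite T"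
    and indep: "\<And>c. (\<And>d. d \<in> T \<Longrightarrow> int p dvd (\<Sum>i\<in>S. c i * v i d)) \<Longrightarrow> (\<And>i. i \<in> S \<Longrightarrow> int p dvd c i)"
  shows "\<exists>g. \<forall>i\<in>S. \<forall>j\<in>S. int p dvd (\<Sum>d\<in>T. g i d * v j d) - (if i = j then 1 else 0)"
  using \<open>finite S\<close> indep
proof (induction S)
  case empty then show ?case by simp
next
  case (insert k S)
  have indep: "int p dvd c i" if "\<And>d. d \<in> T \<Longrightarrow> int p dvd (\<Sum>i\<in>S. c i * v i d)" "i \<in> S" for c i
  proof -
    have "int p dvd (c(k := 0)) i"
    proof (rule insert.prems)
      fix d assume "d \<in> T"
      have "(\<Sum>i\<in>insert k S. (c(k := 0)) i * v i d) = (\<Sum>i\<in>S. c i * v i d)"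
        using insert.hyps by (simp, intro sum.cong) auto
      then show "int p dvd (\<Sum>i\<in>insert k S. (c(k := 0)) i * v i d)"
        using that(1)[OF \<open>d \<in> T\<close>] by simp
    qed (use that in simp)
    then show ?thesis using that insert.hyps by (auto split: if_splits)
  qed
  have "\<exists>g. \<forall>i\<in>S. \<forall>j\<in>S. int p dvd (\<Sum>d\<in>T. g i d * v j d) - (if i = j then 1 else 0)"
    by (rule insert.IH) (rule indep)
  then obtain g
    where g: "\<And>i j. i \<in> S \<Longrightarrow> j \<in> S \<Longrightarrow> int p dvd (\<Sum>d\<in>T. g i d * v j d) - (if i = j then 1 else 0)"
    by blast
  define pair where "pair a b = (\<Sum>d\<in>T. a d * b d)" for a b :: "'d \<Rightarrow> int"
  define \<gamma> where "\<gamma> i = pair (g i) (v k)" for i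
  \<comment> \<open>The residue of \<open>v k\<close> after removing its components along the
    earlier vectors. Independence gives it a coordinate t that is a unit modulo p.\<close>
  define w where "w d = v k d - (\<Sum>i\<in>S. \<gamma> i * v i d)" for d
  have "\<exists>t\<in>T. \<not> int p dvd w t"
  proof (rule ccontr)
    assume "\<not> (\<exists>t\<in>T. \<not> int p dvd w t)"
    then have all: "int p dvd w d" if "d \<in> T" for d using that by blast
    have "int p dvd ((\<lambda>i. - \<gamma> i)(k := 1)) k"
    proof (rule insert.prems[where c = "(\<lambda>i. - \<gamma> i)(k := 1)" and i = k])
      fix d assume "d \<in> T"
      have "(\<Sum>i\<in>S. ((\<lambda>i. - \<gamma> i)(k := 1)) i * v i d) = - (\<Sum>i\<in>S. \<gamma> i * v i d)"
        unfolding sum_negf[symmetric] by (rule sum.cong) (use insert.hyps in auto)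
      then have "(\<Sum>i\<in>insert k S. ((\<lambda>i. - \<gamma> i)(k := 1)) i * v i d) = w d"
        using insert.hyps by (simp add: w_def)
      then show "int p dvd (\<Sum>i\<in>insert k S. ((\<lambda>i. - \<gamma> i)(k := 1)) i * v i d)"
        using all[OF \<open>d \<in> T\<close>] by simp
    qed simp
    then show False using p by (simp add: prime_nat_iff)
  qed
  then obtain t where t: "t \<in> T" "\<not> int p dvd w t" by blast
  have "coprime (int p) (w t)"
    using t p by (intro prime_imp_coprime) auto
  then obtain q r where "q * w t + r * int p = 1"
    using bezout_int[of "w t" "int p"] by (auto simp: coprime_iff_gcd_eq_1 gcd.commute)
  then have q: "int p dvd q * w t - 1"
    by (metis add_diff_cancel_left' diff_add_cancel dvd_minus_iff dvd_triv_right minus_diff_eq)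
  \<comment> \<open>Coordinate t of the residue, scaled by the inverse q of \<open>w t\<close>
    modulo p: it takes the value 1 on \<open>v k\<close> and 0 on the earlier vectors.\<close>
  define h where "h d = q * ((if d = t then 1 else 0) - (\<Sum>i\<in>S. v i t * g i d))" for d
  have pair_h: "pair h b = q * (b t - (\<Sum>i\<in>S. v i t * pair (g i) b))" for b
  proof -
    have "pair h b = q * ((\<Sum>d\<in>T. (if d = t then 1 else 0) * b d) - (\<Sum>d\<in>T. \<Sum>i\<in>S. v i t * (g i d * b d)))"
      by (simp add: pair_def h_def sum_distrib_left sum_distrib_right sum_subtractf algebra_simps)
    also have "(\<Sum>d\<in>T. (if d = t then 1 else 0) * b d) = b t"
      using t \<open>finite T\<close> by (simp add: if_distrib[of "\<lambda>x. x * _"] cong: if_cong)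
    also have "(\<Sum>d\<in>T. \<Sum>i\<in>S. v i t * (g i d * b d)) = (\<Sum>i\<in>S. v i t * pair (g i) b)"
      unfolding pair_def sum_distrib_left by (rule sum.swap)
    finally show ?thesis .
  qed
  have hk: "int p dvd pair h (v k) - 1"
    using q by (simp add: pair_h \<gamma>_def[symmetric] w_def mult.commute)
  have hj: "int p dvd pair h (v j)" if "j \<in> S" for j
  proof -
    have "(\<Sum>i\<in>S. v i t * (if i = j then 1 else 0)) = v j t"
      using that insert.hyps by (simp add: if_distrib[of "\<lambda>x. _ * x"] cong: if_cong)
    then have "v j t - (\<Sum>i\<in>S. v i t * pair (g i) (v j)) = - (\<Sum>i\<in>S. v i t * (pair (g i) (v j) - (if i = j then 1 else 0)))"
      by (simp add: right_diff_distrib sum_subtractf)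
    moreover have "int p dvd (\<Sum>i\<in>S. v i t * (pair (g i) (v j) - (if i = j then 1 else 0)))"
      unfolding pair_def by (intro dvd_sum dvd_mult g that)
    ultimately show ?thesis by (simp add: pair_h)
  qed
  \<comment> \<open>A multiple of h is subtracted so that the earlier functionals vanish on
    \<open>v k\<close>; their values on the earlier vectors do not change modulo p.\<close>
  define g' where "g' i = (if i = k then h else (\<lambda>d. g i d - \<gamma> i * h d))" for i
  have g'S: "pair (g' i) b = pair (g i) b - \<gamma> i * pair h b" if "i \<in> S" for i b
    using that insert.hyps
    by (auto simp: g'_def pair_def left_diff_distrib sum_subtractf sum_distrib_left mult.assoc)
  have "int p dvd pair (g' i) (v j) - (if i = j then 1 else 0)" if ij: "i \<in> insert k S" "j \<in> insert k S" for i j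
  proof (cases "i = k")
    case True
    then show ?thesis using ij hk hj insert.hyps by (auto simp: g'_def)
  next
    case False
    then have i: "i \<in> S" using ij by simp
    show ?thesis
    proof (cases "j = k")
      case True
      have "pair (g' i) (v j) - (if i = j then 1 else 0) = - (\<gamma> i * (pair h (v k) - 1))"
        using True False i by (simp add: g'S \<gamma>_def algebra_simps)
      then show ?thesis using hk by simp
    next
      case False
      then have j: "j \<in> S" using ij by simp
      have "int p dvd (pair (g i) (v j) - (if i = j then 1 else 0)) - \<gamma> i * pair h (v j)"
        using dvd_diff[OF g[OF i j] dvd_mult[OF hj[OF j], of "\<gamma> i"]] unfolding pair_def .
      then show ?thesis by (simp add: g'S[OF i] algebra_simps)
    qed
  qed
  then show ?case unfolding pair_def by blast
qed

text \<open>Rational elimination with denominators cleared: V spans D rationally modulo the joint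
  kernel of C, g gives the coordinates, and M is the common denominator. A new functional c is
  handled by first treating the part of D on which c vanishes.\<close>

lemma annihilator_functionals:
  fixes C :: "('r::comm_ring_1 \<Rightarrow> int) set"
  assumes "finite C" "\<And>c. c \<in> C \<Longrightarrow> additive c"
    and "0 \<in> D" "\<And>x y. x \<in> D \<Longrightarrow> y \<in> D \<Longrightarrow> x - y \<in> D"
  shows "\<exists>(M::int) V g. M \<noteq> 0 \<and> finite V \<and> V \<subseteq> D \<and> (\<forall>v. additive (g v)) \<and>
    (\<forall>v x. (\<forall>c\<in>C. c x = 0) \<longrightarrow> g v x = (0::int)) \<and>
    (\<forall>d\<in>D. \<forall>c\<in>C. c (of_int M * d - (\<Sum>v\<in>V. of_int (g v d) * v)) = 0)"
  using assms
proof (induction C arbitrary: D rule: finite_induct)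
  case empty
  show ?case
    by (rule exI[of _ 1], rule exI[of _ "{}"], rule exI[of _ "\<lambda>_ _. 0"]) (simp add: additive_def)
next
  case (insert c C)
  interpret c: additive c by (rule insert.prems) simp
  have closed_of_int: "of_int m * x \<in> D" if "x \<in> D" for m x
  proof -
    have neg: "- y \<in> D" if "y \<in> D" for y using insert.prems(3)[OF insert.prems(2) that] by simp
    have "of_nat n * x \<in> D" for n
    proof (induction n)
      case (Suc n) then show ?case using insert.prems(3)[OF Suc neg[OF that]] by (simp add: algebra_simps)
    qed (simp add: insert.prems)
    then show ?thesis using neg by (cases m rule: int_cases2) auto
  qed
  define D0 where "D0 = {d\<in>D. c d = 0}"
  have "\<exists>(M::int) V g. M \<noteq> 0 \<and> finite V \<and> V \<subseteq> D0 \<and> (\<forall>v. additive (g v)) \<and>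
    (\<forall>v x. (\<forall>c\<in>C. c x = 0) \<longrightarrow> g v x = 0) \<and>
    (\<forall>d\<in>D0. \<forall>c\<in>C. c (of_int M * d - (\<Sum>v\<in>V. of_int (g v d) * v)) = 0)"
    (is "\<exists>M V g. ?P M V g")
    by (rule insert.IH) (use insert.prems in \<open>auto simp: D0_def c.zero c.diff\<close>)
  then obtain M V g where P: "?P M V g" by (elim exE)
  have M: "M \<noteq> 0" and V: "finite V" "V \<subseteq> D0" and g: "\<And>v. additive (g v)"
    "\<And>v x. (\<forall>c\<in>C. c x = 0) \<Longrightarrow> g v x = 0"
    and eq: "\<And>d c. d \<in> D0 \<Longrightarrow> c \<in> C \<Longrightarrow> c (of_int M * d - (\<Sum>v\<in>V. of_int (g v d) * v)) = 0"
    using P by blast+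
  have cV: "c (\<Sum>v\<in>V. of_int (a v) * v) = 0" for a
    using V by (auto simp: c.sum additive_of_int[OF c.additive_axioms] D0_def intro!: sum.neutral)
  show ?case
  proof (cases "D = D0")
    case True
    have "c (of_int M * d - (\<Sum>v\<in>V. of_int (g v d) * v)) = 0" if "d \<in> D" for d
    proof -
      have "d \<in> D0" using that True by blast
      then have "c d = 0" by (simp add: D0_def)
      then show ?thesis unfolding c.diff cV by (simp add: additive_of_int[OF c.additive_axioms])
    qed
    then have "\<forall>d\<in>D. \<forall>f\<in>insert c C. f (of_int M * d - (\<Sum>v\<in>V. of_int (g v d) * v)) = 0"
      using True eq by blast
    moreover have "\<forall>v x. (\<forall>f\<in>insert c C. f x = 0) \<longrightarrow> g v x = 0" using g(2) by blast
    ultimately show ?thesis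
      using True M V g(1) by (intro exI[of _ M] exI[of _ V] exI[of _ g] conjI) blast+
  next
    case False
    then obtain z where z: "z \<in> D" "c z \<noteq> 0" by (auto simp: D0_def)
    \<comment> \<open>Cross-multiplication with z moves D into the kernel of c without division; the
      factor \<open>c z\<close> reappears in the new denominator.\<close>
    define r where "r x = of_int (c z) * x - of_int (c x) * z" for x
    have r_add: "additive r" by (simp add: additive_def r_def c.add algebra_simps)
    have r0: "r d \<in> D0" if "d \<in> D" for d
      using that z by (auto simp: r_def D0_def c.diff additive_of_int[OF c.additive_axioms]
          intro!: insert.prems closed_of_int)
    have zV: "z \<notin> V" using z V by (auto simp: D0_def)
    define g' where "g' v x = (if v = z then M * c x else g v (r x))" for v x
    have eq': "of_int (M * c z) * d - (\<Sum>v\<in>insert z V. of_int (g' v d) * v)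
        = of_int M * r d - (\<Sum>v\<in>V. of_int (g v (r d)) * v)" for d
    proof -
      have "(\<Sum>v\<in>V. of_int (g' v d) * v) = (\<Sum>v\<in>V. of_int (g v (r d)) * v)"
        by (rule sum.cong) (use zV in \<open>auto simp: g'_def\<close>)
      then show ?thesis using V zV by (simp add: g'_def r_def algebra_simps)
    qed
    show ?thesis
    proof (intro exI conjI allI ballI impI)
      show "M * c z \<noteq> 0" using M z by simp
      show "finite (insert z V)" "insert z V \<subseteq> D" using V z by (auto simp: D0_def)
      show "additive (g' v)" for v
        unfolding g'_def using additive_comp[OF g(1) r_add, of v]
        by (cases "v = z") (simp_all add: additive_def c.add algebra_simps)
      show "g' v x = 0" if "\<forall>c\<in>insert c C. c x = 0" for v x
        using that g(2)[of "r x" v] insert.prems(1)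
        by (auto simp: g'_def r_def additive_of_int additive.diff)
      show "f (of_int (M * c z) * d - (\<Sum>v\<in>insert z V. of_int (g' v d) * v)) = 0"
        if "d \<in> D" "f \<in> insert c C" for d f
        unfolding eq' using that eq[OF r0[OF that(1)]] r0[OF that(1)]
        by (auto simp: c.diff cV additive_of_int[OF c.additive_axioms] D0_def)
    qed
  qed
qed

text \<open>E consists of the defects of the rational expansion in D. A common zero of E is an
  element with a nonzero multiple in D, modulo the joint kernel of C; torsion modulo D is invisible
  to E.\<close>

lemma annihilator_exists:
  fixes C :: "('r::comm_ring_1 \<Rightarrow> int) set"
  assumes C: "finite C" "\<And>c. c \<in> C \<Longrightarrow> additive c"
    and D: "0 \<in> D" "\<And>x y. x \<in> D \<Longrightarrow> y \<in> D \<Longrightarrow> x - y \<in> D"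
  shows "\<exists>E :: ('r \<Rightarrow> int) set. finite E \<and> (\<forall>\<eta>\<in>E. additive \<eta>) \<and>
    (\<forall>\<eta>\<in>E. \<forall>d\<in>D. \<eta> d = 0) \<and> (\<forall>\<eta>\<in>E. \<forall>x. (\<forall>c\<in>C. c x = 0) \<longrightarrow> \<eta> x = 0) \<and>
    (\<forall>x. (\<forall>\<eta>\<in>E. \<eta> x = 0) \<longrightarrow> (\<exists>d\<in>D. \<exists>M::int. M \<noteq> 0 \<and> (\<forall>c\<in>C. c (of_int M * x - d) = 0)))"
proof -
  have "\<exists>(M::int) V g. M \<noteq> 0 \<and> finite V \<and> V \<subseteq> D \<and> (\<forall>v. additive (g v)) \<and>
    (\<forall>v x. (\<forall>c\<in>C. c x = 0) \<longrightarrow> g v x = (0::int)) \<and>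
    (\<forall>d\<in>D. \<forall>c\<in>C. c (of_int M * d - (\<Sum>v\<in>V. of_int (g v d) * v)) = 0)"
    (is "\<exists>M V g. ?P M V g")
    by (rule annihilator_functionals) (use C D in auto)
  then obtain M :: int and V and g :: "'r \<Rightarrow> 'r \<Rightarrow> int" where P: "?P M V g" by (elim exE)
  have M: "M \<noteq> 0" and V: "finite V" "V \<subseteq> D"
    and g: "\<And>v. additive (g v)" "\<And>v x. (\<forall>c\<in>C. c x = 0) \<Longrightarrow> g v x = 0"
    and eq: "\<And>d c. d \<in> D \<Longrightarrow> c \<in> C \<Longrightarrow> c (of_int M * d - (\<Sum>v\<in>V. of_int (g v d) * v)) = 0"
    using P by blast+
  define s where "s x = (\<Sum>v\<in>V. of_int (g v x) * v)" for x
  have r_add: "additive (\<lambda>x. of_int M * x - s x)"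
    by (simp add: s_def additive_def additive.add[OF g(1)] algebra_simps sum.distrib)
  have neg: "- y \<in> D" if "y \<in> D" for y using D(2)[OF D(1) that] by simp
  have add: "x + y \<in> D" if "x \<in> D" "y \<in> D" for x y using D(2)[OF that(1) neg[OF that(2)]] by simp
  have mult: "of_int m * x \<in> D" if "x \<in> D" for m x
  proof -
    have "of_nat n * x \<in> D" for n
      by (induction n) (auto simp: D distrib_right add that)
    then show ?thesis using neg by (cases m rule: int_cases2) auto
  qed
  have sD: "s x \<in> D" for x
    unfolding s_def using V(1,2) by (induction V rule: finite_induct) (auto simp: D(1) add mult)
  show ?thesis
  proof (intro exI[of _ "(\<lambda>c x. c (of_int M * x - s x)) ` C"] conjI ballI allI impI, goal_cases)
    case 1 then show ?case using C by simp
  next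
    case (2 \<eta>) then show ?case using additive_comp[OF C(2) r_add] by auto
  next
    case (3 \<eta> d) then show ?case using eq by (auto simp: s_def)
  next
    case (4 \<eta> x)
    then have "s x = 0" using g(2)[of x] by (simp add: s_def)
    then show ?case using 4 C(2) by (auto simp: additive_of_int)
  next
    case (5 x) then show ?case using sD M by (intro bexI[of _ "s x"]) auto
  qed
qed

text \<open>The values on E map the ring onto a subgroup of a finitely generated free group, which
  is free itself; Y lifts a basis of it into M and \<xi> is the dual basis. Each further functional
  adds at most one basis element.\<close>

lemma dual_system_exists:
  fixes E :: "('r::comm_ring_1 \<Rightarrow> int) set"
  assumes "finite E" "\<And>\<eta>. \<eta> \<in> E \<Longrightarrow> additive \<eta>"
    and "\<And>x. \<exists>y\<in>M. \<forall>\<eta>\<in>E. \<eta> x = \<eta> y"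
  shows "\<exists>Y (\<xi> :: 'r \<Rightarrow> 'r \<Rightarrow> int). finite Y \<and> Y \<subseteq> M \<and> (\<forall>x. additive (\<xi> x)) \<and>
    (\<forall>x\<in>Y. \<forall>y\<in>Y. \<xi> x y = (if x = y then 1 else 0)) \<and>
    (\<forall>x y. (\<forall>\<eta>\<in>E. \<eta> y = 0) \<longrightarrow> \<xi> x y = 0) \<and>
    (\<forall>y. \<forall>\<eta>\<in>E. \<eta> (y - (\<Sum>x\<in>Y. of_int (\<xi> x y) * x)) = 0)"
  using assms
proof (induction E rule: finite_induct)
  case empty
  show ?case by (rule exI[of _ "{}"], rule exI[of _ "\<lambda>_ _. 0"]) (simp add: additive_def)
next
  case (insert \<eta> E)
  interpret \<eta>: additive \<eta> by (rule insert.prems) simp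
  have "\<exists>Y (\<xi> :: 'r \<Rightarrow> 'r \<Rightarrow> int). finite Y \<and> Y \<subseteq> M \<and> (\<forall>x. additive (\<xi> x)) \<and>
    (\<forall>x\<in>Y. \<forall>y\<in>Y. \<xi> x y = (if x = y then 1 else 0)) \<and>
    (\<forall>x y. (\<forall>\<eta>\<in>E. \<eta> y = 0) \<longrightarrow> \<xi> x y = 0) \<and>
    (\<forall>y. \<forall>\<eta>\<in>E. \<eta> (y - (\<Sum>x\<in>Y. of_int (\<xi> x y) * x)) = 0)"
    (is "\<exists>a b. ?P a b")
    by (rule insert.IH) (use insert.prems in \<open>auto, metis\<close>)
  then obtain Y and \<xi> :: "'r \<Rightarrow> 'r \<Rightarrow> int" where P: "?P Y \<xi>" by (elim exE)
  have Y: "finite Y" "Y \<subseteq> M" and \<xi>: "\<And>x. additive (\<xi> x)"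
    and dual: "\<And>x y. x \<in> Y \<Longrightarrow> y \<in> Y \<Longrightarrow> \<xi> x y = (if x = y then 1 else 0)"
    and kill: "\<And>x y. (\<forall>\<eta>\<in>E. \<eta> y = 0) \<Longrightarrow> \<xi> x y = 0"
    and res: "\<And>y \<eta>. \<eta> \<in> E \<Longrightarrow> \<eta> (y - (\<Sum>x\<in>Y. of_int (\<xi> x y) * x)) = 0"
    using P by blast+
  define r where "r y = y - (\<Sum>x\<in>Y. of_int (\<xi> x y) * x)" for y
  have r_add: "additive r"
    by (simp add: additive_def r_def additive.add[OF \<xi>] algebra_simps sum.distrib)
  have \<eta>r_add: "additive (\<lambda>y. \<eta> (r y))" by (rule additive_comp[OF \<eta>.additive_axioms r_add])
  have rY: "r x = 0" if "x \<in> Y" for x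
  proof -
    have "(\<Sum>y\<in>Y. of_int (\<xi> y x) * y) = (\<Sum>y\<in>Y. if y = x then y else 0)"
      by (rule sum.cong) (use that dual in auto)
    then show ?thesis using that Y by (simp add: r_def)
  qed
  have r_kill: "r y = y" if "\<forall>\<eta>\<in>E. \<eta> y = 0" for y
    using kill[OF that] by (simp add: r_def)
  show ?case
  proof (cases "\<forall>y. \<eta> (r y) = 0")
    case True
    then show ?thesis
      using Y \<xi> dual kill res by (intro exI[of _ Y] exI[of _ \<xi>]) (auto simp: r_def)
  next
    case False
    then obtain y0 where "\<eta> (r y0) \<noteq> 0" by blast
    then have "\<exists>d>0. \<exists>y. \<eta> (r y) = int d"
      by (cases "\<eta> (r y0)" rule: int_cases2)
        (force, metis (no_types, lifting) \<eta>r_add additive.minus minus_minus neg_0_equal_iff_equal of_nat_0 neq0_conv)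
    \<comment> \<open>The values of \<eta> on the residues \<open>r y\<close> form an ideal of the
      integers, and d is its positive generator; division by d gives the new coordinate.\<close>
    define d where "d = (LEAST d. d > 0 \<and> (\<exists>y. \<eta> (r y) = int d))"
    have d: "d > 0" "\<exists>y. \<eta> (r y) = int d"
      using LeastI_ex[of "\<lambda>d. d > 0 \<and> (\<exists>y. \<eta> (r y) = int d)"] \<open>\<exists>d>0. _\<close> by (auto simp: d_def)
    then obtain y1 where y1: "\<eta> (r y1) = int d" by blast
    have dvd: "int d dvd \<eta> (r y)" for y
    proof (rule ccontr)
      assume "\<not> int d dvd \<eta> (r y)"
      then have m: "\<eta> (r y) mod int d \<noteq> 0" by (simp add: dvd_eq_mod_eq_0)
      define k where "k = nat (\<eta> (r y) mod int d)"
      have k: "0 < k" "k < d" 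
        using m d(1) pos_mod_sign[of "int d" "\<eta> (r y)"] pos_mod_bound[of "int d" "\<eta> (r y)"]
        by (auto simp: k_def nat_less_iff)
      have "\<eta> (r (y - of_int (\<eta> (r y) div int d) * y1)) = \<eta> (r y) - (\<eta> (r y) div int d) * int d"
        by (simp add: additive.diff[OF \<eta>r_add] additive_of_int[OF \<eta>r_add] y1)
      also have "\<dots> = int k" using d(1) by (simp add: k_def minus_div_mult_eq_mod)
      finally have "d \<le> k" unfolding d_def using k by (intro Least_le) blast
      then show False using k by simp
    qed
    \<comment> \<open>The residue \<open>r y1\<close> need not lie in M, so it is exchanged for an
      element of M with the same values.\<close>
    obtain x where x: "x \<in> M" "\<forall>f\<in>insert \<eta> E. f (r y1) = f x" using insert.prems(2)[of "r y1"] by blast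
    have xE: "\<forall>f\<in>E. f x = 0"
    proof
      fix f assume "f \<in> E"
      then have "f (r y1) = f x" "f (r y1) = 0" using x(2) res[of f y1] by (auto simp: r_def)
      then show "f x = 0" by simp
    qed
    have \<eta>x: "\<eta> x = int d" using x y1 by simp
    have xY: "x \<notin> Y" using rY[of x] r_kill[OF xE] \<eta>x d(1) by (auto simp: \<eta>.zero)
    define \<xi>' where "\<xi>' z y = (if z = x then \<eta> (r y) div int d else \<xi> z y)" for z y
    have div_eq: "(\<eta> (r y) div int d) * int d = \<eta> (r y)" for y using dvd[of y] by simp
    have sum_eq: "y - (\<Sum>z\<in>insert x Y. of_int (\<xi>' z y) * z) = r y - of_int (\<eta> (r y) div int d) * x" for y
    proof -
      have "(\<Sum>z\<in>Y. of_int (\<xi>' z y) * z) = (\<Sum>z\<in>Y. of_int (\<xi> z y) * z)"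
        by (rule sum.cong) (use xY in \<open>auto simp: \<xi>'_def\<close>)
      then show ?thesis using Y xY by (simp add: \<xi>'_def r_def algebra_simps)
    qed
    show ?thesis
    proof (intro exI conjI allI ballI impI)
      show "finite (insert x Y)" "insert x Y \<subseteq> M" using Y x by auto
      show "additive (\<xi>' z)" for z
      proof (cases "z = x")
        case True
        have "\<eta> (r (a + b)) div int d = \<eta> (r a) div int d + \<eta> (r b) div int d" for a b
          using dvd[of b] by (simp add: additive.add[OF \<eta>r_add] div_add dvd)
        then show ?thesis using True by (simp add: additive_def \<xi>'_def)
      qed (simp add: \<xi>'_def[abs_def] \<xi>)
      show "\<xi>' z y = (if z = y then 1 else 0)" if "z \<in> insert x Y" "y \<in> insert x Y" for z y
        using that xY dual[of z y] rY[of y] kill[OF xE, of z] r_kill[OF xE] \<eta>x d(1) by (auto simp: \<xi>'_def \<eta>.zero)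
      show "\<xi>' z y = 0" if "\<forall>f\<in>insert \<eta> E. f y = 0" for z y
        using that kill[of y z] r_kill[of y] by (auto simp: \<xi>'_def)
      show "f (y - (\<Sum>z\<in>insert x Y. of_int (\<xi>' z y) * z)) = 0" if f: "f \<in> insert \<eta> E" for y f
      proof (cases "f = \<eta>")
        case True
        then show ?thesis
          by (simp add: sum_eq \<eta>.diff additive_of_int[OF \<eta>.additive_axioms] \<eta>x div_eq)
      next
        case False
        then have "f \<in> E" "additive f" using f insert.prems(1) by auto
        then show ?thesis
          using xE res[of f y] by (simp add: sum_eq additive.diff additive_of_int r_def)
      qed
    qed
  qed
qed

section \<open>Evaluation of polynomials\<close>

definition eval_mono :: "('i \<Rightarrow> 'r) \<Rightarrow> ('i \<Rightarrow>\<^sub>0 nat) \<Rightarrow> 'r::comm_ring_1"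
  where "eval_mono e m = (\<Prod>i\<in>keys m. e i ^ lookup m i)"

lemma eval_mono_superset:
  assumes "finite S" "keys m \<subseteq> S"
  shows "eval_mono e m = (\<Prod>i\<in>S. e i ^ lookup m i)"
  unfolding eval_mono_def
  by (rule prod.mono_neutral_left) (use assms in \<open>auto simp: in_keys_iff\<close>)

lemma eval_mono_0 [simp]: "eval_mono e 0 = 1" by (simp add: eval_mono_def)

lemma eval_mono_add: "eval_mono e (m + n) = eval_mono e m * eval_mono e n"
proof -
  let ?S = "keys m \<union> keys n"
  have "keys (m + n) \<subseteq> ?S" by (rule keys_add)
  then show ?thesis
    by (subst (1 2 3) eval_mono_superset[where S = ?S]) (auto simp: lookup_add power_add prod.distrib)
qed

lemma eval_mono_single [simp]: "eval_mono e (single i (Suc 0)) = e i"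
  by (simp add: eval_mono_def)

definition poly_eval :: "('i \<Rightarrow> 'r) \<Rightarrow> (('i \<Rightarrow>\<^sub>0 nat) \<Rightarrow>\<^sub>0 int) \<Rightarrow> 'r::comm_ring_1"
  where "poly_eval e = int_extend (eval_mono e)"

lemma poly_eval_additive: "additive (poly_eval e)"
  unfolding poly_eval_def by (rule int_extend_additive)

lemmas poly_eval_add = additive.add[OF poly_eval_additive]
  and poly_eval_0 [simp] = additive.zero[OF poly_eval_additive]
  and poly_eval_diff = additive.diff[OF poly_eval_additive]
  and poly_eval_sum = additive.sum[OF poly_eval_additive]

lemma poly_eval_frag_of [simp]: "poly_eval e (frag_of m) = eval_mono e m"
  by (simp add: poly_eval_def)

lemma poly_eval_frag_cmul: "poly_eval e (frag_cmul c f) = of_int c * poly_eval e f"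
  by (simp add: poly_eval_def int_extend_frag_cmul)

lemma frag_of_mult: "frag_of m * frag_of n = frag_of (m + n)"
  by (simp add: mult_single)

lemma poly_eval_1 [simp]: "poly_eval e 1 = 1"
  using poly_eval_frag_of[of e 0] by simp

lemma poly_eval_mult: "poly_eval e (f * g) = poly_eval e f * poly_eval e g"
  using subset_UNIV[of "keys f"]
proof (induction f rule: frag_induction)
  case (one m)
  show ?case
    using subset_UNIV[of "keys g"]
  proof (induction g rule: frag_induction)
    case (one n) then show ?case by (simp only: frag_of_mult poly_eval_frag_of eval_mono_add)
  qed (simp_all add: right_diff_distrib poly_eval_diff)
qed (simp_all add: left_diff_distrib poly_eval_diff)

lemma frag_cmul_eq_of_int_mult: "frag_cmul c f = of_int c * (f :: ('i \<Rightarrow>\<^sub>0 nat) \<Rightarrow>\<^sub>0 int)"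
proof -
  have nat: "frag_cmul (int n) f = of_nat n * f" for n
    by (induction n) (simp_all add: frag_cmul_distrib distrib_right)
  show ?thesis
    using nat by (cases c rule: int_cases2) (simp_all flip: minus_frag_cmul)
qed

lemma frag_dvdE:
  assumes "\<And>m. c dvd lookup f m"
  obtains g where "f = frag_cmul c g"
proof
  have "finite {m. lookup f m div c \<noteq> 0}"
    by (rule finite_subset[of _ "keys f"]) (auto simp: in_keys_iff)
  then show "f = frag_cmul c (Abs_poly_mapping (\<lambda>m. lookup f m div c))"
    by (intro poly_mapping_eqI) (simp add: Abs_poly_mapping_inverse assms)
qed

lemma monom_degree_superset:
  assumes "finite S" "keys m \<subseteq> S"
  shows "monom_degree d m = (\<Sum>i\<in>S. lookup m i * d i)"
  unfolding monom_degree_def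
  by (rule sum.mono_neutral_left) (use assms in \<open>auto simp: in_keys_iff\<close>)

lemma monom_degree_add: "monom_degree d (m + n) = monom_degree d m + monom_degree d n"
proof -
  let ?S = "keys m \<union> keys n"
  have "keys (m + n) \<subseteq> ?S" by (rule keys_add)
  then show ?thesis
    by (subst (1 2 3) monom_degree_superset[where S = ?S])
      (auto simp: lookup_add distrib_right sum.distrib)
qed

lemma monom_degree_single [simp]: "monom_degree d (single i (Suc 0)) = d i"
  by (simp add: monom_degree_def)

lemma monom_degree_0_iff:
  "(\<And>i. i \<in> keys m \<Longrightarrow> 0 < d i) \<Longrightarrow> monom_degree d m = 0 \<longleftrightarrow> m = 0"
proof
  assume pos: "\<And>i. i \<in> keys m \<Longrightarrow> 0 < d i" and "monom_degree d m = 0"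
  then have "d i = 0" if "i \<in> keys m" for i
    using that by (auto simp: monom_degree_def)
  with pos have "keys m = {}" by (metis all_not_in_conv less_irrefl)
  then show "m = 0" by simp
qed (simp add: monom_degree_def)

section \<open>Partial derivatives\<close>

text \<open>The truncated difference does no harm when i does not occur in m, because the
  coefficient is then 0.\<close>

definition partial :: "'i \<Rightarrow> (('i \<Rightarrow>\<^sub>0 nat) \<Rightarrow>\<^sub>0 int) \<Rightarrow> (('i \<Rightarrow>\<^sub>0 nat) \<Rightarrow>\<^sub>0 int)"
  where "partial i = frag_extend (\<lambda>m. frag_cmul (int (lookup m i)) (frag_of (m - single i 1)))"

lemma monomial_decompose:
  "0 < lookup m i \<Longrightarrow> m = (m - single i 1) + single i (1::nat)"
  by (intro poly_mapping_eqI) (auto simp: lookup_add lookup_minus lookup_single when_def)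

lemma lookup_partial:
  assumes "0 < lookup m i"
  shows "lookup (partial i f) (m - single i 1)
    = int (lookup m i) * lookup f m"
proof -
  have "lookup (partial i f) (m - single i 1) =
     (\<Sum>n\<in>keys f. lookup f n * (int (lookup n i) *
        (if n - single i 1 = m - single i 1 then 1 else 0)))"
    by (auto simp: partial_def frag_extend_def lookup_sum intro!: sum.cong)
  also have "\<dots> = (\<Sum>n\<in>keys f. if n = m then lookup f m * int (lookup m i) else 0)"
  proof (rule sum.cong)
    fix n assume "n \<in> keys f"
    show "lookup f n * (int (lookup n i) *
        (if n - single i 1 = m - single i 1 then 1 else 0))
      = (if n = m then lookup f m * int (lookup m i) else 0)"
    proof (cases "lookup n i = 0")
      case True
      then show ?thesis using assms by auto
    next
      case False
      then have "n - single i 1 = m - single i 1 \<longleftrightarrow> n = m"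
        using monomial_decompose[OF assms] monomial_decompose[of n i] by (metis gr0I)
      then show ?thesis by simp
    qed
  qed simp
  also have "\<dots> = int (lookup m i) * lookup f m"
    by (simp add: in_keys_iff)
  finally show ?thesis .
qed

lemma keys_partial:
  assumes "n \<in> keys (partial i f)"
  obtains m where "m \<in> keys f" "0 < lookup m i" "m = n + single i 1"
proof -
  from subsetD[OF keys_frag_extend assms[unfolded partial_def]] obtain m where m: "m \<in> keys f"
    "n \<in> keys (frag_cmul (int (lookup m i)) (frag_of (m - single i 1)))"
    by (rule UN_E)
  then have "0 < lookup m i" "n = m - single i 1"
    by (auto simp: keys_cmul_iff)
  then have "m = n + single i 1" by (simp only: monomial_decompose[symmetric])
  with m(1) \<open>0 < _\<close> show ?thesis by (rule that)
qed

lemma of_int_dvd_of_intI: "c dvd d \<Longrightarrow> (of_int c :: 'a::comm_ring_1) dvd of_int d"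
  by (auto elim!: dvdE)

locale derivation = additive D for D :: "'r::comm_ring_1 \<Rightarrow> 'r" +
  assumes leibniz: "D (x * y) = D x * y + x * D y"
begin

lemma D_1: "D 1 = 0" using leibniz[of 1 1] by simp

lemma D_power: "D (x ^ n) = of_nat n * x ^ (n - 1) * D x"
proof (induction n)
  case (Suc n) then show ?case by (cases n) (simp_all add: leibniz algebra_simps)
qed (simp add: D_1)

lemma D_prod: "finite S \<Longrightarrow> D (prod f S) = (\<Sum>i\<in>S. D (f i) * prod f (S - {i}))"
proof (induction S rule: finite_induct)
  case (insert j S)
  have "(\<Sum>i\<in>S. D (f i) * prod f (insert j S - {i})) = (\<Sum>i\<in>S. f j * (D (f i) * prod f (S - {i})))"
  proof (rule sum.cong)
    fix i assume "i \<in> S"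
    then have "insert j S - {i} = insert j (S - {i})" using insert.hyps by auto
    then show "D (f i) * prod f (insert j S - {i}) = f j * (D (f i) * prod f (S - {i}))"
      using insert.hyps by (simp add: mult_ac)
  qed simp
  then show ?case using insert by (simp add: leibniz sum_distrib_left)
qed (simp add: D_1)

lemma D_eval_mono:
  assumes "finite V" "keys m \<subseteq> V"
  shows "D (eval_mono e m) = (\<Sum>i\<in>V. of_nat (lookup m i) *
    eval_mono e (m - single i 1) * D (e i))"
proof -
  let ?f = "\<lambda>i. e i ^ lookup m i"
  have "D (eval_mono e m) = (\<Sum>i\<in>V. D (?f i) * prod ?f (V - {i}))"
    using assms by (simp add: eval_mono_superset[OF assms] D_prod)
  also have "\<dots> = (\<Sum>i\<in>V. of_nat (lookup m i) * eval_mono e (m - single i 1) * D (e i))"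
  proof (rule sum.cong)
    fix i assume i: "i \<in> V"
    have k: "keys (m - single i 1) \<subseteq> V"
      using assms by (auto simp: in_keys_iff lookup_minus)
    have "prod (\<lambda>j. e j ^ lookup (m - single i 1) j) (V - {i}) = prod ?f (V - {i})"
      by (rule prod.cong) (auto simp: lookup_minus lookup_single when_def)
    then have "eval_mono e (m - single i 1) = e i ^ (lookup m i - 1) * prod ?f (V - {i})"
      unfolding eval_mono_superset[OF assms(1) k] by (subst prod.remove[OF assms(1) i])
        (simp add: lookup_minus)
    then show "D (?f i) * prod ?f (V - {i}) = of_nat (lookup m i) *
        eval_mono e (m - single i 1) * D (e i)"
      by (simp add: D_power mult_ac)
  qed simp
  finally show ?thesis .
qed

text \<open>The chain rule for an arbitrary derivation.\<close>

lemma D_poly_eval: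
  assumes V: "finite V" and f: "keys f \<subseteq> {m. keys m \<subseteq> V}"
  shows "D (poly_eval e f) = (\<Sum>i\<in>V. poly_eval e (partial i f) * D (e i))"
  using f
proof (induction f rule: frag_induction)
  case zero then show ?case by (simp add: additive.zero[OF additive_axioms] partial_def)
next
  case (one m)
  then show ?case using D_eval_mono[OF V, of m e] by (simp add: partial_def poly_eval_frag_cmul)
next
  case (diff a b)
  have "partial i (a - b) = partial i a - partial i b" for i
    by (simp add: partial_def frag_extend_diff)
  with diff.IH show ?case
    by (simp add: poly_eval_diff additive.diff[OF additive_axioms] left_diff_distrib sum_subtractf)
qed

end

section \<open>A criterion for a graded ring to be polynomial\<close>

text \<open>The ring in question is the quotient by the joint kernel of all functionals in \<open>C\<close>; its
  part of degree \<open>n\<close> is the image of the joint kernel of those in \<open>C m\<close> for \<open>m \<noteq> n\<close>.\<close>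

locale functional_grading =
  fixes C :: "nat \<Rightarrow> ('r::comm_ring_1 \<Rightarrow> int) set"
  assumes C_additive: "c \<in> C n \<Longrightarrow> additive c"
    and C_finite: "finite (C n)"
begin

definition null :: "'r set" where "null = {x. \<forall>n. \<forall>c\<in>C n. c x = 0}"
definition grade :: "nat \<Rightarrow> 'r set" where "grade n = {x. \<forall>m. m \<noteq> n \<longrightarrow> (\<forall>c\<in>C m. c x = 0)}"

lemmas C_simps = additive.diff[OF C_additive] additive_of_int[OF C_additive]

lemma null_closed:
  assumes "\<And>c :: 'r \<Rightarrow> int. additive c \<Longrightarrow> c x = 0 \<Longrightarrow> c y = 0 \<Longrightarrow> c z = 0" "x \<in> null" "y \<in> null"
  shows "z \<in> null"
  unfolding null_def
proof (intro CollectI allI ballI)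
  fix n c assume c: "c \<in> C n"
  then have "c x = 0" "c y = 0" using assms(2,3) by (auto simp: null_def)
  then show "c z = 0" by (rule assms(1)[OF C_additive[OF c]])
qed

lemma grade_closed:
  assumes "\<And>c :: 'r \<Rightarrow> int. additive c \<Longrightarrow> c x = 0 \<Longrightarrow> c y = 0 \<Longrightarrow> c z = 0" "x \<in> grade n" "y \<in> grade n"
  shows "z \<in> grade n"
  unfolding grade_def
proof (intro CollectI allI ballI impI)
  fix m c assume m: "m \<noteq> n" and c: "c \<in> C m"
  then have "c x = 0" "c y = 0" using assms(2,3) by (auto simp: grade_def)
  then show "c z = 0" by (rule assms(1)[OF C_additive[OF c]])
qed

lemma null_zero [simp]: "0 \<in> null"
  by (auto simp: null_def additive.zero[OF C_additive])
lemma null_add: "x \<in> null \<Longrightarrow> y \<in> null \<Longrightarrow> x + y \<in> null"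
  by (rule null_closed[of x y]) (simp_all add: additive.add)
lemma null_diff: "x \<in> null \<Longrightarrow> y \<in> null \<Longrightarrow> x - y \<in> null"
  by (rule null_closed[of x y]) (simp_all add: additive.diff)
lemma null_uminus: "x \<in> null \<Longrightarrow> - x \<in> null"
  by (rule null_closed[of x x]) (simp_all add: additive.minus)
lemma null_of_int: "M \<noteq> 0 \<Longrightarrow> of_int M * x \<in> null \<Longrightarrow> x \<in> null"
  by (rule null_closed[of "of_int M * x" "of_int M * x"]) (simp_all add: additive_of_int)
lemma null_trans: "x - y \<in> null \<Longrightarrow> y - z \<in> null \<Longrightarrow> x - z \<in> null"
  using null_add[of "x - y" "y - z"] by simp
lemma null_sym: "x - y \<in> null \<Longrightarrow> y - x \<in> null"
  using null_uminus[of "x - y"] by simp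

lemma grade_zero [simp]: "0 \<in> grade n"
  by (auto simp: grade_def additive.zero[OF C_additive])
lemma grade_add: "x \<in> grade n \<Longrightarrow> y \<in> grade n \<Longrightarrow> x + y \<in> grade n"
  by (rule grade_closed[of x y]) (simp_all add: additive.add)
lemma grade_diff: "x \<in> grade n \<Longrightarrow> y \<in> grade n \<Longrightarrow> x - y \<in> grade n"
  by (rule grade_closed[of x y]) (simp_all add: additive.diff)
lemma grade_of_int: "x \<in> grade n \<Longrightarrow> of_int c * x \<in> grade n"
  by (rule grade_closed[of x x]) (simp_all add: additive_of_int)
lemma grade_sum: "(\<And>i. i \<in> S \<Longrightarrow> f i \<in> grade n) \<Longrightarrow> sum f S \<in> grade n"
  by (induction S rule: infinite_finite_induct) (auto intro: grade_add)
lemma null_grade: "x \<in> null \<Longrightarrow> x \<in> grade n" by (simp add: null_def grade_def)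
lemma grade_null:
  assumes "x \<in> grade n" "\<And>c. c \<in> C n \<Longrightarrow> c x = 0"
  shows "x \<in> null"
proof -
  have "c x = 0" if "c \<in> C m" for c m
    using assms that by (cases "m = n") (auto simp: grade_def)
  then show ?thesis by (simp add: null_def)
qed
definition null_mod :: "nat \<Rightarrow> 'r set" where "null_mod p = {x. \<exists>y. x - of_nat p * y \<in> null}"

end

text \<open>A derivation \<open>D\<close> as in \<open>null_der\<close> is \<open>(id \<otimes> \<xi>) \<circ> \<Delta>\<close> for a coproduct \<open>\<Delta>\<close>.\<close>

locale polynomial_criterion = functional_grading C for C :: "nat \<Rightarrow> ('r::comm_ring_1 \<Rightarrow> int) set" +
  assumes null_mult: "x \<in> null \<Longrightarrow> x * y \<in> null"
    and grade_one: "1 \<in> grade 0"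
    and grade_mult: "x \<in> grade m \<Longrightarrow> y \<in> grade n \<Longrightarrow> x * y \<in> grade (m + n)"
    and grade_decomp: "\<exists>f M. (\<forall>n. f n \<in> grade n) \<and> x - (\<Sum>n\<le>M::nat. f n) \<in> null"
    and grade_0: "x \<in> grade 0 \<Longrightarrow> \<exists>c. x - of_int c \<in> null"
    and C_unit: "\<exists>c\<in>C 0. c 1 = 1"
    and null_frob: "Factorial_Ring.prime p \<Longrightarrow> x ^ p \<in> null_mod p \<Longrightarrow> x \<in> null_mod p"
    and null_der: "\<lbrakk>0 < n; additive \<xi>; \<And>x. x \<in> null \<Longrightarrow> \<xi> x = 0;
        \<And>m x. m \<noteq> n \<Longrightarrow> x \<in> grade m \<Longrightarrow> \<xi> x = (0::int);
        \<And>i j x y. \<lbrakk>0 < i; 0 < j; i + j = n; x \<in> grade i; y \<in> grade j\<rbrakk> \<Longrightarrow> \<xi> (x * y) = 0\<rbrakk>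
      \<Longrightarrow> \<exists>D. derivation D \<and> (\<forall>x\<in>null. D x \<in> null) \<and> (\<forall>m<n. \<forall>x\<in>grade m. D x \<in> null) \<and>
          (\<forall>x\<in>grade n. D x - of_int (\<xi> x) \<in> null)"
begin

lemma null_mult_left: "x \<in> null \<Longrightarrow> y * x \<in> null"
  using null_mult[of x y] by (simp add: mult.commute)

lemma null_mod_add: "x \<in> null_mod p \<Longrightarrow> y \<in> null_mod p \<Longrightarrow> x + y \<in> null_mod p"
proof -
  assume "x \<in> null_mod p" "y \<in> null_mod p"
  then obtain a b where "x - of_nat p * a \<in> null" "y - of_nat p * b \<in> null" by (auto simp: null_mod_def)
  from null_add[OF this] have "(x + y) - of_nat p * (a + b) \<in> null" by (simp add: algebra_simps)
  then show ?thesis by (auto simp: null_mod_def)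
qed

lemma null_mod_mult: "x \<in> null_mod p \<Longrightarrow> x * y \<in> null_mod p"
proof -
  assume "x \<in> null_mod p"
  then obtain a where "x - of_nat p * a \<in> null" by (auto simp: null_mod_def)
  from null_mult[OF this, of y] have "x * y - of_nat p * (a * y) \<in> null" by (simp add: algebra_simps)
  then show ?thesis by (auto simp: null_mod_def)
qed

lemma null_mod_dvd: "of_nat p dvd x \<Longrightarrow> x \<in> null_mod p"
  by (auto simp: null_mod_def elim!: dvdE) (metis diff_self null_zero)
lemma null_in_null_mod: "x \<in> null \<Longrightarrow> x \<in> null_mod p" by (auto simp: null_mod_def intro: exI[of _ 0])
lemma null_mod_uminus: "x \<in> null_mod p \<Longrightarrow> - x \<in> null_mod p"
  using null_mod_mult[of x p "-1"] by simp
lemma null_mod_diff: "x \<in> null_mod p \<Longrightarrow> y \<in> null_mod p \<Longrightarrow> x - y \<in> null_mod p"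
  using null_mod_add[of x p "- y"] null_mod_uminus[of y p] by simp
lemma null_mod_sum: "(\<And>i. i \<in> S \<Longrightarrow> f i \<in> null_mod p) \<Longrightarrow> sum f S \<in> null_mod p"
  by (induction S rule: infinite_finite_induct) (auto intro: null_mod_add null_in_null_mod)

lemma of_int_null_mod: "of_int c \<in> null_mod p \<Longrightarrow> int p dvd c"
proof -
  assume "of_int c \<in> null_mod p"
  then obtain y where y: "of_int c * 1 - of_int (int p) * y \<in> null" by (auto simp: null_mod_def)
  obtain f where f: "f \<in> C 0" "f 1 = 1" using C_unit by blast
  have "f (of_int c * 1 - of_int (int p) * y) = 0" using y f(1) by (auto simp: null_def)
  then have "c - int p * f y = 0" unfolding C_simps[OF f(1)] f(2) by simp
  then show ?thesis by simp
qed

end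

text \<open>Values of \<open>D i\<close> on generators of degree above \<open>d i\<close> are left
  open, so the matrix of the \<open>D i (e j)\<close> is unitriangular rather than the
  identity.\<close>

locale coordinate_system = polynomial_criterion C for C :: "nat \<Rightarrow> ('r::comm_ring_1 \<Rightarrow> int) set" +
  fixes I :: "'i set" and d :: "'i \<Rightarrow> nat" and e :: "'i \<Rightarrow> 'r" and D :: "'i \<Rightarrow> 'r \<Rightarrow> 'r"
  assumes d_pos: "i \<in> I \<Longrightarrow> 0 < d i" and e_grade: "i \<in> I \<Longrightarrow> e i \<in> grade (d i)"
    and D_derivation: "i \<in> I \<Longrightarrow> derivation (D i)"
    and D_null: "i \<in> I \<Longrightarrow> x \<in> null \<Longrightarrow> D i x \<in> null"
    and D_less: "i \<in> I \<Longrightarrow> j \<in> I \<Longrightarrow> d j < d i \<Longrightarrow> D i (e j) \<in> null"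
    and D_eq: "i \<in> I \<Longrightarrow> j \<in> I \<Longrightarrow> d j = d i \<Longrightarrow> D i (e j) - (if i = j then 1 else 0) \<in> null"
begin

text \<open>A relation modulo \<open>p\<close> of smallest degree has vanishing partial derivatives, hence is a
  \<open>p\<close>-th power, and Frobenius is injective.\<close>

lemma poly_eval_null_mod:
  assumes p: "Factorial_Ring.prime p"
    and "\<And>m. m \<in> keys f \<Longrightarrow> keys m \<subseteq> I"
    and "\<And>m. m \<in> keys f \<Longrightarrow> monom_degree d m \<le> n"
    and "poly_eval e f \<in> null_mod p"
  shows "int p dvd lookup f m"
  using assms(2-)
proof (induction n arbitrary: f m rule: less_induct)
  case (less n)
  define V where "V = (\<Union>m\<in>keys f. keys m)"
  have V: "finite V" "V \<subseteq> I" "keys f \<subseteq> {m. keys m \<subseteq> V}"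
    using less.prems(1) by (auto simp: V_def)
  have p1: "p > 1" using p by (rule prime_gt_1_nat)
  have partial: "int p dvd lookup (partial j f) m" if "j \<in> V" for j m
  proof (rule ccontr)
    assume neg: "\<not> ?thesis"
    \<comment> \<open>The variables whose partial derivative survives modulo p. For j of largest
      degree in W, \<open>D j\<close> vanishes on the other generators indexed by W, and variables
      outside W contribute 0 modulo p; applying \<open>D j\<close> to the relation isolates the
      partial derivative for j.\<close>
    define W where "W = {j\<in>V. \<exists>m. \<not> int p dvd lookup (partial j f) m}"
    have W: "finite W" "W \<noteq> {}" using V neg that by (auto simp: W_def)
    then have "Max (d ` W) \<in> d ` W" by (intro Max_in) auto
    then obtain j where j: "j \<in> W" "d j = Max (d ` W)" by force
    have max: "d i \<le> d j" if "i \<in> W" for i using that W(1) by (simp add: j(2))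
    have jV: "j \<in> V" and jI: "j \<in> I" using j(1) V by (auto simp: W_def)
    interpret Dj: derivation "D j" by (rule D_derivation[OF jI])
    have nz: "partial j f \<noteq> 0" using j(1) by (auto simp: W_def)
    then obtain m0 where m0: "m0 \<in> keys (partial j f)" by fastforce
    have deg: "monom_degree d m' < n" if m': "m' \<in> keys (partial j f)" for m'
    proof -
      obtain m where m: "m \<in> keys f" "m = m' + single j 1"
        using keys_partial[OF m'] by metis
      then have "monom_degree d m' + d j \<le> n"
        using less.prems(2)[OF m(1)] by (simp add: monom_degree_add)
      then show ?thesis using d_pos[OF jI] by simp
    qed
    have n: "n > 0" using deg[OF m0] by simp
    have D_mod: "D j x \<in> null_mod p" if x: "x \<in> null_mod p" for x
    proof -
      obtain y where "x - of_int (int p) * y \<in> null" using x by (auto simp: null_mod_def)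
      from D_null[OF jI this] have "D j x - of_nat p * D j y \<in> null"
        unfolding Dj.diff additive_of_int[OF Dj.additive_axioms] by simp
      then show ?thesis by (auto simp: null_mod_def)
    qed
    have "poly_eval e (partial i f) * D j (e i) \<in> null_mod p" if i: "i \<in> V - {j}" for i
    proof (cases "i \<in> W")
      case True
      then have "D j (e i) \<in> null"
        using D_less[OF jI, of i] D_eq[OF jI, of i] max[of i] i V
        by (cases "d i = d j") auto
      then show ?thesis by (intro null_in_null_mod null_mult_left)
    next
      case False
      then obtain g where "partial i f = frag_cmul (int p) g" using i frag_dvdE[of "int p" "partial i f"]
        by (auto simp: W_def)
      then have "of_nat p dvd poly_eval e (partial i f)" by (simp add: poly_eval_frag_cmul)
      then show ?thesis by (intro null_mod_mult null_mod_dvd)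
    qed
    then have rest: "(\<Sum>i\<in>V - {j}. poly_eval e (partial i f) * D j (e i)) \<in> null_mod p"
      by (rule null_mod_sum)
    have "D j (poly_eval e f) = poly_eval e (partial j f) * D j (e j)
        + (\<Sum>i\<in>V - {j}. poly_eval e (partial i f) * D j (e i))"
      unfolding Dj.D_poly_eval[OF V(1,3)] by (rule sum.remove[OF V(1) jV])
    with null_mod_diff[OF D_mod[OF less.prems(3)] rest]
    have "poly_eval e (partial j f) * D j (e j) \<in> null_mod p" by simp
    moreover have "poly_eval e (partial j f) * (D j (e j) - 1) \<in> null_mod p"
      using D_eq[OF jI jI] by (intro null_in_null_mod null_mult_left) simp
    ultimately have "poly_eval e (partial j f) * D j (e j) - poly_eval e (partial j f) * (D j (e j) - 1) \<in> null_mod p"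
      by (rule null_mod_diff)
    then have "poly_eval e (partial j f) \<in> null_mod p"
      by (simp add: algebra_simps)
    then have "int p dvd lookup (partial j f) m" for m
    proof (rule less.IH[of "n - 1", rotated 3])
      show "keys m' \<subseteq> I" if m': "m' \<in> keys (partial j f)" for m'
      proof -
        obtain m where m: "m \<in> keys f" "m = m' + single j 1"
          using keys_partial[OF m'] by metis
        have "keys m' \<subseteq> keys m" unfolding m(2)
          by (auto simp: in_keys_iff lookup_add)
        then show ?thesis using less.prems(1)[OF m(1)] by blast
      qed
      show "monom_degree d m' \<le> n - 1" if "m' \<in> keys (partial j f)" for m'
        using deg[OF that] by simp
    qed (use n in simp)
    then show False using j(1) by (simp add: W_def)
  qed
  \<comment> \<open>A coefficient in K is a unit modulo p, so the vanishing of the partial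
    derivatives forces all exponents of the monomial to be divisible by p.\<close>
  define K where "K = {m\<in>keys f. \<not> int p dvd lookup f m}"
  have K: "finite K" "K \<subseteq> keys f" by (auto simp: K_def)
  have p_dvd: "p dvd lookup m i" if "m \<in> K" for m i
  proof (cases "lookup m i = 0")
    case False
    then have "i \<in> V" using that K by (auto simp: V_def in_keys_iff)
    then have "int p dvd int (lookup m i) * lookup f m"
      using partial[of i "m - single i 1"] lookup_partial[of m i f] False by simp
    then show ?thesis using that p by (auto simp: K_def prime_dvd_mult_iff)
  qed simp
  define q where "q m = Poly_Mapping.map (\<lambda>k. k div p) m" for m :: "'i \<Rightarrow>\<^sub>0 nat"
  have lookup_q: "lookup (q m) i = lookup m i div p" for m i
    by (simp add: q_def map.rep_eq when_def)
  have lookup_m: "lookup m i = p * lookup (q m) i" if "m \<in> K" for m i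
    using p_dvd[OF that] by (simp add: lookup_q)
  have keys_q: "keys (q m) = keys m" if "m \<in> K" for m
    using lookup_m[OF that] p1 by (auto simp: in_keys_iff)
  have q_inj: "inj_on q K"
    using lookup_m by (intro inj_onI poly_mapping_eqI) metis
  have deg_q: "monom_degree d m = p * monom_degree d (q m)" if "m \<in> K" for m
    unfolding monom_degree_def keys_q[OF that] by (simp add: sum_distrib_left lookup_m[OF that] mult.assoc)
  have eval_q: "eval_mono e m = eval_mono e (q m) ^ p" if "m \<in> K" for m
    unfolding eval_mono_def keys_q[OF that]
    by (simp add: prod_power_distrib lookup_m[OF that] power_mult mult.commute[of p])
  \<comment> \<open>The p-th root of f modulo p. Its coefficients are those of f, because c ^ p is
    congruent to c.\<close>
  define h where "h = (\<Sum>m\<in>K. frag_cmul (lookup f m) (frag_of (q m)))"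
  have lookup_h: "lookup h (q m) = lookup f m" if "m \<in> K" for m
  proof -
    have "lookup h (q m) = (\<Sum>m'\<in>K. if m' = m then lookup f m else 0)"
      unfolding h_def lookup_sum using inj_onD[OF q_inj] that
      by (intro sum.cong) auto
    then show ?thesis using that K by simp
  qed
  have keys_h: "keys h \<subseteq> q ` K"
  proof -
    have "keys h \<subseteq> (\<Union>m\<in>K. keys (frag_cmul (lookup f m) (frag_of (q m))))"
      unfolding h_def by (rule keys_sum)
    moreover have "keys (frag_cmul (lookup f m) (frag_of (q m))) \<subseteq> {q m}" for m
      using keys_cmul[of "lookup f m" "frag_of (q m)"] by simp
    ultimately show ?thesis by blast
  qed
  have h_null: "poly_eval e h \<in> null_mod p"
  proof (rule null_frob[OF p])
    let ?t = "\<lambda>m. of_int (lookup f m) * eval_mono e (q m)"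
    have "poly_eval e h = (\<Sum>m\<in>K. ?t m)"
      by (simp add: h_def poly_eval_sum poly_eval_frag_cmul)
    then have "of_nat p dvd poly_eval e h ^ p - (\<Sum>m\<in>K. ?t m ^ p)"
      using prime_dvd_power_sum[OF p K(1)] by simp
    moreover have "of_nat p dvd (\<Sum>m\<in>K. ?t m ^ p) - (\<Sum>m\<in>K. of_int (lookup f m) * eval_mono e m)"
      unfolding sum_subtractf[symmetric]
    proof (rule dvd_sum)
      fix m assume m: "m \<in> K"
      have "int p dvd lookup f m ^ p - lookup f m"
        by (rule prime_dvd_power_diff_self[OF p])
      then have "of_int (int p) dvd (of_int (lookup f m ^ p - lookup f m) :: 'r)"
        by (rule of_int_dvd_of_intI)
      then have "of_nat p dvd (of_int (lookup f m) ^ p - of_int (lookup f m)) * eval_mono e m"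
        by simp
      then show "of_nat p dvd ?t m ^ p - of_int (lookup f m) * eval_mono e m"
        using eval_q[OF m] by (simp add: power_mult_distrib algebra_simps)
    qed
    moreover have "of_nat p dvd (\<Sum>m\<in>K. of_int (lookup f m) * eval_mono e m) - poly_eval e f"
    proof -
      have "poly_eval e f = (\<Sum>m\<in>K. of_int (lookup f m) * eval_mono e m) +
         (\<Sum>m\<in>keys f - K. of_int (lookup f m) * eval_mono e m)"
        unfolding poly_eval_def int_extend_def using K by (simp add: sum.subset_diff add.commute)
      moreover have "of_nat p dvd (\<Sum>m\<in>keys f - K. of_int (lookup f m) * eval_mono e m)"
        by (intro dvd_sum dvd_mult2) (auto simp: K_def elim!: dvdE)
      ultimately show ?thesis by simp
    qed
    ultimately have "of_nat p dvd (poly_eval e h ^ p - (\<Sum>m\<in>K. ?t m ^ p))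
      + ((\<Sum>m\<in>K. ?t m ^ p) - (\<Sum>m\<in>K. of_int (lookup f m) * eval_mono e m))
      + ((\<Sum>m\<in>K. of_int (lookup f m) * eval_mono e m) - poly_eval e f)"
      by (intro dvd_add)
    then have "of_nat p dvd poly_eval e h ^ p - poly_eval e f" by simp
    from null_mod_add[OF null_mod_dvd[OF this] less.prems(3)]
    show "poly_eval e h ^ p \<in> null_mod p" by simp
  qed
  have "K = {}"
  \<comment> \<open>In degree 0 division by p does not lower the bound; there f is a constant, and
    the unit is not divisible by p.\<close>
  proof (cases "n = 0")
    case True
    have m0: "m = 0" if "m \<in> keys f" for m
      using less.prems(2)[OF that] True monom_degree_0_iff[of m d] less.prems(1)[OF that] d_pos by auto
    have "poly_eval e f = of_int (lookup f 0)"
    proof -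
      have "keys f \<subseteq> {0}" using m0 by auto
      then show ?thesis unfolding poly_eval_def by (subst int_extend_superset[of "{0}"]) auto
    qed
    then have "int p dvd lookup f 0" using less.prems(3) of_int_null_mod by simp
    then show ?thesis using m0 by (auto simp: K_def)
  next
    case False
    show ?thesis
    proof (rule ccontr)
      assume "K \<noteq> {}"
      then obtain m where m: "m \<in> K" by blast
      have "int p dvd lookup h (q m)"
      proof (rule less.IH[of "n div p", OF _ _ _ h_null])
        show "n div p < n" using False p1 by simp
        fix m' assume "m' \<in> keys h"
        then obtain m where m: "m \<in> K" "m' = q m" using keys_h by auto
        show "keys m' \<subseteq> I" using m keys_q[OF m(1)] less.prems(1) K by auto
        have "p * monom_degree d m' \<le> n"
          using less.prems(2)[of m] m K deg_q[OF m(1)] by auto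
        then show "monom_degree d m' \<le> n div p" using p1 by (simp add: less_eq_div_iff_mult_less_eq mult.commute)
      qed
      then show False using m lookup_h[OF m] by (simp add: K_def)
    qed
  qed
  then show ?case by (cases "m \<in> keys f") (auto simp: K_def in_keys_iff)
qed

text \<open>Each coefficient of a relation is divisible by every prime, in particular by one
  exceeding its absolute value.\<close>

lemma poly_eval_null:
  assumes "\<And>m. m \<in> keys f \<Longrightarrow> keys m \<subseteq> I" "poly_eval e f \<in> null"
  shows "f = 0"
proof (rule poly_mapping_eqI)
  fix m
  obtain p where p: "Factorial_Ring.prime p" "p > nat \<bar>lookup f m\<bar>"
    using bigger_prime by blast
  have "int p dvd lookup f m"
    by (rule poly_eval_null_mod[OF p(1) assms(1), of f "Max (monom_degree d ` keys f)"])
      (auto intro: null_in_null_mod assms)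
  then have "lookup f m = 0" using p(2) zdvd_imp_le[of "int p" "\<bar>lookup f m\<bar>"]
    by fastforce
  then show "lookup f m = lookup 0 m" by simp
qed

text \<open>For a prime factor p of M, f is a relation modulo p and hence divisible by p; then p
  cancels, since the quotient by \<open>null\<close> has no torsion.\<close>

lemma poly_eval_saturated:
  assumes "\<And>m. m \<in> keys f \<Longrightarrow> keys m \<subseteq> I" "0 < M"
    "of_nat M * x - poly_eval e f \<in> null"
  shows "\<exists>g. (\<forall>m\<in>keys g. keys m \<subseteq> I) \<and> x - poly_eval e g \<in> null"
  using assms
proof (induction M arbitrary: f rule: less_induct)
  case (less M)
  show ?case
  proof (cases "M = 1")
    case True then show ?thesis using less.prems by auto
  next
    case False
    then obtain p k where p: "Factorial_Ring.prime p" "M = p * k" 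
      using prime_factor_nat[of M] by (auto elim: dvdE)
    have "poly_eval e f - of_nat p * (of_nat k * x) \<in> null"
      using null_sym[OF less.prems(3)] p by (simp add: mult.assoc)
    then have "poly_eval e f \<in> null_mod p" by (auto simp: null_mod_def)
    then have "int p dvd lookup f m" for m
      by (intro poly_eval_null_mod[OF p(1) less.prems(1), of f "Max (monom_degree d ` keys f)"]) auto
    then obtain g where g: "f = frag_cmul (int p) g" using frag_dvdE by blast
    have p0: "p > 1" using p(1) by (rule prime_gt_1_nat)
    have "of_int (int p) * (of_nat k * x - poly_eval e g) \<in> null"
      using less.prems(3) p by (simp add: g poly_eval_frag_cmul algebra_simps)
    then have "of_nat k * x - poly_eval e g \<in> null" by (rule null_of_int[rotated]) (use p0 in simp)
    moreover have "keys g = keys f" using p0 by (auto simp: g)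
    moreover have "k < M" "0 < k" using p p0 less.prems(2) by (auto simp: nat_0_less_mult_iff)
    ultimately show ?thesis using less.IH[of k g] less.prems(1) by auto
  qed
qed

end

section \<open>Polynomials over a set of variables, decomposables, and the choice of
  generators\<close>

definition poly_over :: "'i set \<Rightarrow> (('i \<Rightarrow>\<^sub>0 nat) \<Rightarrow>\<^sub>0 int) set"
  where "poly_over I = {f. \<forall>m\<in>keys f. keys m \<subseteq> I}"

lemma poly_over_0 [simp]: "0 \<in> poly_over I" by (simp add: poly_over_def)

lemma poly_over_frag_of [simp]: "frag_of m \<in> poly_over I \<longleftrightarrow> keys m \<subseteq> I"
  by (simp add: poly_over_def)

lemma poly_over_add: "f \<in> poly_over I \<Longrightarrow> g \<in> poly_over I \<Longrightarrow> f + g \<in> poly_over I"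
  unfolding poly_over_def using keys_add[of f g] by blast

lemma poly_over_frag_cmul: "f \<in> poly_over I \<Longrightarrow> frag_cmul c f \<in> poly_over I"
  unfolding poly_over_def using keys_cmul[of c f] by blast

lemma poly_over_diff: "f \<in> poly_over I \<Longrightarrow> g \<in> poly_over I \<Longrightarrow> f - g \<in> poly_over I"
  using poly_over_add[of f I "frag_cmul (-1) g"] poly_over_frag_cmul[of g I "-1"] by simp

lemma poly_over_mult:
  assumes "f \<in> poly_over I" "g \<in> poly_over I"
  shows "f * g \<in> poly_over I"
  unfolding poly_over_def
proof (intro CollectI ballI)
  fix m assume "m \<in> keys (f * g)"
  then obtain a b where "a \<in> keys f" "b \<in> keys g" "m = a + b"
    using keys_mult[of f g] by blast
  then show "keys m \<subseteq> I"
    using assms keys_add[of a b] unfolding poly_over_def by blast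
qed

inductive_set decomposables :: "(nat \<Rightarrow> 'r set) \<Rightarrow> nat \<Rightarrow> 'r::comm_ring_1 set"
  for gr n where
  zero: "0 \<in> decomposables gr n"
| prod: "\<lbrakk>0 < i; 0 < j; i + j = n; x \<in> gr i; y \<in> gr j\<rbrakk> \<Longrightarrow> x * y \<in> decomposables gr n"
| diff: "x \<in> decomposables gr n \<Longrightarrow> y \<in> decomposables gr n \<Longrightarrow> x - y \<in> decomposables gr n"

context polynomial_criterion
begin

abbreviation decomposable :: "nat \<Rightarrow> 'r set" where "decomposable \<equiv> decomposables grade"

lemma decomposable_grade: "x \<in> decomposable n \<Longrightarrow> x \<in> grade n"
  by (induction rule: decomposables.induct) (auto intro: grade_diff grade_mult)

lemma grade_component: "\<exists>y\<in>grade n. \<forall>c\<in>C n. c x = c y"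
proof -
  obtain f and M :: nat where f: "\<And>n. f n \<in> grade n" "x - (\<Sum>n\<le>M. f n) \<in> null"
    using grade_decomp[of x] by blast
  have "c x = c (if n \<le> M then f n else 0)" if c: "c \<in> C n" for c
  proof -
    interpret c: additive c by (rule C_additive[OF c])
    have "c (x - (\<Sum>n\<le>M. f n)) = 0" using f(2) c by (auto simp: null_def)
    then have "c x = (\<Sum>k\<le>M. c (f k))" by (simp add: c.diff c.sum)
    also have "\<dots> = (\<Sum>k\<le>M. if k = n then c (f n) else 0)"
    proof (rule sum.cong)
      show "c (f k) = (if k = n then c (f n) else 0)" for k
        using f(1)[of k] c unfolding grade_def by auto
    qed simp
    finally show ?thesis by (simp add: c.zero)
  qed
  then show ?thesis using f(1) by (intro bexI[of _ "if n \<le> M then f n else 0"]) auto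
qed

text \<open>\<open>Y\<close> lifts a basis of the indecomposables of degree \<open>n\<close> modulo torsion.\<close>

lemma indecomposables:
  "\<exists>Y (\<xi> :: 'r \<Rightarrow> 'r \<Rightarrow> int). finite Y \<and> Y \<subseteq> grade n \<and> (\<forall>x. additive (\<xi> x)) \<and>
    (\<forall>x\<in>Y. \<forall>y\<in>Y. \<xi> x y = (if x = y then 1 else 0)) \<and>
    (\<forall>x y. (\<forall>c\<in>C n. c y = 0) \<longrightarrow> \<xi> x y = 0) \<and>
    (\<forall>x. \<forall>y\<in>decomposable n. \<xi> x y = 0) \<and>
    (\<forall>x\<in>grade n. \<exists>(M::int) y. M \<noteq> 0 \<and> y \<in> decomposable n \<and>
       of_int M * (x - (\<Sum>y\<in>Y. of_int (\<xi> y x) * y)) - y \<in> null)"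
proof -
  \<comment> \<open>E detects elements of degree n exactly up to decomposables and torsion, so a
    dual system for E is the basis sought.\<close>
  have "\<exists>E :: ('r \<Rightarrow> int) set. finite E \<and> (\<forall>\<eta>\<in>E. additive \<eta>) \<and>
    (\<forall>\<eta>\<in>E. \<forall>d\<in>decomposable n. \<eta> d = 0) \<and> (\<forall>\<eta>\<in>E. \<forall>x. (\<forall>c\<in>C n. c x = 0) \<longrightarrow> \<eta> x = 0) \<and>
    (\<forall>x. (\<forall>\<eta>\<in>E. \<eta> x = 0) \<longrightarrow>
      (\<exists>d\<in>decomposable n. \<exists>M::int. M \<noteq> 0 \<and> (\<forall>c\<in>C n. c (of_int M * x - d) = 0)))"
    (is "\<exists>E. ?P E")
    by (rule annihilator_exists)
      (auto intro: C_finite C_additive decomposables.zero decomposables.diff)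
  then obtain E where "?P E" ..
  then have E: "finite E" "\<And>\<eta>. \<eta> \<in> E \<Longrightarrow> additive \<eta>"
    "\<And>\<eta> d. \<eta> \<in> E \<Longrightarrow> d \<in> decomposable n \<Longrightarrow> \<eta> d = 0"
    "\<And>\<eta> x. \<eta> \<in> E \<Longrightarrow> (\<And>c. c \<in> C n \<Longrightarrow> c x = 0) \<Longrightarrow> \<eta> x = 0"
    "\<And>x. \<forall>\<eta>\<in>E. \<eta> x = 0 \<Longrightarrow> \<exists>d\<in>decomposable n. \<exists>M::int. M \<noteq> 0 \<and> (\<forall>c\<in>C n. c (of_int M * x - d) = 0)"
    by blast+
  have rep: "\<exists>y\<in>grade n. \<forall>\<eta>\<in>E. \<eta> x = \<eta> y" for x
  proof -
    obtain y where y: "y \<in> grade n" "\<And>c. c \<in> C n \<Longrightarrow> c x = c y" using grade_component by blast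
    have "\<eta> x = \<eta> y" if "\<eta> \<in> E" for \<eta>
    proof -
      have "\<eta> (x - y) = 0"
        by (rule E(4)[OF that]) (simp add: additive.diff[OF C_additive] y(2))
      then show ?thesis by (simp add: additive.diff[OF E(2)[OF that]])
    qed
    then show ?thesis using y(1) by blast
  qed
  have "\<exists>Y (\<xi> :: 'r \<Rightarrow> 'r \<Rightarrow> int). finite Y \<and> Y \<subseteq> grade n \<and> (\<forall>x. additive (\<xi> x)) \<and>
    (\<forall>x\<in>Y. \<forall>y\<in>Y. \<xi> x y = (if x = y then 1 else 0)) \<and>
    (\<forall>x y. (\<forall>\<eta>\<in>E. \<eta> y = 0) \<longrightarrow> \<xi> x y = 0) \<and>
    (\<forall>y. \<forall>\<eta>\<in>E. \<eta> (y - (\<Sum>x\<in>Y. of_int (\<xi> x y) * x)) = 0)" (is "\<exists>Y \<xi>. ?P Y \<xi>")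
    by (rule dual_system_exists) (fact E(1), erule E(2), rule rep)
  then obtain Y \<xi> where P: "?P Y \<xi>" by (elim exE)
  note P1 = P[THEN conjunct1]
  note P2 = P[THEN conjunct2, THEN conjunct1]
  note P3 = P[THEN conjunct2, THEN conjunct2, THEN conjunct1]
  note P4 = P[THEN conjunct2, THEN conjunct2, THEN conjunct2, THEN conjunct1]
  note P5 = P[THEN conjunct2, THEN conjunct2, THEN conjunct2, THEN conjunct2, THEN conjunct1]
  note P6 = P[THEN conjunct2, THEN conjunct2, THEN conjunct2, THEN conjunct2, THEN conjunct2]
  have res: "\<exists>(M::int) y. M \<noteq> 0 \<and> y \<in> decomposable n \<and>
       of_int M * (x - (\<Sum>y\<in>Y. of_int (\<xi> y x) * y)) - y \<in> null" if x: "x \<in> grade n" for x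
  proof -
    let ?s = "x - (\<Sum>y\<in>Y. of_int (\<xi> y x) * y)"
    have "\<forall>\<eta>\<in>E. \<eta> ?s = 0" using P6 by (rule spec)
    from E(5)[OF this] obtain d M where d: "d \<in> decomposable n" "M \<noteq> 0"
      "\<forall>c\<in>C n. c (of_int M * ?s - d) = 0"
      by (elim bexE exE conjE)
    have s: "?s \<in> grade n" using P2 x by (intro grade_diff grade_sum grade_of_int) auto
    have "of_int M * ?s - d \<in> grade n"
      by (rule grade_diff[OF grade_of_int[OF s] decomposable_grade[OF d(1)]])
    then have "of_int M * ?s - d \<in> null" using d(3) by (intro grade_null) auto
    then show ?thesis using d by blast
  qed
  show ?thesis
  proof (intro exI conjI)
    have kill: "\<xi> x y = 0" if "\<forall>\<eta>\<in>E. \<eta> y = 0" for x y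
      using P5[THEN spec, THEN spec] that by (rule mp)
    show "\<forall>x y. (\<forall>c\<in>C n. c y = 0) \<longrightarrow> \<xi> x y = 0"
    proof (intro allI impI kill ballI)
      fix y \<eta> assume y: "\<forall>c\<in>C n. c y = 0" and "\<eta> \<in> E"
      from this(2) show "\<eta> y = 0" by (rule E(4)) (rule y[THEN bspec])
    qed
    show "\<forall>x. \<forall>y\<in>decomposable n. \<xi> x y = 0"
      by (intro allI ballI kill) (rule E(3))
    show "\<forall>x\<in>grade n. \<exists>(M::int) y. M \<noteq> 0 \<and> y \<in> decomposable n \<and>
       of_int M * (x - (\<Sum>y\<in>Y. of_int (\<xi> y x) * y)) - y \<in> null" by (intro ballI res)
  qed (fact P1 P2 P3 P4)+
qed

text \<open>The variables must come from a prescribed type, so \<open>lab\<close> names the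
  generators. Distinct generators receive distinct names because the dual functionals, which
  separate them, vanish on \<open>null\<close>.\<close>

theorem polynomial_generators:
  fixes lab :: "'r \<Rightarrow> 'i"
  assumes lab: "\<And>x y. lab x = lab y \<Longrightarrow> x - y \<in> null"
  obtains I :: "'i set" and d e where "\<And>i. i \<in> I \<Longrightarrow> 0 < d i" "\<And>i. i \<in> I \<Longrightarrow> e i \<in> grade (d i)"
    "\<And>f. f \<in> poly_over I \<Longrightarrow> poly_eval e f \<in> null \<Longrightarrow> f = 0"
    "\<And>x. \<exists>f\<in>poly_over I. x - poly_eval e f \<in> null"
proof -
  from indecomposables have "\<forall>n. \<exists>P. (\<lambda>(Y, \<xi>). finite Y \<and> Y \<subseteq> grade n \<and> (\<forall>x. additive (\<xi> x)) \<and>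
    (\<forall>x\<in>Y. \<forall>y\<in>Y. \<xi> x y = (if x = y then 1 else 0)) \<and>
    (\<forall>x y. (\<forall>c\<in>C n. c y = 0) \<longrightarrow> \<xi> x y = (0::int)) \<and>
    (\<forall>x. \<forall>y\<in>decomposable n. \<xi> x y = 0) \<and>
    (\<forall>x\<in>grade n. \<exists>(M::int) y. M \<noteq> 0 \<and> y \<in> decomposable n \<and>
       of_int M * (x - (\<Sum>y\<in>Y. of_int (\<xi> y x) * y)) - y \<in> null)) P"
    by (simp only: split_paired_Ex prod.case) blast
  then obtain P where P: "\<forall>n. (\<lambda>(Y, \<xi>). finite Y \<and> Y \<subseteq> grade n \<and> (\<forall>x. additive (\<xi> x)) \<and>
    (\<forall>x\<in>Y. \<forall>y\<in>Y. \<xi> x y = (if x = y then 1 else 0)) \<and>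
    (\<forall>x y. (\<forall>c\<in>C n. c y = 0) \<longrightarrow> \<xi> x y = (0::int)) \<and>
    (\<forall>x. \<forall>y\<in>decomposable n. \<xi> x y = 0) \<and>
    (\<forall>x\<in>grade n. \<exists>(M::int) y. M \<noteq> 0 \<and> y \<in> decomposable n \<and>
       of_int M * (x - (\<Sum>y\<in>Y. of_int (\<xi> y x) * y)) - y \<in> null)) (P n)"
    by (rule choice[THEN exE])
  define Y \<xi> where "Y n = fst (P n)" and "\<xi> n = snd (P n)" for n
  have Q: "finite (Y n) \<and> Y n \<subseteq> grade n \<and> (\<forall>x. additive (\<xi> n x)) \<and>
    (\<forall>x\<in>Y n. \<forall>y\<in>Y n. \<xi> n x y = (if x = y then 1 else 0)) \<and>
    (\<forall>x y. (\<forall>c\<in>C n. c y = 0) \<longrightarrow> \<xi> n x y = 0) \<and>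
    (\<forall>x. \<forall>y\<in>decomposable n. \<xi> n x y = 0) \<and>
    (\<forall>x\<in>grade n. \<exists>(M::int) y. M \<noteq> 0 \<and> y \<in> decomposable n \<and>
       of_int M * (x - (\<Sum>y\<in>Y n. of_int (\<xi> n y x) * y)) - y \<in> null)" for n
    using P[THEN spec, of n] unfolding Y_def \<xi>_def case_prod_beta .
  note Q1 = Q[THEN conjunct1]
  note Q2 = Q[THEN conjunct2, THEN conjunct1]
  note Q3 = Q[THEN conjunct2, THEN conjunct2, THEN conjunct1]
  note Q4 = Q[THEN conjunct2, THEN conjunct2, THEN conjunct2, THEN conjunct1]
  note Q5 = Q[THEN conjunct2, THEN conjunct2, THEN conjunct2, THEN conjunct2, THEN conjunct1]
  note Q6 = Q[THEN conjunct2, THEN conjunct2, THEN conjunct2, THEN conjunct2, THEN conjunct2, THEN conjunct1]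
  note Q7 = Q[THEN conjunct2, THEN conjunct2, THEN conjunct2, THEN conjunct2, THEN conjunct2, THEN conjunct2]
  have Yg: "x \<in> grade n" if "x \<in> Y n" for n x using Q2[of n] that by blast
  have add: "additive (\<xi> n x)" for n x using Q3[of n] by blast
  have dual: "\<xi> n x y = (if x = y then 1 else 0)" if "x \<in> Y n" "y \<in> Y n" for n x y
    using Q4[of n] that by blast
  have kill: "\<xi> n x y = 0" if "\<And>c. c \<in> C n \<Longrightarrow> c y = 0" for n x y using Q5[of n, THEN spec, THEN spec, of y x] that by blast
  have kill_null: "\<xi> n x y = 0" if "y \<in> null" for n x y using that by (intro kill) (auto simp: null_def)
  have kill_grade: "\<xi> n x y = 0" if "y \<in> grade m" "m \<noteq> n" for n m x y
    using that by (intro kill) (auto simp: grade_def)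
  have Y_unique: "m = n \<and> x = y" if xy: "x \<in> Y m" "y \<in> Y n" and l: "lab x = lab y" for m n x y
  proof -
    have xy_null: "x - y \<in> null" by (rule lab[OF l])
    have one: "\<xi> m x y = 1"
      using kill_null[OF xy_null, of m x] dual[OF xy(1) xy(1)] by (simp add: additive.diff[OF add])
    then have mn: "m = n" using kill_grade[OF Yg[OF xy(2)], of m x] by auto
    then show ?thesis using dual[OF xy(1), of y] xy(2) one by (auto split: if_splits)
  qed
  define I where "I = {i. \<exists>n>0. \<exists>x\<in>Y n. lab x = i}"
  define d where "d i = (SOME n. 0 < n \<and> (\<exists>x\<in>Y n. lab x = i))" for i
  define e where "e i = (SOME x. x \<in> Y (d i) \<and> lab x = i)" for i
  have d: "0 < d i" "\<exists>x\<in>Y (d i). lab x = i" if "i \<in> I" for i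
    using someI_ex[of "\<lambda>n. 0 < n \<and> (\<exists>x\<in>Y n. lab x = i)"] that unfolding I_def d_def by blast+
  have e: "e i \<in> Y (d i)" "lab (e i) = i" if "i \<in> I" for i
    using someI_ex[of "\<lambda>x. x \<in> Y (d i) \<and> lab x = i"] d(2)[OF that] unfolding e_def by blast+
  have e_lab: "lab x \<in> I" "e (lab x) = x" if "x \<in> Y n" "0 < n" for x n
  proof -
    show I: "lab x \<in> I" using that by (auto simp: I_def)
    show "e (lab x) = x" using Y_unique[OF e(1)[OF I] that(1)] e(2)[OF I] by blast
  qed
  have "\<exists>D. derivation D \<and> (\<forall>x\<in>null. D x \<in> null) \<and> (\<forall>m<d i. \<forall>x\<in>grade m. D x \<in> null) \<and>
          (\<forall>x\<in>grade (d i). D x - of_int (\<xi> (d i) (e i) x) \<in> null)" if i: "i \<in> I" for i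
  proof (rule null_der[OF d(1)[OF i] add])
    show "\<xi> (d i) (e i) x = 0" if "x \<in> null" for x using that by (rule kill_null)
    show "\<xi> (d i) (e i) x = 0" if "m \<noteq> d i" "x \<in> grade m" for m x using that by (intro kill_grade)
    show "\<xi> (d i) (e i) (x * y) = 0"
      if "0 < k" "0 < j" "k + j = d i" "x \<in> grade k" "y \<in> grade j" for k j x y
      using Q6[of "d i"] decomposables.prod[OF that] by blast
  qed
  then have "\<forall>i\<in>I. \<exists>D. derivation D \<and> (\<forall>x\<in>null. D x \<in> null) \<and> (\<forall>m<d i. \<forall>x\<in>grade m. D x \<in> null) \<and>
          (\<forall>x\<in>grade (d i). D x - of_int (\<xi> (d i) (e i) x) \<in> null)" by blast
  then obtain D where D: "\<forall>i\<in>I. derivation (D i) \<and> (\<forall>x\<in>null. D i x \<in> null) \<and>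
      (\<forall>m<d i. \<forall>x\<in>grade m. D i x \<in> null) \<and> (\<forall>x\<in>grade (d i). D i x - of_int (\<xi> (d i) (e i) x) \<in> null)"
    by (rule bchoice[THEN exE])
  interpret coordinate_system C I d e D
  proof (intro coordinate_system.intro coordinate_system_axioms.intro)
    show "polynomial_criterion C" by (rule polynomial_criterion_axioms)
    fix i assume i: "i \<in> I"
    show "0 < d i" "e i \<in> grade (d i)" using d(1)[OF i] Yg[OF e(1)[OF i]] by auto
    show "derivation (D i)" using D i by blast
    show "D i x \<in> null" if "x \<in> null" for x using D i that by blast
    fix j assume j: "j \<in> I"
    have ej: "e j \<in> grade (d j)" by (rule Yg[OF e(1)[OF j]])
    show "D i (e j) \<in> null" if "d j < d i" using D i ej that by blast
    show "D i (e j) - (if i = j then 1 else 0) \<in> null" if eq: "d j = d i"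
    proof -
      have "e j \<in> Y (d i)" using e(1)[OF j] by (simp only: eq)
      then have "\<xi> (d i) (e i) (e j) = (if e i = e j then 1 else 0)" by (rule dual[OF e(1)[OF i]])
      moreover have "e i = e j \<longleftrightarrow> i = j" using e(2)[OF i] e(2)[OF j] by metis
      moreover have "e j \<in> grade (d i)" using ej by (simp only: eq)
      then have "D i (e j) - of_int (\<xi> (d i) (e i) (e j)) \<in> null" using D i by blast
      ultimately show ?thesis by (cases "i = j") simp_all
    qed
  qed
  \<comment> \<open>The subring generated by the \<open>e i\<close>, enlarged by
    \<open>null\<close>. It is shown to contain every degree.\<close>
  define S where "S = {x. \<exists>f\<in>poly_over I. x - poly_eval e f \<in> null}"
  have S_diff: "x - y \<in> S" if xy: "x \<in> S" "y \<in> S" for x y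
  proof -
    obtain f g where fg: "f \<in> poly_over I" "g \<in> poly_over I" "x - poly_eval e f \<in> null" "y - poly_eval e g \<in> null"
      using xy by (auto simp: S_def)
    have "(x - y) - poly_eval e (f - g) \<in> null"
      using null_diff[OF fg(3,4)] by (simp add: poly_eval_diff algebra_simps)
    then show ?thesis using poly_over_diff[OF fg(1,2)] by (auto simp: S_def)
  qed
  have S_mult: "x * y \<in> S" if xy: "x \<in> S" "y \<in> S" for x y
  proof -
    obtain f g where fg: "f \<in> poly_over I" "g \<in> poly_over I" "x - poly_eval e f \<in> null" "y - poly_eval e g \<in> null"
      using xy by (auto simp: S_def)
    have "x * y - poly_eval e (f * g) = (x - poly_eval e f) * y + poly_eval e f * (y - poly_eval e g)"
      by (simp add: poly_eval_mult algebra_simps)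
    then have "x * y - poly_eval e (f * g) \<in> null"
      using null_add[OF null_mult[OF fg(3), of y] null_mult_left[OF fg(4), of "poly_eval e f"]] by simp
    then show ?thesis using poly_over_mult[OF fg(1,2)] by (auto simp: S_def)
  qed
  have S_null: "x \<in> S" if "x \<in> null" for x using that by (auto simp: S_def intro!: bexI[of _ 0])
  have S_add: "x + y \<in> S" if "x \<in> S" "y \<in> S" for x y
    using S_diff[OF that(1) S_diff[OF S_null[OF null_zero] that(2)]] by simp
  have S_sum: "sum f K \<in> S" if "\<And>k. k \<in> K \<Longrightarrow> f k \<in> S" for f and K :: "'k set"
    using that by (induction K rule: infinite_finite_induct) (auto intro: S_add S_null)
  have S_of_int: "of_int c \<in> S" for c
    unfolding S_def by (auto intro!: bexI[of _ "frag_cmul c (frag_of 0)"] poly_over_frag_cmul simp del: single_one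
      simp: poly_eval_frag_cmul)
  have S_grade: "x \<in> S" if "x \<in> grade n" for x n
    using that
  proof (induction n arbitrary: x rule: less_induct)
    case (less n)
    show ?case
    proof (cases "n = 0")
      case True
      then obtain c where "x - of_int c \<in> null" using grade_0 less.prems by blast
      from S_add[OF S_null[OF this] S_of_int[of c]] show ?thesis by simp
    next
      case False
      have dec: "y \<in> S" if "y \<in> decomposable n" for y
        using that
      proof (induction rule: decomposables.induct)
        case (prod i j x y)
        then show ?case using less.IH[of i x] less.IH[of j y] by (intro S_mult) auto
      qed (auto intro: S_diff S_null)
      obtain M y where My: "M \<noteq> 0" "y \<in> decomposable n"
        "of_int M * (x - (\<Sum>y\<in>Y n. of_int (\<xi> n y x) * y)) - y \<in> null"
        using Q7[of n, THEN bspec, OF less.prems] by (elim exE conjE)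
      \<comment> \<open>What the dual functionals do not see. A nonzero multiple of s is
        decomposable up to \<open>null\<close>, hence in S by the induction hypothesis; saturation
        cancels the multiple.\<close>
      define s where "s = x - (\<Sum>y\<in>Y n. of_int (\<xi> n y x) * y)"
      obtain f where f: "f \<in> poly_over I" "y - poly_eval e f \<in> null" using dec[OF My(2)] by (auto simp: S_def)
      have Ms: "of_int M * s - poly_eval e f \<in> null"
        using null_add[OF My(3)[folded s_def] f(2)] by (simp add: algebra_simps)
      have "s \<in> S"
      proof (cases "M > 0")
        case True
        then have "of_nat (nat M) * s - poly_eval e f \<in> null" using Ms by simp
        from poly_eval_saturated[OF _ _ this] show ?thesis using f(1) True by (auto simp: S_def poly_over_def)
      next
        case False
        then have "of_nat (nat (- M)) * s - poly_eval e (- f) \<in> null"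
          using null_uminus[OF Ms] by (simp add: additive.minus[OF poly_eval_additive])
        from poly_eval_saturated[OF _ _ this] show ?thesis using f(1) False My(1) by (auto simp: S_def poly_over_def)
      qed
      moreover have "(\<Sum>y\<in>Y n. of_int (\<xi> n y x) * y) \<in> S"
      proof (intro S_sum S_mult S_of_int)
        fix y assume y: "y \<in> Y n"
        then show "y \<in> S" unfolding S_def using e_lab[OF y] False
          by (intro CollectI bexI[of _ "frag_of (single (lab y) 1)"]) auto
      qed
      ultimately have "s + (\<Sum>y\<in>Y n. of_int (\<xi> n y x) * y) \<in> S" by (rule S_add)
      then show ?thesis by (simp add: s_def)
    qed
  qed
  have S_all: "x \<in> S" for x
  proof -
    obtain f and M :: nat where f: "\<And>n. f n \<in> grade n" "x - (\<Sum>n\<le>M. f n) \<in> null"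
      using grade_decomp[of x] by blast
    have "(\<Sum>n\<le>M. f n) \<in> S" using f(1) S_grade by (intro S_sum) blast
    from S_add[OF S_null[OF f(2)] this] show ?thesis by simp
  qed
  show ?thesis
  proof (rule that[of I d e])
    show "f = 0" if "f \<in> poly_over I" "poly_eval e f \<in> null" for f
      using that by (intro poly_eval_null) (auto simp: poly_over_def)
    show "\<exists>f\<in>poly_over I. x - poly_eval e f \<in> null" for x using S_all by (auto simp: S_def)
  qed (use d_pos e_grade in auto)
qed

end

section \<open>Coordinates on a connected graded ring\<close>

context graded_ring
begin

lemma G_sub: "x \<in> G n \<Longrightarrow> x \<in> carrier A"
  by (rule subsetD[OF additive_subgroup.a_subset[OF grade_subgroup]])

lemma G_zero [simp]: "\<zero> \<in> G n"
  by (rule additive_subgroup.zero_closed[OF grade_subgroup])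

lemma G_add: "x \<in> G n \<Longrightarrow> y \<in> G n \<Longrightarrow> x \<oplus> y \<in> G n"
  by (rule additive_subgroup.a_closed[OF grade_subgroup])

lemma G_pow: "x \<in> G n \<Longrightarrow> x [^] (k::nat) \<in> G (k * n)"
proof (induction k)
  case 0 then show ?case using one_grade by simp
next
  case (Suc k) then show ?case using mult_grade[of "x [^] k" "k * n" x n] by (simp add: Groups.add.commute[of n])
qed

definition homog :: "'a \<Rightarrow> nat \<Rightarrow> 'a" where
  "homog x = (THE f. (\<forall>n. f n \<in> G n) \<and> finite {n. f n \<noteq> \<zero>} \<and> x = (\<Oplus>n\<in>{n. f n \<noteq> \<zero>}. f n))"

lemma homog:
  assumes "x \<in> carrier A"
  shows "homog x n \<in> G n" "finite {n. homog x n \<noteq> \<zero>}" "x = (\<Oplus>n\<in>{n. homog x n \<noteq> \<zero>}. homog x n)"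
  using theI'[OF direct_sum[OF assms]] unfolding homog_def by blast+

lemma homog_unique:
  assumes "\<And>n. f n \<in> G n" "finite S" "{n. f n \<noteq> \<zero>} \<subseteq> S" "x = (\<Oplus>n\<in>S. f n)"
  shows "homog x = f"
proof -
  have f: "f \<in> S \<rightarrow> carrier A" using assms(1) G_sub by auto
  have x: "x \<in> carrier A" unfolding assms(4) by (rule finsum_closed[OF f])
  have "x = (\<Oplus>n\<in>{n. f n \<noteq> \<zero>}. f n)"
    unfolding assms(4) by (rule add.finprod_mono_neutral_cong_right) (use assms f in auto)
  then show ?thesis
    using the1_equality[OF direct_sum[OF x], of f] assms finite_subset[OF assms(3,2)]
    unfolding homog_def by blast
qed

lemma homog_add:
  assumes "x \<in> carrier A" "y \<in> carrier A"
  shows "homog (x \<oplus> y) n = homog x n \<oplus> homog y n"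
proof -
  let ?S = "{n. homog x n \<noteq> \<zero>} \<union> {n. homog y n \<noteq> \<zero>}"
  have fin: "finite ?S" using homog(2)[OF assms(1)] homog(2)[OF assms(2)] by simp
  have cl: "homog x \<in> B \<rightarrow> carrier A" "homog y \<in> B \<rightarrow> carrier A" for B
    using homog(1)[OF assms(1)] homog(1)[OF assms(2)] G_sub by auto
  have "x = (\<Oplus>n\<in>?S. homog x n)" 
    by (rule trans[OF homog(3)[OF assms(1)]], rule add.finprod_mono_neutral_cong_left[OF fin])
      (use cl in auto)
  moreover have "y = (\<Oplus>n\<in>?S. homog y n)"
    by (rule trans[OF homog(3)[OF assms(2)]], rule add.finprod_mono_neutral_cong_left[OF fin])
      (use cl in auto)
  ultimately have "x \<oplus> y = (\<Oplus>n\<in>?S. homog x n \<oplus> homog y n)"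
    using finsum_addf[OF cl] by simp
  then have "homog (x \<oplus> y) = (\<lambda>n. homog x n \<oplus> homog y n)"
    by (intro homog_unique[OF _ fin]) (auto intro: G_add homog(1) assms)
  then show ?thesis by simp
qed

lemma homog_G:
  assumes "x \<in> G m"
  shows "homog x n = (if n = m then x else \<zero>)"
proof -
  have "homog x = (\<lambda>n. if n = m then x else \<zero>)"
    by (rule homog_unique[where S = "{m}"]) (use assms G_sub in auto)
  then show ?thesis by simp
qed

lemma carrier_induct [consumes 1, case_names zero grade add]:
  assumes "x \<in> carrier A" "P \<zero>" "\<And>n a. a \<in> G n \<Longrightarrow> P a"
    "\<And>x y. x \<in> carrier A \<Longrightarrow> y \<in> carrier A \<Longrightarrow> P x \<Longrightarrow> P y \<Longrightarrow> P (x \<oplus> y)"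
  shows "P x"
proof -
  have "P (\<Oplus>n\<in>S. homog x n)" if "finite S" for S
    using that
  proof (induction S)
    case (insert n S)
    have c: "homog x \<in> S \<rightarrow> carrier A" "homog x n \<in> carrier A" using homog(1)[OF assms(1)] G_sub by auto
    have "P (homog x n \<oplus> finsum A (homog x) S)"
      using insert.IH by (intro assms(4) c(2) finsum_closed[OF c(1)] assms(3)[OF homog(1)[OF assms(1)]])
    then show ?case using insert.hyps c by simp
  qed (simp add: assms(2))
  then show ?thesis using homog(2,3)[OF assms(1)] by metis
qed

end

context connected_graded_comm_ring
begin

definition rk :: "nat \<Rightarrow> nat" where
  "rk n = (SOME k. free_Abelian_group {..<k} \<cong> add_monoid (A\<lparr>carrier := G n\<rparr>))"

definition param :: "nat \<Rightarrow> (nat \<Rightarrow>\<^sub>0 int) \<Rightarrow> 'a" where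
  "param n = (SOME h. h \<in> iso (free_Abelian_group {..<rk n}) (add_monoid (A\<lparr>carrier := G n\<rparr>)))"

lemma param_iso: "param n \<in> iso (free_Abelian_group {..<rk n}) (add_monoid (A\<lparr>carrier := G n\<rparr>))"
proof -
  have "free_Abelian_group {..<rk n} \<cong> add_monoid (A\<lparr>carrier := G n\<rparr>)"
    unfolding rk_def by (rule someI_ex[OF finite_free])
  then have "\<exists>h. h \<in> iso (free_Abelian_group {..<rk n}) (add_monoid (A\<lparr>carrier := G n\<rparr>))"
    unfolding is_iso_def by blast
  then show ?thesis unfolding param_def by (rule someI_ex)
qed

lemma param_bij: "bij_betw (param n) {f. keys f \<subseteq> {..<rk n}} (G n)"
  using param_iso[of n] by (simp add: iso_def carrier_free_Abelian_group_iff free_Abelian_group_def)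

lemma param_add:
  "keys f \<subseteq> {..<rk n} \<Longrightarrow> keys g \<subseteq> {..<rk n} \<Longrightarrow>
    param n (f + g) = param n f \<oplus> param n g"
  using param_iso[of n] by (simp add: iso_def hom_def free_Abelian_group_def)

lemma param_G: "keys f \<subseteq> {..<rk n} \<Longrightarrow> param n f \<in> G n"
  using bij_betw_apply[OF param_bij] by blast

text \<open>An index is a degree together with a position in the chosen basis of that degree. The
  default \<zero> keeps \<open>bas c\<close> in \<open>G (fst c)\<close> without a side
  condition.\<close>

definition bas :: "nat \<times> nat \<Rightarrow> 'a" where
  "bas c = (if snd c < rk (fst c) then param (fst c) (frag_of (snd c)) else \<zero>)"

definition coord :: "nat \<times> nat \<Rightarrow> 'a \<Rightarrow> int" where
  "coord c x = lookup
    (inv_into {f. keys f \<subseteq> {..<rk (fst c)}} (param (fst c)) (homog x (fst c))) (snd c)"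

lemma bas_G: "bas c \<in> G (fst c)"
  by (auto simp: bas_def intro: param_G)

lemma bas_carrier [simp]: "bas c \<in> carrier A"
  using bas_G G_sub by blast

lemma coord_param:
  assumes "keys f \<subseteq> {..<rk n}"
  shows "coord (n, i) (param n f) = lookup f i"
proof -
  have "inv_into {f. keys f \<subseteq> {..<rk n}} (param n) (param n f) = f"
    by (rule inv_into_f_f) (use assms param_bij[of n] in \<open>auto simp: bij_betw_def\<close>)
  then show ?thesis using homog_G[OF param_G[OF assms]] by (simp add: coord_def)
qed

lemma G_paramE:
  assumes "x \<in> G n"
  obtains f where "keys f \<subseteq> {..<rk n}" "x = param n f"
  using assms param_bij[of n] by (auto simp: bij_betw_def)

lemma coord_homog: "x \<in> carrier A \<Longrightarrow> coord c x = coord c (homog x (fst c))"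
  using homog_G[OF homog(1)] by (simp add: coord_def)

lemma coord_add:
  assumes "x \<in> carrier A" "y \<in> carrier A"
  shows "coord c (x \<oplus> y) = coord c x + coord c y"
proof -
  obtain n i where c: "c = (n, i)" by (cases c)
  obtain f where f: "keys f \<subseteq> {..<rk n}" "homog x n = param n f"
    using G_paramE[OF homog(1)[OF assms(1)]] by blast
  obtain g where g: "keys g \<subseteq> {..<rk n}" "homog y n = param n g"
    using G_paramE[OF homog(1)[OF assms(2)]] by blast
  have k: "keys (f + g) \<subseteq> {..<rk n}" using f(1) g(1) keys_add[of f g] by blast
  have "coord c (x \<oplus> y) = coord c (homog (x \<oplus> y) n)" using assms by (subst coord_homog) (auto simp: c)
  also have "\<dots> = coord c (param n (f + g))" using f g by (simp add: homog_add assms param_add)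
  also have "\<dots> = coord c (homog x n) + coord c (homog y n)"
    unfolding f(2) g(2) c coord_param[OF k] coord_param[OF f(1)] coord_param[OF g(1)] by (simp add: lookup_add)
  finally show ?thesis using coord_homog[OF assms(1), of c] coord_homog[OF assms(2), of c] by (simp add: c)
qed

lemma coord_zero [simp]: "coord c \<zero> = 0"
  using coord_add[of \<zero> \<zero> c] by simp

lemma coord_uminus: "x \<in> carrier A \<Longrightarrow> coord c (\<ominus> x) = - coord c x"
  using coord_add[of x "\<ominus> x" c] by (simp add: r_neg)

lemma coord_pow_nat: "x \<in> carrier A \<Longrightarrow> coord c (add_pow A (k::nat) x) = int k * coord c x"
  by (induction k) (simp_all add: coord_add add.nat_pow_Suc distrib_right)

lemma coord_pow_int: "x \<in> carrier A \<Longrightarrow> coord c (add_pow A (k::int) x) = k * coord c x"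
proof (cases k rule: int_cases2)
  case (nonneg n)
  have "add_pow A (int n) x = add_pow A n x" by (simp add: add_pow_def int_pow_int)
  then show "x \<in> carrier A \<Longrightarrow> ?thesis" by (simp add: nonneg coord_pow_nat)
next
  case (nonpos n)
  assume x: "x \<in> carrier A"
  have "add_pow A (- int n) x = \<ominus> add_pow A n x"
    using add.int_pow_neg_int[OF x, of n] by (simp add: a_inv_def add_pow_def)
  then show ?thesis using x by (simp add: nonpos coord_pow_nat coord_uminus)
qed

lemma coord_finsum:
  "f \<in> S \<rightarrow> carrier A \<Longrightarrow> coord c (finsum A f S) = (\<Sum>i\<in>S. coord c (f i))"
proof (induction S rule: infinite_finite_induct)
  case (insert i S)
  then show ?case by (subst finsum_insert) (auto simp: coord_add Pi_def finsum_closed)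
qed simp_all

lemma coord_other: "x \<in> G m \<Longrightarrow> m \<noteq> fst c \<Longrightarrow> coord c x = 0"
  using coord_homog[of x c] homog_G[of x m "fst c"] G_sub[of x m] by simp

lemma coord_big: "x \<in> carrier A \<Longrightarrow> rk (fst c) \<le> snd c \<Longrightarrow> coord c x = 0"
proof -
  assume x: "x \<in> carrier A" and le: "rk (fst c) \<le> snd c"
  obtain f where f: "keys f \<subseteq> {..<rk (fst c)}" "homog x (fst c) = param (fst c) f"
    using G_paramE[OF homog(1)[OF x]] by blast
  have "coord c x = lookup f (snd c)"
    using coord_homog[OF x, of c] coord_param[OF f(1), of "snd c"] f(2) by simp
  then show ?thesis using f(1) le by (metis in_keys_iff lessThan_iff not_le subsetD)
qed

lemma functional_expand:
  assumes F: "\<And>x y. x \<in> carrier A \<Longrightarrow> y \<in> carrier A \<Longrightarrow> F (x \<oplus> y) = F x + (F y :: int)"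
    and x: "x \<in> G n"
  shows "F x = (\<Sum>i<rk n. coord (n, i) x * F (bas (n, i)))"
proof -
  obtain f where f: "keys f \<subseteq> {..<rk n}" "x = param n f" using G_paramE[OF x] .
  have F0: "F \<zero> = 0" using F[of \<zero> \<zero>] by simp
  have p0: "param n 0 = \<zero>"
  proof -
    have "param n 0 \<oplus> param n 0 = param n 0" using param_add[of 0 n 0] by simp
    then show ?thesis using G_sub[OF param_G[of 0 n]] by (simp add: add.l_cancel_one)
  qed
  have "keys f \<subseteq> {..<rk n} \<and>
    F (param n f) = (\<Sum>i<rk n. lookup f i * F (bas (n, i)))"
    using f(1)
  proof (induction f rule: frag_induction)
    case (one i)
    then show ?case by (simp add: bas_def if_distrib[of "\<lambda>x. x * _"] cong: if_cong)
  next
    case (diff a b)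
    then have k: "keys (a - b) \<subseteq> {..<rk n}" using keys_diff[of a b] by blast
    have "F (param n a) = F (param n (a - b)) + F (param n b)"
      using param_add[OF k, of b] diff.IH(2) F[of "param n (a - b)" "param n b"] G_sub[OF param_G] k by simp
    then show ?case using k diff.IH by (simp add: lookup_minus left_diff_distrib sum_subtractf)
  qed (simp_all add: p0 F0)
  then show ?thesis unfolding f(2) by (simp add: coord_param[OF f(1)])
qed

lemma coord_bas:
  assumes "snd c' < rk (fst c')"
  shows "coord c (bas c') = (if c = c' then 1 else 0)"
proof -
  obtain n i m j where c: "c = (n, i)" "c' = (m, j)" by (cases c, cases c')
  show ?thesis
  proof (cases "n = m")
    case True
    have "keys (frag_of j) \<subseteq> {..<rk m}" using assms by (simp add: c)
    from coord_param[OF this, of i] True assms show ?thesis by (auto simp: bas_def c)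
  next
    case False
    then show ?thesis using coord_other[OF bas_G, of c' c] by (auto simp: c)
  qed
qed

lemma zero_mod_add:
  assumes "zero_mod A p x" "zero_mod A p y" shows "zero_mod A p (x \<oplus> y)"
proof -
  obtain a b where "a \<in> carrier A" "b \<in> carrier A" "x = add_pow A p a" "y = add_pow A p b"
    using assms by (auto simp: zero_mod_def)
  then show ?thesis unfolding zero_mod_def by (auto simp: add.nat_pow_distrib intro!: bexI[of _ "a \<oplus> b"])
qed

lemma zero_mod_zero [simp]: "zero_mod A p \<zero>"
  unfolding zero_mod_def by (auto intro!: bexI[of _ \<zero>])

lemma zero_mod_iff:
  assumes x: "x \<in> carrier A"
  shows "zero_mod A p x \<longleftrightarrow> (\<forall>c. int p dvd coord c x)"
proof
  assume "zero_mod A p x"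
  then show "\<forall>c. int p dvd coord c x" by (auto simp: zero_mod_def coord_pow_nat)
next
  assume dvd: "\<forall>c. int p dvd coord c x"
  have "zero_mod A p (homog x n)" for n
  proof -
    obtain f where f: "keys f \<subseteq> {..<rk n}" "homog x n = param n f"
      using G_paramE[OF homog(1)[OF x]] by blast
    have "int p dvd lookup f i" for i
      using dvd coord_homog[OF x, of "(n, i)"] coord_param[OF f(1), of i] f(2) by (metis fst_conv)
    then obtain g where g: "f = frag_cmul (int p) g" using frag_dvdE by blast
    show ?thesis
    proof (cases "p = 0")
      case True
      have "param n 0 \<oplus> param n 0 = param n 0" using param_add[of 0 n 0] by simp
      then have "param n 0 = \<zero>" using G_sub[OF param_G[of 0 n]] by (simp add: add.l_cancel_one)
      then show ?thesis using f(2) g True by simp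
    next
      case False
      then have k: "keys g \<subseteq> {..<rk n}" using f(1) g by auto
      have "param n (frag_cmul (int (Suc k)) g) = add_pow A (Suc k) (param n g)" for k
      proof (induction k)
        case 0 show ?case using G_sub[OF param_G[OF k]] by simp
      next
        case (Suc k)
        have "keys (frag_cmul (int (Suc k)) g) \<subseteq> {..<rk n}" using k by auto
        then have "param n (frag_cmul (int (Suc k)) g + g) = param n (frag_cmul (int (Suc k)) g) \<oplus> param n g"
          using k by (rule param_add)
        moreover have "frag_cmul (int (Suc (Suc k))) g = frag_cmul (int (Suc k)) g + g"
          by (rule poly_mapping_eqI) (simp add: lookup_add algebra_simps)
        ultimately show ?case using Suc by simp
      qed
      from this[of "p - 1"] False have "homog x n = add_pow A p (param n g)" using f(2) g by simp
      then show ?thesis using G_sub[OF param_G[OF k]] by (auto simp: zero_mod_def)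
    qed
  qed
  moreover have "zero_mod A p (\<Oplus>n\<in>S. homog x n)" if "finite S" "\<And>n. zero_mod A p (homog x n)" for S
    using that(1)
  proof (induction S)
    case (insert n S)
    then show ?case using homog(1)[OF x] G_sub by (subst finsum_insert) (auto intro: zero_mod_add that(2))
  qed simp
  ultimately show "zero_mod A p x" using homog(2,3)[OF x] by metis
qed

lemma eq_zero_if_coord:
  assumes x: "x \<in> carrier A" and "\<And>c. coord c x = 0"
  shows "x = \<zero>"
proof -
  \<comment> \<open>Divisibility by 0 means vanishing, so the criterion for divisibility is applied
    with p = 0.\<close>
  obtain y where "x = add_pow A (0::nat) y" using zero_mod_iff[OF x, of 0] assms(2) by (auto simp: zero_mod_def)
  then show ?thesis by simp
qed

text \<open>Graded commutativity makes the square equal to its negative, and A has no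
  torsion.\<close>

lemma odd_square:
  assumes "x \<in> G n" "odd n"
  shows "x \<otimes> x = \<zero>"
proof (rule eq_zero_if_coord)
  have x: "x \<in> carrier A" using assms G_sub by blast
  then show "x \<otimes> x \<in> carrier A" by simp
  have "x \<otimes> x = add_pow A ((-1::int) ^ (n * n)) (x \<otimes> x)" by (rule graded_comm) (use assms in auto)
  then have "coord c (x \<otimes> x) = - coord c (x \<otimes> x)" for c
    using coord_pow_int[of "x \<otimes> x" c "-1"] x assms(2) by simp
  then show "coord c (x \<otimes> x) = 0" for c by (simp add: equal_neg_zero)
qed

text \<open>The square of x is zero, so its p-th power vanishes for every prime p, and all
  coordinates of x are divisible by every prime.\<close>

lemma G_odd_if_reduced:
  assumes "\<And>p::nat. \<And>x. Factorial_Ring.prime p \<Longrightarrow> x \<in> carrier A \<Longrightarrow> zero_mod A p (x [^] p) \<Longrightarrow> zero_mod A p x"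
    and x: "x \<in> G n" "odd n"
  shows "x = \<zero>"
proof (rule eq_zero_if_coord)
  show cx: "x \<in> carrier A" using x G_sub by blast
  have dvd: "int p dvd coord c x" if p: "Factorial_Ring.prime p" for p c
  proof -
    obtain k where k: "p = Suc (Suc k)" using prime_ge_2_nat[OF p] by (metis add_2_eq_Suc le_Suc_ex)
    have "x [^] p = \<zero>"
      using odd_square[OF x] cx by (simp add: k m_assoc)
    then have "zero_mod A p x" using assms(1)[OF p cx] by simp
    then show ?thesis using zero_mod_iff[OF cx] by blast
  qed
  fix c
  obtain p where p: "Factorial_Ring.prime p" "p > nat \<bar>coord c x\<bar>" using bigger_prime by blast
  show "coord c x = 0"
    using dvd[OF p(1), of c] p(2) zdvd_imp_le[of "int p" "\<bar>coord c x\<bar>"] by fastforce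
qed

text \<open>\<open>\<int>\<close> is the degree \<open>0\<close> part, so its unit is not divisible.\<close>

lemma G_0_pow_dvd:
  assumes p: "Factorial_Ring.prime p" and x: "x \<in> G 0" and "\<And>c. int p dvd coord c (x [^] p)"
  shows "int p dvd coord c x"
proof -
  obtain h where h: "h \<in> ring_iso int_ring (A\<lparr>carrier := G 0\<rparr>)"
    using connected by (auto simp: is_ring_iso_def)
  have h_hom: "h (a + b) = h a \<oplus> h b" "h (a * b) = h a \<otimes> h b" "h 1 = \<one>" for a b
    using h by (auto simp: ring_iso_def ring_hom_def)
  have h_bij: "bij_betw h UNIV (G 0)" using h by (simp add: ring_iso_def)
  have hG: "h a \<in> G 0" for a using bij_betw_apply[OF h_bij] by simp
  \<comment> \<open>The basis chosen in degree 0 need not be \<one>, so the integer behind a degree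
    0 component is read off through the ring isomorphism h.\<close>
  define F where "F y = inv_into UNIV h (homog y 0)" for y
  have F_h: "F (h a) = a" for a
    using homog_G[OF hG[of a], of 0] h_bij by (simp add: F_def bij_betw_def)
  have F_add: "F (y \<oplus> z) = F y + F z" if yz: "y \<in> carrier A" "z \<in> carrier A" for y z
  proof -
    have "homog y 0 \<in> range h" "homog z 0 \<in> range h"
      using homog(1)[OF yz(1), of 0] homog(1)[OF yz(2), of 0] h_bij by (auto simp: bij_betw_def)
    then obtain a b where ab: "homog y 0 = h a" "homog z 0 = h b" by blast
    then show ?thesis using h_bij by (simp add: F_def homog_add yz flip: h_hom(1)) (simp add: bij_betw_def)
  qed
  obtain k where k: "x = h k" using x h_bij by (auto simp: bij_betw_def)
  have pow: "x [^] n = h (k ^ n)" for n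
    by (induction n) (simp_all add: k h_hom(3)[symmetric] h_hom(2)[symmetric] mult.commute)
  have F_eq: "F (x [^] p) = (\<Sum>i<rk 0. coord (0, i) (x [^] p) * F (bas (0, i)))"
    by (rule functional_expand[OF F_add]) (auto simp: pow hG)
  have "int p dvd F (x [^] p)" unfolding F_eq by (intro dvd_sum dvd_mult2 assms(3))
  then have "int p dvd k ^ p" by (simp add: pow F_h)
  then have "int p dvd k" using p prime_dvd_power_int[of "int p" k p] by simp
  then obtain l where l: "k = int p * l" by blast
  have mult: "coord c (h (int n * l)) = int n * coord c (h l)" for n
  proof (induction n)
    case 0
    have "h 0 \<oplus> h 0 = h 0" using h_hom(1)[of 0 0] by simp
    then have "h 0 = \<zero>" using G_sub[OF hG[of 0]] by (simp add: add.l_cancel_one)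
    then show ?case by simp
  next
    case (Suc n)
    then show ?case by (simp add: distrib_right h_hom(1) coord_add G_sub[OF hG])
  qed
  show ?thesis unfolding k l mult by simp
qed

text \<open>The structure constants of A. The index set depends on c alone and not on the degrees of
  a and b, as \<open>lderiv_mult\<close> demands; surplus terms vanish for degree reasons.\<close>

lemma coord_mult:
  assumes a: "a \<in> G m" "0 < m" and b: "b \<in> G n" "0 < n"
  shows "coord c (a \<otimes> b) =
    (\<Sum>(d, e)\<in>{(d, e). snd d < rk (fst d) \<and> snd e < rk (fst e) \<and> 0 < fst d \<and> 0 < fst e \<and> fst d + fst e = fst c}.
       coord c (bas d \<otimes> bas e) * coord d a * coord e b)"
    (is "_ = sum ?f ?T")
proof -
  have ac: "a \<in> carrier A" and bc: "b \<in> carrier A" using a b G_sub by auto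
  have fin: "finite ?T"
  proof (rule finite_subset)
    let ?B = "Sigma {..fst c} (\<lambda>n. {..<rk n})"
    show "?T \<subseteq> ?B \<times> ?B" by auto
  qed simp
  let ?S = "(\<lambda>(i, j). ((m, i), (n, j))) ` ({..<rk m} \<times> {..<rk n})"
  have "coord c (a \<otimes> b) = (\<Sum>i<rk m. coord (m, i) a * coord c (bas (m, i) \<otimes> b))"
    using bc by (intro functional_expand[where F = "\<lambda>a. coord c (a \<otimes> b)"])
      (auto simp: l_distr coord_add a)
  also have "\<dots> = (\<Sum>i<rk m. \<Sum>j<rk n. coord (m, i) a * (coord (n, j) b * coord c (bas (m, i) \<otimes> bas (n, j))))"
  proof -
    have "coord c (bas (m, i) \<otimes> b) = (\<Sum>j<rk n. coord (n, j) b * coord c (bas (m, i) \<otimes> bas (n, j)))" for i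
      by (intro functional_expand[where F = "\<lambda>b. coord c (bas (m, i) \<otimes> b)"])
        (auto simp: r_distr coord_add b)
    then show ?thesis by (simp add: sum_distrib_left)
  qed
  also have "\<dots> = sum ?f ?S"
    by (subst sum.reindex) (auto simp: inj_on_def sum.cartesian_product intro!: sum.cong)
  also have "\<dots> = sum ?f ?T"
  proof (cases "m + n = fst c")
    case True
    show ?thesis
    proof (rule sum.mono_neutral_left[OF fin])
      show "?S \<subseteq> ?T" using a(2) b(2) True by auto
      have "coord d a = 0 \<or> coord e b = 0" if "(d, e) \<in> ?T - ?S" for d e
      proof -
        have "fst d \<noteq> m \<or> fst e \<noteq> n"
        proof (rule ccontr)
          assume "\<not> ?thesis"
          then have "(d, e) = (\<lambda>(i, j). ((m, i), (n, j))) (snd d, snd e)" "(snd d, snd e) \<in> {..<rk m} \<times> {..<rk n}"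
            using that by (auto simp: prod_eq_iff)
          then have "(d, e) \<in> ?S" by (rule image_eqI)
          then show False using that by blast
        qed
        then show ?thesis using coord_other[OF a(1)] coord_other[OF b(1)] by metis
      qed
      then show "\<forall>x\<in>?T - ?S. ?f x = 0" by auto
    qed
  next
    case False
    have "?f x = 0" if xS: "x \<in> ?S" for x
    proof -
      obtain i j where x: "x = ((m, i), (n, j))" using xS by auto
      have "bas (m, i) \<otimes> bas (n, j) \<in> G (m + n)"
        using mult_grade[OF bas_G[of "(m, i)"] bas_G[of "(n, j)"]] by simp
      then show ?thesis using coord_other[of _ "m + n" c] False by (simp add: x)
    qed
    moreover have "?f x = 0" if "x \<in> ?T" for x
    proof -
      obtain d e where x: "x = (d, e)" by (cases x)
      have "fst d \<noteq> m \<or> fst e \<noteq> n" using that False x by auto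
      then show ?thesis using coord_other[OF a(1), of d] coord_other[OF b(1), of e] by (auto simp: x)
    qed
    ultimately show ?thesis by (simp add: sum.neutral)
  qed
  finally show ?thesis .
qed

end

text \<open>Either side of the equivalence leads here. A is then strictly commutative, and Koszul
  signs are 1 on words without a zero letter.\<close>

locale even_graded_ring = connected_graded_comm_ring +
  assumes G_odd: "odd n \<Longrightarrow> x \<in> G n \<Longrightarrow> x = \<zero>"
begin

lemma G_comm:
  assumes "x \<in> G m" "y \<in> G n"
  shows "x \<otimes> y = y \<otimes> x"
proof (cases "even m")
  case True
  then show ?thesis using graded_comm[OF assms] assms G_sub by auto
next
  case False
  then show ?thesis using G_odd[of m x] assms G_sub by auto
qed

lemma carrier_comm:
  assumes "x \<in> carrier A" "y \<in> carrier A"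
  shows "x \<otimes> y = y \<otimes> x"
proof -
  have 1: "x \<otimes> y = y \<otimes> x" if "x \<in> G m" "y \<in> carrier A" for x y m
    using that(2)
  proof (induction rule: carrier_induct)
    case (grade n a) then show ?case by (rule G_comm[OF that(1)])
  qed (use that G_sub in \<open>auto simp: l_distr r_distr\<close>)
  show ?thesis
    using assms(1)
  proof (induction rule: carrier_induct)
    case (grade n a) then show ?case by (rule 1[OF _ assms(2)])
  qed (use assms(2) in \<open>auto simp: l_distr r_distr\<close>)
qed

lemma cring_A: "cring A"
  by unfold_locales (rule carrier_comm)

text \<open>The binomial theorem seen through an additive functional; the factor z absorbs one x or
  one y in each step of the induction.\<close>

lemma functional_binomial:
  assumes F: "\<And>x y. x \<in> carrier A \<Longrightarrow> y \<in> carrier A \<Longrightarrow> F (x \<oplus> y) = F x + (F y :: int)"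
    and x: "x \<in> carrier A" and y: "y \<in> carrier A" and "z \<in> carrier A"
  shows "F ((x \<oplus> y) [^] n \<otimes> z) = (\<Sum>k\<le>n. int (n choose k) * F (x [^] k \<otimes> (y [^] (n - k) \<otimes> z)))"
  using assms(4)
proof (induction n arbitrary: z)
  case 0 then show ?case by simp
next
  case (Suc n)
  interpret cring A by (rule cring_A)
  define u where "u k = F (x [^] k \<otimes> (y [^] (Suc n - k) \<otimes> z))" for k
  have z: "z \<in> carrier A" by (rule Suc.prems)
  have "(x \<oplus> y) [^] Suc n \<otimes> z = (x \<oplus> y) [^] n \<otimes> (x \<otimes> z) \<oplus> (x \<oplus> y) [^] n \<otimes> (y \<otimes> z)"
    using x y z by (simp add: m_assoc l_distr r_distr)
  then have "F ((x \<oplus> y) [^] Suc n \<otimes> z) = F ((x \<oplus> y) [^] n \<otimes> (x \<otimes> z)) + F ((x \<oplus> y) [^] n \<otimes> (y \<otimes> z))"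
    using x y z F by simp
  also have "F ((x \<oplus> y) [^] n \<otimes> (x \<otimes> z)) = (\<Sum>k\<le>n. int (n choose k) * u (Suc k))"
  proof -
    have "x [^] k \<otimes> (y [^] (n - k) \<otimes> (x \<otimes> z)) = x [^] Suc k \<otimes> (y [^] (Suc n - Suc k) \<otimes> z)" for k
      using x y z by (simp add: m_ac)
    then show ?thesis using Suc.IH[of "x \<otimes> z"] x z by (simp add: u_def)
  qed
  also have "F ((x \<oplus> y) [^] n \<otimes> (y \<otimes> z)) = (\<Sum>k\<le>n. int (n choose k) * u k)"
  proof -
    have "y [^] (n - k) \<otimes> (y \<otimes> z) = y [^] (Suc n - k) \<otimes> z" if "k \<le> n" for k
      using that x y z by (simp add: m_assoc Suc_diff_le)
    then show ?thesis using Suc.IH[of "y \<otimes> z"] y z by (simp add: u_def)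
  qed
  also have "(\<Sum>k\<le>n. int (n choose k) * u (Suc k)) + (\<Sum>k\<le>n. int (n choose k) * u k)
    = (\<Sum>k\<le>Suc n. int (Suc n choose k) * u k)"
  proof -
    have "(\<Sum>k\<le>n. int (n choose k) * u k) = (\<Sum>k\<le>Suc n. int (n choose k) * u k)"
      by (simp add: binomial_eq_0)
    also have "\<dots> = u 0 + (\<Sum>k\<le>n. int (n choose Suc k) * u (Suc k))"
      by (subst sum.atMost_Suc_shift) simp
    finally have l: "(\<Sum>k\<le>n. int (n choose k) * u k) = u 0 + (\<Sum>k\<le>n. int (n choose Suc k) * u (Suc k))" .
    have "(\<Sum>k\<le>Suc n. int (Suc n choose k) * u k) = u 0 + (\<Sum>k\<le>n. int (Suc n choose Suc k) * u (Suc k))"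
      by (subst sum.atMost_Suc_shift) simp
    then show ?thesis unfolding l by (simp add: sum.distrib distrib_right)
  qed
  finally show ?case by (simp only: u_def)
qed

lemma coord_frob_add:
  assumes p: "Factorial_Ring.prime p" and "x \<in> carrier A" "y \<in> carrier A"
  shows "int p dvd coord c ((x \<oplus> y) [^] p) - (coord c (x [^] p) + coord c (y [^] p))"
proof -
  define u where "u k = coord c (x [^] k \<otimes> (y [^] (p - k) \<otimes> \<one>))" for k
  obtain q where q: "p = Suc q" using prime_gt_0_nat[OF p] by (cases p) auto
  have "coord c ((x \<oplus> y) [^] p) = (\<Sum>k\<le>p. int (p choose k) * u k)"
    using functional_binomial[where F = "coord c", OF coord_add assms(2,3) one_closed, of p] assms(2,3)
    by (simp add: u_def)
  also have "\<dots> = u 0 + (\<Sum>k<q. int (p choose Suc k) * u (Suc k)) + u p"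
    unfolding q by (subst sum.atMost_Suc_shift) (simp add: lessThan_Suc_atMost[symmetric] del: binomial_Suc_Suc)
  also have "u 0 = coord c (y [^] p)" using assms by (simp add: u_def)
  also have "u p = coord c (x [^] p)" using assms by (simp add: u_def)
  finally have "coord c ((x \<oplus> y) [^] p) - (coord c (x [^] p) + coord c (y [^] p)) =
    (\<Sum>k<q. int (p choose Suc k) * u (Suc k))" by simp
  moreover have "int p dvd int (p choose Suc k)" if "k < q" for k
    by (intro of_nat_dvd_of_natI dvd_choose_prime) (use p q that in auto)
  ultimately show ?thesis by (auto intro!: dvd_sum dvd_mult2)
qed

lemma coord_frob_finsum:
  assumes p: "Factorial_Ring.prime p" and "finite S" "f \<in> S \<rightarrow> carrier A"
  shows "int p dvd coord c (finsum A f S [^] p) - (\<Sum>i\<in>S. coord c (f i [^] p))"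
  using assms(2,3)
proof (induction S)
  case empty
  then show ?case using prime_gt_0_nat[OF p] by (simp add: nat_pow_zero)
next
  case (insert i S)
  have "finsum A f (insert i S) = f i \<oplus> finsum A f S" using insert by (intro finsum_insert) auto
  moreover have "int p dvd coord c ((f i \<oplus> finsum A f S) [^] p) - (coord c (f i [^] p) + coord c (finsum A f S [^] p))"
    using insert.prems by (intro coord_frob_add p finsum_closed) auto
  then have "int p dvd (coord c ((f i \<oplus> finsum A f S) [^] p) - (coord c (f i [^] p) + coord c (finsum A f S [^] p)))
      + (coord c (finsum A f S [^] p) - (\<Sum>i\<in>S. coord c (f i [^] p)))"
    using insert by (intro dvd_add) auto
  ultimately show ?case using insert.hyps by (simp add: algebra_simps)
qed

text \<open>Modulo p, the p-th power of x is the sum of the p-th powers of its components, which lie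
  in distinct degrees. Degree 0 is covered by \<open>G_0_pow_dvd\<close>.\<close>

lemma reduced_if_homogeneous:
  assumes hom: "\<And>p n x c. Factorial_Ring.prime p \<Longrightarrow> 0 < n \<Longrightarrow> x \<in> G n \<Longrightarrow>
      (\<And>c. int p dvd coord c (x [^] p)) \<Longrightarrow> int p dvd coord c x"
    and p: "Factorial_Ring.prime p" and x: "x \<in> carrier A" and z: "zero_mod A p (x [^] p)"
  shows "zero_mod A p x"
proof -
  let ?S = "{n. homog x n \<noteq> \<zero>}"
  have cl: "homog x \<in> ?S \<rightarrow> carrier A" using homog(1)[OF x] G_sub by auto
  have p0: "p > 0" using prime_gt_0_nat[OF p] .
  have pow: "homog x n [^] p \<in> G (p * n)" for n by (rule G_pow[OF homog(1)[OF x]])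
  have dvd: "int p dvd coord c (homog x n [^] p)" for c n
  proof (cases "fst c = p * n")
    case True
    have "(\<Sum>k\<in>?S. coord c (homog x k [^] p)) = (\<Sum>k\<in>?S. if k = n then coord c (homog x n [^] p) else 0)"
      using coord_other[OF pow] True p0 by (intro sum.cong) auto
    also have "\<dots> = coord c (homog x n [^] p)"
      using homog(2)[OF x] p0 by (auto simp: nat_pow_zero)
    finally have s: "(\<Sum>k\<in>?S. coord c (homog x k [^] p)) = coord c (homog x n [^] p)" .
    have "x [^] p \<in> carrier A" using x by simp
    then have "int p dvd coord c (x [^] p)" using z zero_mod_iff by blast
    moreover
    have "int p dvd coord c (x [^] p) - coord c (homog x n [^] p)"
      using coord_frob_finsum[OF p homog(2)[OF x] cl, of c]
      unfolding homog(3)[OF x, symmetric] s .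
    from dvd_diff[OF calculation this] show ?thesis by simp
  next
    case False
    then show ?thesis using coord_other[OF pow, of n c] by simp
  qed
  have "int p dvd coord c x" for c
  proof -
    have "int p dvd coord c (homog x (fst c))"
    proof (cases "fst c = 0")
      case True then show ?thesis using G_0_pow_dvd[OF p _ dvd] homog(1)[OF x, of 0] by simp
    next
      case False then show ?thesis using hom[OF p _ homog(1)[OF x] dvd] by simp
    qed
    then show ?thesis using coord_homog[OF x, of c] by simp
  qed
  then show ?thesis using zero_mod_iff[OF x] by blast
qed

lemma pow_add_pow_int:
  assumes x: "x \<in> carrier A"
  shows "coord c ((add_pow A (k::int) x) [^] (n::nat)) = k ^ n * coord c (x [^] n)"
proof -
  interpret cring A by (rule cring_A)
  have "coord c ((add_pow A k x) [^] n \<otimes> z) = k ^ n * coord c (x [^] n \<otimes> z)" if "z \<in> carrier A" for z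
    using that
  proof (induction n arbitrary: z)
    case (Suc n)
    have "(add_pow A k x) [^] Suc n \<otimes> z = add_pow A k x \<otimes> ((add_pow A k x) [^] n \<otimes> z)"
      using x Suc.prems by (simp add: m_ac)
    also have "\<dots> = add_pow A k (x \<otimes> ((add_pow A k x) [^] n \<otimes> z))"
      using x Suc.prems by (simp add: add_pow_ldistr_int)
    also have "x \<otimes> ((add_pow A k x) [^] n \<otimes> z) = (add_pow A k x) [^] n \<otimes> (x \<otimes> z)"
      using x Suc.prems by (simp add: m_ac)
    finally have "coord c ((add_pow A k x) [^] Suc n \<otimes> z) = k * coord c ((add_pow A k x) [^] n \<otimes> (x \<otimes> z))"
      using x Suc.prems by (simp add: coord_pow_int)
    then show ?case using Suc.IH[of "x \<otimes> z"] x Suc.prems by (simp add: m_assoc mult_ac)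
  qed simp
  from this[of \<one>] show ?thesis using x by simp
qed

text \<open>Modulo p, Frobenius from \<open>G n\<close> to \<open>G (p * n)\<close> is linear by
  Fermat's theorem and injective by \<open>red\<close>, so it has a left inverse; \<gamma> is its
  row for coordinate i.\<close>

lemma frob_left_inverse:
  assumes red: "\<And>x. x \<in> carrier A \<Longrightarrow> zero_mod A p (x [^] p) \<Longrightarrow> zero_mod A p x"
    and p: "Factorial_Ring.prime p" and i: "i < rk n"
  shows "\<exists>\<gamma>. \<forall>a\<in>G n. int p dvd (\<Sum>j<rk (p * n). \<gamma> j * coord (p * n, j) (a [^] p)) - coord (n, i) a"
proof -
  let ?v = "\<lambda>i j. coord (p * n, j) (bas (n, i) [^] p)"
  have expand: "int p dvd coord c (a [^] p) - (\<Sum>i<rk n. coord (n, i) a * coord c (bas (n, i) [^] p))"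
    if a: "a \<in> G n" for a c
  proof -
    \<comment> \<open>The element a rebuilt from its coordinates, which turns additivity of
      Frobenius into a formula in these coordinates.\<close>
    define b where "b = (\<Oplus>i\<in>{..<rk n}. add_pow A (coord (n, i) a) (bas (n, i)))"
    have "coord c' b = coord c' a" for c'
    proof -
      have "coord c' b = (\<Sum>i<rk n. coord (n, i) a * coord c' (bas (n, i)))"
        unfolding b_def by (subst coord_finsum) (auto simp: coord_pow_int)
      also have "\<dots> = coord c' a" by (rule functional_expand[symmetric]) (auto simp: coord_add a)
      finally show ?thesis .
    qed
    moreover have bc: "b \<in> carrier A" "a \<in> carrier A" unfolding b_def using a G_sub by (auto intro: finsum_closed)
    ultimately have "b \<ominus> a = \<zero>"
      by (intro eq_zero_if_coord) (auto simp: a_minus_def coord_add coord_uminus)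
    then have ba: "a = b" using bc by simp
    have "int p dvd coord c (b [^] p) - (\<Sum>i<rk n. coord c ((add_pow A (coord (n, i) a) (bas (n, i))) [^] p))"
      unfolding b_def by (rule coord_frob_finsum[OF p]) auto
    moreover have "int p dvd (\<Sum>i<rk n. coord c ((add_pow A (coord (n, i) a) (bas (n, i))) [^] p))
       - (\<Sum>i<rk n. coord (n, i) a * coord c (bas (n, i) [^] p))"
      unfolding sum_subtractf[symmetric] pow_add_pow_int[OF bas_carrier] left_diff_distrib[symmetric]
      by (intro dvd_sum dvd_mult2 prime_dvd_power_diff_self p)
    ultimately have "int p dvd (coord c (b [^] p) - (\<Sum>i<rk n. coord c ((add_pow A (coord (n, i) a) (bas (n, i))) [^] p)))
      + ((\<Sum>i<rk n. coord c ((add_pow A (coord (n, i) a) (bas (n, i))) [^] p))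
       - (\<Sum>i<rk n. coord (n, i) a * coord c (bas (n, i) [^] p)))" by (rule dvd_add)
    then show ?thesis unfolding ba[symmetric] by simp
  qed
  have "\<exists>g. \<forall>i\<in>{..<rk n}. \<forall>k\<in>{..<rk n}. int p dvd (\<Sum>j<rk (p * n). g i j * ?v k j) - (if i = k then 1 else 0)"
  proof (rule left_inverse_mod_prime[OF p])
    fix \<alpha> k
    assume dvd: "\<And>j. j \<in> {..<rk (p * n)} \<Longrightarrow> int p dvd (\<Sum>i<rk n. \<alpha> i * ?v i j)" and k: "k \<in> {..<rk n}"
    \<comment> \<open>A linear relation between the p-th powers of basis elements is the same as an
      element whose p-th power is 0 modulo p.\<close>
    define a where "a = (\<Oplus>i\<in>{..<rk n}. add_pow A (\<alpha> i) (bas (n, i)))"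
    have ac: "a \<in> carrier A" unfolding a_def by (auto intro: finsum_closed)
    have "int p dvd coord c (a [^] p)" for c
    proof -
      have "int p dvd coord c (a [^] p) - (\<Sum>i<rk n. coord c ((add_pow A (\<alpha> i) (bas (n, i))) [^] p))"
        unfolding a_def by (rule coord_frob_finsum[OF p]) auto
      moreover have "int p dvd (\<Sum>i<rk n. coord c ((add_pow A (\<alpha> i) (bas (n, i))) [^] p))
          - (\<Sum>i<rk n. \<alpha> i * coord c (bas (n, i) [^] p))"
        unfolding sum_subtractf[symmetric] pow_add_pow_int[OF bas_carrier] left_diff_distrib[symmetric]
        by (intro dvd_sum dvd_mult2 prime_dvd_power_diff_self p)
      moreover have "int p dvd (\<Sum>i<rk n. \<alpha> i * coord c (bas (n, i) [^] p))"
      proof (cases "fst c = p * n \<and> snd c < rk (p * n)")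
        case True
        then show ?thesis using dvd[of "snd c"] by (cases c) auto
      next
        case False
        have "coord c (bas (n, i) [^] p) = 0" for i
        proof (cases "fst c = p * n")
          case True
          then show ?thesis using False by (intro coord_big) auto
        next
          case False
          then show ?thesis using coord_other[OF G_pow[OF bas_G[of "(n, i)"]], of p c] by simp
        qed
        then show ?thesis by simp
      qed
      ultimately have "int p dvd (coord c (a [^] p) - (\<Sum>i<rk n. coord c ((add_pow A (\<alpha> i) (bas (n, i))) [^] p)))
        + ((\<Sum>i<rk n. coord c ((add_pow A (\<alpha> i) (bas (n, i))) [^] p)) - (\<Sum>i<rk n. \<alpha> i * coord c (bas (n, i) [^] p)))
        + (\<Sum>i<rk n. \<alpha> i * coord c (bas (n, i) [^] p))" by (intro dvd_add)
      then show ?thesis by simp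
    qed
    then have "zero_mod A p a" using red[OF ac] zero_mod_iff[of "a [^] p" p] ac by simp
    then have "int p dvd coord (n, k) a" using zero_mod_iff[OF ac] by blast
    also have "coord (n, k) a = (\<Sum>i<rk n. if i = k then \<alpha> k else 0)"
    proof -
      have "coord (n, k) a = (\<Sum>i<rk n. \<alpha> i * coord (n, k) (bas (n, i)))"
        unfolding a_def by (subst coord_finsum) (auto simp: coord_pow_int)
      also have "\<dots> = (\<Sum>i<rk n. if i = k then \<alpha> k else 0)"
        by (rule sum.cong) (auto simp: coord_bas)
      finally show ?thesis .
    qed
    finally show "int p dvd \<alpha> k" using k by simp
  qed auto
  then obtain g where g: "\<And>i k. i < rk n \<Longrightarrow> k < rk n \<Longrightarrow>
      int p dvd (\<Sum>j<rk (p * n). g i j * ?v k j) - (if i = k then 1 else 0)"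
    by auto
  have "int p dvd (\<Sum>j<rk (p * n). g i j * coord (p * n, j) (a [^] p)) - coord (n, i) a" if a: "a \<in> G n" for a
  proof -
    have 1: "int p dvd (\<Sum>j<rk (p * n). g i j * (coord (p * n, j) (a [^] p) - (\<Sum>k<rk n. coord (n, k) a * ?v k j)))"
      by (intro dvd_sum dvd_mult expand a)
    have 2: "int p dvd (\<Sum>k<rk n. coord (n, k) a * ((\<Sum>j<rk (p * n). g i j * ?v k j) - (if i = k then 1 else 0)))"
      by (intro dvd_sum dvd_mult g i) auto
    have swap: "(\<Sum>j<rk (p * n). g i j * (\<Sum>k<rk n. coord (n, k) a * ?v k j)) =
        (\<Sum>k<rk n. coord (n, k) a * (\<Sum>j<rk (p * n). g i j * ?v k j))"
      unfolding sum_distrib_left by (subst sum.swap) (simp add: mult_ac)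
    have delta: "(\<Sum>k<rk n. coord (n, k) a * (if i = k then 1 else 0)) = coord (n, i) a"
      using i by (simp add: if_distrib[of "\<lambda>x. _ * x"] cong: if_cong)
    have e1: "(\<Sum>j<rk (p * n). g i j * (coord (p * n, j) (a [^] p) - (\<Sum>k<rk n. coord (n, k) a * ?v k j))) =
        (\<Sum>j<rk (p * n). g i j * coord (p * n, j) (a [^] p)) - (\<Sum>k<rk n. coord (n, k) a * (\<Sum>j<rk (p * n). g i j * ?v k j))"
      unfolding swap[symmetric] by (simp only: right_diff_distrib sum_subtractf)
    have e2: "(\<Sum>k<rk n. coord (n, k) a * ((\<Sum>j<rk (p * n). g i j * ?v k j) - (if i = k then 1 else 0))) =
        (\<Sum>k<rk n. coord (n, k) a * (\<Sum>j<rk (p * n). g i j * ?v k j)) - coord (n, i) a"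
      by (simp only: right_diff_distrib sum_subtractf delta)
    from dvd_add[OF 1 2] show ?thesis unfolding e1 e2 by simp
  qed
  then show ?thesis by blast
qed

end

section \<open>The quasi-shuffle product as a sum over pairs of injections\<close>

definition incs :: "nat \<Rightarrow> nat \<Rightarrow> (nat \<Rightarrow> nat) set" where
  "incs l n = {\<alpha> \<in> {..<l} \<rightarrow>\<^sub>E {..<n}. strict_mono_on {..<l} \<alpha>}"

text \<open>\<open>inc_cons\<close> and \<open>inc_lift\<close> yield the increasing maps that hit 0
  and those that avoid it. Both are restricted to their domain, since quasi-shuffles are pairs of
  extensional functions.\<close>

definition inc_cons :: "nat \<Rightarrow> (nat \<Rightarrow> nat) \<Rightarrow> nat \<Rightarrow> nat" where
  "inc_cons l \<alpha> = (\<lambda>j\<in>{..<Suc l}. case j of 0 \<Rightarrow> 0 | Suc j \<Rightarrow> Suc (\<alpha> j))"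

definition inc_lift :: "nat \<Rightarrow> (nat \<Rightarrow> nat) \<Rightarrow> nat \<Rightarrow> nat" where
  "inc_lift l \<alpha> = (\<lambda>j\<in>{..<l}. Suc (\<alpha> j))"

lemma inc_cons_image: "inc_cons l \<alpha> ` {..<Suc l} = insert 0 (Suc ` \<alpha> ` {..<l})"
  by (force simp: inc_cons_def lessThan_Suc_eq_insert_0 image_iff)

lemma inc_lift_image: "inc_lift l \<alpha> ` {..<l} = Suc ` \<alpha> ` {..<l}"
  by (force simp: inc_lift_def)

lemma inc_cons_in: "\<alpha> \<in> incs l n \<Longrightarrow> inc_cons l \<alpha> \<in> incs (Suc l) (Suc n)"
  by (auto simp: incs_def inc_cons_def strict_mono_on_def PiE_iff split: nat.splits)

lemma inc_lift_in: "\<alpha> \<in> incs l n \<Longrightarrow> inc_lift l \<alpha> \<in> incs l (Suc n)"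
  by (auto simp: incs_def inc_lift_def strict_mono_on_def PiE_iff)

lemma incs_mono: "\<alpha> \<in> incs l n \<Longrightarrow> i < j \<Longrightarrow> j < l \<Longrightarrow> \<alpha> i < \<alpha> j"
  unfolding incs_def strict_mono_on_def by fastforce

lemma inc_cons_surj:
  assumes "\<alpha> \<in> incs (Suc l) (Suc n)" "\<alpha> 0 = 0"
  shows "\<exists>\<alpha>'\<in>incs l n. \<alpha> = inc_cons l \<alpha>'"
proof (rule bexI)
  let ?\<alpha> = "\<lambda>j\<in>{..<l}. \<alpha> (Suc j) - 1"
  have pos: "0 < \<alpha> (Suc j)" if "j < l" for j
  proof -
    have "\<alpha> 0 < \<alpha> (Suc j)" by (rule incs_mono[OF assms(1)]) (use that in auto)
    then show ?thesis by simp
  qed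
  have lt: "\<alpha> (Suc j) < Suc n" if "j < l" for j using assms that by (auto simp: incs_def)
  have mono: "\<alpha> (Suc i) < \<alpha> (Suc j)" if "i < j" "j < l" for i j
    by (rule incs_mono[OF assms(1)]) (use that in auto)
  show "?\<alpha> \<in> incs l n"
    unfolding incs_def
  proof (intro CollectI conjI)
    show "?\<alpha> \<in> {..<l} \<rightarrow>\<^sub>E {..<n}"
    proof (rule PiE_I)
      fix j assume "j \<in> {..<l}"
      then show "?\<alpha> j \<in> {..<n}" using lt[of j] pos[of j] by auto
    qed auto
    show "strict_mono_on {..<l} ?\<alpha>"
    proof (rule strict_mono_onI)
      fix i j assume "i \<in> {..<l}" "j \<in> {..<l}" "i < j"
      then show "?\<alpha> i < ?\<alpha> j" using mono[of i j] pos[of i] by (auto intro: diff_less_mono)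
    qed
  qed
  show "\<alpha> = inc_cons l ?\<alpha>"
  proof
    fix j
    show "\<alpha> j = inc_cons l ?\<alpha> j"
      using assms pos by (cases j) (auto simp: inc_cons_def incs_def PiE_iff extensional_def)
  qed
qed

lemma inc_lift_surj:
  assumes "\<alpha> \<in> incs l (Suc n)" "0 \<notin> \<alpha> ` {..<l}"
  shows "\<exists>\<alpha>'\<in>incs l n. \<alpha> = inc_lift l \<alpha>'"
proof (rule bexI)
  let ?\<alpha> = "\<lambda>j\<in>{..<l}. \<alpha> j - 1"
  have pos: "0 < \<alpha> j" if "j < l" for j using assms(2) that by (metis image_eqI lessThan_iff gr0I)
  have lt: "\<alpha> j < Suc n" if "j < l" for j using assms that by (auto simp: incs_def)
  have mono: "\<alpha> i < \<alpha> j" if "i < j" "j < l" for i j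
    by (rule incs_mono[OF assms(1)]) (use that in auto)
  show "?\<alpha> \<in> incs l n"
    unfolding incs_def
  proof (intro CollectI conjI)
    show "?\<alpha> \<in> {..<l} \<rightarrow>\<^sub>E {..<n}"
    proof (rule PiE_I)
      fix j assume "j \<in> {..<l}"
      then show "?\<alpha> j \<in> {..<n}" using lt[of j] pos[of j] by auto
    qed auto
    show "strict_mono_on {..<l} ?\<alpha>"
    proof (rule strict_mono_onI)
      fix i j assume "i \<in> {..<l}" "j \<in> {..<l}" "i < j"
      then show "?\<alpha> i < ?\<alpha> j" using mono[of i j] pos[of i] by (auto intro: diff_less_mono)
    qed
  qed
  show "\<alpha> = inc_lift l ?\<alpha>"
  proof
    fix j
    show "\<alpha> j = inc_lift l ?\<alpha> j"
      using assms pos by (auto simp: inc_lift_def incs_def PiE_iff extensional_def)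
  qed
qed

lemma inc_cons_inj:
  assumes "\<alpha> \<in> incs l n" "\<beta> \<in> incs l n" "inc_cons l \<alpha> = inc_cons l \<beta>"
  shows "\<alpha> = \<beta>"
proof
  fix j
  have "inc_cons l \<alpha> (Suc j) = inc_cons l \<beta> (Suc j)" by (simp add: assms(3))
  then show "\<alpha> j = \<beta> j"
    using assms(1,2) by (cases "j < l") (auto simp: inc_cons_def incs_def PiE_iff extensional_def)
qed

lemma inc_lift_inj:
  assumes "\<alpha> \<in> incs l n" "\<beta> \<in> incs l n" "inc_lift l \<alpha> = inc_lift l \<beta>"
  shows "\<alpha> = \<beta>"
proof
  fix j
  have "inc_lift l \<alpha> j = inc_lift l \<beta> j" by (simp add: assms(3))
  then show "\<alpha> j = \<beta> j"
    using assms(1,2) by (cases "j < l") (auto simp: inc_lift_def incs_def PiE_iff extensional_def)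
qed

lemma incs_zero: "\<alpha> \<in> incs l n \<Longrightarrow> 0 \<in> \<alpha> ` {..<l} \<Longrightarrow> \<exists>l'. l = Suc l' \<and> \<alpha> 0 = 0"
proof -
  assume a: "\<alpha> \<in> incs l n" and "0 \<in> \<alpha> ` {..<l}"
  then obtain j where j: "j < l" "\<alpha> j = 0" by auto
  have "j = 0"
  proof (rule ccontr)
    assume "j \<noteq> 0"
    then have "\<alpha> 0 < \<alpha> j" by (intro incs_mono[OF a]) (use j in auto)
    then show False using j by simp
  qed
  then show ?thesis using j by (cases l) auto
qed

lemma quasi_shuffles_iff:
  "(\<alpha>, \<beta>) \<in> quasi_shuffles l m n \<longleftrightarrow>
    \<alpha> \<in> incs l n \<and> \<beta> \<in> incs m n \<and> \<alpha> ` {..<l} \<union> \<beta> ` {..<m} = {..<n}"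
  by (auto simp: quasi_shuffles_def incs_def)

lemma finite_quasi_shuffles: "finite (quasi_shuffles l m n)"
proof (rule finite_subset)
  show "quasi_shuffles l m n \<subseteq> ({..<l} \<rightarrow>\<^sub>E {..<n}) \<times> ({..<m} \<rightarrow>\<^sub>E {..<n})"
    by (auto simp: quasi_shuffles_def)
qed (intro finite_cartesian_product finite_PiE; simp)

lemma quasi_shuffles_0:
  "quasi_shuffles l m 0 = (if l = 0 \<and> m = 0 then {(\<lambda>_. undefined, \<lambda>_. undefined)} else {})"
  by (auto simp: quasi_shuffles_def strict_mono_on_def)

definition qs_both :: "nat \<Rightarrow> nat \<Rightarrow> nat \<Rightarrow> ((nat \<Rightarrow> nat) \<times> (nat \<Rightarrow> nat)) set" where
  "qs_both l m n = (if l = 0 \<or> m = 0 then {} else map_prod (inc_cons (l - 1)) (inc_cons (m - 1)) ` quasi_shuffles (l - 1) (m - 1) n)"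
definition qs_left :: "nat \<Rightarrow> nat \<Rightarrow> nat \<Rightarrow> ((nat \<Rightarrow> nat) \<times> (nat \<Rightarrow> nat)) set" where
  "qs_left l m n = (if l = 0 then {} else map_prod (inc_cons (l - 1)) (inc_lift m) ` quasi_shuffles (l - 1) m n)"
definition qs_right :: "nat \<Rightarrow> nat \<Rightarrow> nat \<Rightarrow> ((nat \<Rightarrow> nat) \<times> (nat \<Rightarrow> nat)) set" where
  "qs_right l m n = (if m = 0 then {} else map_prod (inc_lift l) (inc_cons (m - 1)) ` quasi_shuffles l (m - 1) n)"

lemma lessThan_Suc_image: "{..<Suc n} = insert 0 (Suc ` {..<n})"
  by (rule lessThan_Suc_eq_insert_0)

lemma insert0_Suc_eq_iff: "insert 0 (Suc ` B) = insert 0 (Suc ` B') \<longleftrightarrow> B = B'"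
  by (auto simp: set_eq_iff image_iff)

text \<open>Position 0 is hit by the first word only, by the second only, or by both: the three
  terms in the recursion of \<open>qs_words\<close>.\<close>

lemma quasi_shuffles_Suc:
  "quasi_shuffles l m (Suc n) = qs_left l m n \<union> (qs_right l m n \<union> qs_both l m n)" (is "?L = ?R")
proof
  show "?L \<subseteq> ?R"
  proof
    fix x assume "x \<in> ?L"
    then obtain \<alpha> \<beta> where x: "x = (\<alpha>, \<beta>)" and a: "\<alpha> \<in> incs l (Suc n)" and b: "\<beta> \<in> incs m (Suc n)"
      and cov: "\<alpha> ` {..<l} \<union> \<beta> ` {..<m} = {..<Suc n}"
      by (cases x) (auto simp: quasi_shuffles_iff)
    have "0 \<in> \<alpha> ` {..<l} \<or> 0 \<in> \<beta> ` {..<m}" using cov by blast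
    then consider "0 \<in> \<alpha> ` {..<l}" "0 \<in> \<beta> ` {..<m}" | "0 \<in> \<alpha> ` {..<l}" "0 \<notin> \<beta> ` {..<m}"
      | "0 \<notin> \<alpha> ` {..<l}" "0 \<in> \<beta> ` {..<m}" by blast
    then show "x \<in> ?R"
    proof cases
      case 1
      obtain l' where l: "l = Suc l'" "\<alpha> 0 = 0" using incs_zero[OF a 1(1)] by blast
      obtain m' where m: "m = Suc m'" "\<beta> 0 = 0" using incs_zero[OF b 1(2)] by blast
      obtain \<alpha>' where a': "\<alpha>' \<in> incs l' n" "\<alpha> = inc_cons l' \<alpha>'" using inc_cons_surj a l by blast
      obtain \<beta>' where b': "\<beta>' \<in> incs m' n" "\<beta> = inc_cons m' \<beta>'" using inc_cons_surj b m by blast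
      have "insert 0 (Suc ` (\<alpha>' ` {..<l'} \<union> \<beta>' ` {..<m'})) = insert 0 (Suc ` {..<n})"
        using cov unfolding l m a' b' inc_cons_image lessThan_Suc_image[of n] by (simp add: image_Un)
      then have "(\<alpha>', \<beta>') \<in> quasi_shuffles l' m' n" using a' b' by (simp add: quasi_shuffles_iff insert0_Suc_eq_iff)
      then have "x \<in> qs_both l m n"
        unfolding qs_both_def using a' b' l m x by (auto intro!: image_eqI[of _ _ "(\<alpha>', \<beta>')"])
      then show ?thesis by blast
    next
      case 2
      obtain l' where l: "l = Suc l'" "\<alpha> 0 = 0" using incs_zero[OF a 2(1)] by blast
      obtain \<alpha>' where a': "\<alpha>' \<in> incs l' n" "\<alpha> = inc_cons l' \<alpha>'" using inc_cons_surj a l by blast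
      obtain \<beta>' where b': "\<beta>' \<in> incs m n" "\<beta> = inc_lift m \<beta>'" using inc_lift_surj[OF b 2(2)] by blast
      have "insert 0 (Suc ` (\<alpha>' ` {..<l'} \<union> \<beta>' ` {..<m})) = insert 0 (Suc ` {..<n})"
        using cov unfolding l a' b' inc_cons_image inc_lift_image lessThan_Suc_image[of n] by (simp add: image_Un)
      then have "(\<alpha>', \<beta>') \<in> quasi_shuffles l' m n" using a' b' by (simp add: quasi_shuffles_iff insert0_Suc_eq_iff)
      then have "x \<in> qs_left l m n"
        unfolding qs_left_def using a' b' l x by (auto intro!: image_eqI[of _ _ "(\<alpha>', \<beta>')"])
      then show ?thesis by blast
    next
      case 3
      obtain m' where m: "m = Suc m'" "\<beta> 0 = 0" using incs_zero[OF b 3(2)] by blast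
      obtain \<alpha>' where a': "\<alpha>' \<in> incs l n" "\<alpha> = inc_lift l \<alpha>'" using inc_lift_surj[OF a 3(1)] by blast
      obtain \<beta>' where b': "\<beta>' \<in> incs m' n" "\<beta> = inc_cons m' \<beta>'" using inc_cons_surj b m by blast
      have "insert 0 (Suc ` (\<alpha>' ` {..<l} \<union> \<beta>' ` {..<m'})) = insert 0 (Suc ` {..<n})"
        using cov unfolding m a' b' inc_cons_image inc_lift_image lessThan_Suc_image[of n] by (simp add: image_Un)
      then have "(\<alpha>', \<beta>') \<in> quasi_shuffles l m' n" using a' b' by (simp add: quasi_shuffles_iff insert0_Suc_eq_iff)
      then have "x \<in> qs_right l m n"
        unfolding qs_right_def using a' b' m x by (auto intro!: image_eqI[of _ _ "(\<alpha>', \<beta>')"])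
      then show ?thesis by blast
    qed
  qed
  have cov: "insert 0 (Suc ` S) \<union> Suc ` T = {..<Suc n}" if "S \<union> T = {..<n}" for S T
    unfolding lessThan_Suc_image that[symmetric] by blast
  have "qs_left l m n \<subseteq> ?L"
  proof (cases l)
    case (Suc l')
    have "map_prod (inc_cons l') (inc_lift m) z \<in> ?L" if "z \<in> quasi_shuffles l' m n" for z
      using that cov unfolding Suc
      by (cases z) (simp add: quasi_shuffles_iff inc_cons_in inc_lift_in inc_cons_image inc_lift_image
        del: lessThan_Suc Un_insert_left)
    then show ?thesis by (auto simp: qs_left_def Suc)
  qed (simp add: qs_left_def)
  moreover have "qs_right l m n \<subseteq> ?L"
  proof (cases m)
    case (Suc m')
    have cov': "Suc ` T \<union> insert 0 (Suc ` S) = {..<Suc n}" if "T \<union> S = {..<n}" for S T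
      unfolding lessThan_Suc_image that[symmetric] by blast
    have "map_prod (inc_lift l) (inc_cons m') z \<in> ?L" if "z \<in> quasi_shuffles l m' n" for z
      using that cov' unfolding Suc
      by (cases z) (simp add: quasi_shuffles_iff inc_cons_in inc_lift_in inc_cons_image inc_lift_image
        del: lessThan_Suc Un_insert_right)
    then show ?thesis by (auto simp: qs_right_def Suc)
  qed (simp add: qs_right_def)
  moreover have "qs_both l m n \<subseteq> ?L"
  proof (cases "l = 0 \<or> m = 0")
    case False
    then obtain l' m' where lm: "l = Suc l'" "m = Suc m'" by (metis not0_implies_Suc)
    have cov': "insert 0 (Suc ` T) \<union> insert 0 (Suc ` S) = {..<Suc n}" if "T \<union> S = {..<n}" for S T
      unfolding lessThan_Suc_image that[symmetric] by blast
    have "map_prod (inc_cons l') (inc_cons m') z \<in> ?L" if "z \<in> quasi_shuffles l' m' n" for z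
      using that cov' unfolding lm
      by (cases z) (simp add: quasi_shuffles_iff inc_cons_in inc_lift_in inc_cons_image inc_lift_image
        del: lessThan_Suc Un_insert_right Un_insert_left)
    then show ?thesis by (auto simp: qs_both_def lm)
  qed (simp add: qs_both_def)
  ultimately show "?R \<subseteq> ?L" by blast
qed

lemma inc_lift_0: "j < m \<Longrightarrow> inc_lift m \<beta> j \<noteq> 0"
  by (simp add: inc_lift_def)

lemma inc_cons_0: "0 \<in> inc_cons m \<beta> ` {..<Suc m}"
  by (simp add: inc_cons_image del: lessThan_Suc)

lemma sum_quasi_shuffles_Suc:
  fixes F :: "(nat \<Rightarrow> nat) \<times> (nat \<Rightarrow> nat) \<Rightarrow> 'r::comm_monoid_add"
  shows "sum F (quasi_shuffles l m (Suc n)) =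
    (if l = 0 then 0 else \<Sum>(\<alpha>, \<beta>)\<in>quasi_shuffles (l - 1) m n. F (inc_cons (l - 1) \<alpha>, inc_lift m \<beta>)) +
    ((if m = 0 then 0 else \<Sum>(\<alpha>, \<beta>)\<in>quasi_shuffles l (m - 1) n. F (inc_lift l \<alpha>, inc_cons (m - 1) \<beta>)) +
     (if l = 0 \<or> m = 0 then 0 else
       \<Sum>(\<alpha>, \<beta>)\<in>quasi_shuffles (l - 1) (m - 1) n. F (inc_cons (l - 1) \<alpha>, inc_cons (m - 1) \<beta>)))"
proof -
  have fin: "finite (qs_left l m n)" "finite (qs_right l m n)" "finite (qs_both l m n)"
    by (simp_all add: qs_left_def qs_right_def qs_both_def finite_quasi_shuffles)
  have left: "0 \<in> fst x ` {..<l} \<and> 0 \<notin> snd x ` {..<m}" if "x \<in> qs_left l m n" for x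
    using that inc_cons_0 by (cases l) (auto simp: qs_left_def inc_lift_0 simp del: lessThan_Suc)
  have right: "0 \<notin> fst x ` {..<l} \<and> 0 \<in> snd x ` {..<m}" if "x \<in> qs_right l m n" for x
    using that inc_cons_0 by (cases m) (auto simp: qs_right_def inc_lift_0 simp del: lessThan_Suc)
  have both: "0 \<in> fst x ` {..<l} \<and> 0 \<in> snd x ` {..<m}" if "x \<in> qs_both l m n" for x
    using that inc_cons_0 by (cases l; cases m) (auto simp: qs_both_def simp del: lessThan_Suc)
  have disj: "qs_left l m n \<inter> (qs_right l m n \<union> qs_both l m n) = {}" "qs_right l m n \<inter> qs_both l m n = {}"
    using left right both by blast+
  have inj: "inj_on (map_prod (inc_cons l') (inc_lift m)) (quasi_shuffles l' m n)"
    "inj_on (map_prod (inc_lift l) (inc_cons m')) (quasi_shuffles l m' n)"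
    "inj_on (map_prod (inc_cons l') (inc_cons m')) (quasi_shuffles l' m' n)" for l' m'
    by (auto simp: inj_on_def quasi_shuffles_iff dest: inc_cons_inj inc_lift_inj)
  have "sum F (qs_left l m n) = (if l = 0 then 0 else \<Sum>(\<alpha>, \<beta>)\<in>quasi_shuffles (l - 1) m n. F (inc_cons (l - 1) \<alpha>, inc_lift m \<beta>))"
    by (simp add: qs_left_def sum.reindex[OF inj(1)], simp add: case_prod_beta map_prod_def)
  moreover have "sum F (qs_right l m n) = (if m = 0 then 0 else \<Sum>(\<alpha>, \<beta>)\<in>quasi_shuffles l (m - 1) n. F (inc_lift l \<alpha>, inc_cons (m - 1) \<beta>))"
    by (simp add: qs_right_def sum.reindex[OF inj(2)], simp add: case_prod_beta map_prod_def)
  moreover have "sum F (qs_both l m n) = (if l = 0 \<or> m = 0 then 0 else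
       \<Sum>(\<alpha>, \<beta>)\<in>quasi_shuffles (l - 1) (m - 1) n. F (inc_cons (l - 1) \<alpha>, inc_cons (m - 1) \<beta>))"
    by (simp add: qs_both_def sum.reindex[OF inj(3)], simp add: case_prod_beta map_prod_def)
  moreover have "sum F (quasi_shuffles l m (Suc n)) = sum F (qs_left l m n) + (sum F (qs_right l m n) + sum F (qs_both l m n))"
    unfolding quasi_shuffles_Suc
    by (subst sum.union_disjoint[OF fin(1) finite_UnI[OF fin(2,3)] disj(1)], subst sum.union_disjoint[OF fin(2,3) disj(2)]) simp
  ultimately show ?thesis by simp
qed

definition fibre :: "'x list \<Rightarrow> (nat \<Rightarrow> nat) \<Rightarrow> nat \<Rightarrow> 'x list" where
  "fibre u \<alpha> i = map ((!) u) (filter (\<lambda>j. \<alpha> j = i) [0..<length u])"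

lemma upt_Suc_shift: "[0..<Suc l] = 0 # map Suc [0..<l]"
  by (simp add: map_Suc_upt upt_conv_Cons del: upt_Suc)

lemma fibre_cons:
  "fibre (a # u) (inc_cons (length u) \<alpha>) 0 = [a]"
  "fibre (a # u) (inc_cons (length u) \<alpha>) (Suc i) = fibre u \<alpha> i"
proof -
  have "filter (\<lambda>j. inc_cons (length u) \<alpha> (Suc j) = 0) [0..<length u] = []"
    by (auto simp: inc_cons_def filter_empty_conv)
  then show "fibre (a # u) (inc_cons (length u) \<alpha>) 0 = [a]"
    by (simp add: fibre_def upt_Suc_shift filter_map o_def inc_cons_def del: upt_Suc)
  have "filter (\<lambda>j. inc_cons (length u) \<alpha> (Suc j) = Suc i) [0..<length u] = filter (\<lambda>j. \<alpha> j = i) [0..<length u]"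
    by (rule filter_cong) (auto simp: inc_cons_def)
  moreover have "inc_cons (length u) \<alpha> 0 \<noteq> Suc i" by (simp add: inc_cons_def)
  ultimately show "fibre (a # u) (inc_cons (length u) \<alpha>) (Suc i) = fibre u \<alpha> i"
    by (simp add: fibre_def upt_Suc_shift filter_map o_def del: upt_Suc)
qed

lemma fibre_lift:
  "fibre u (inc_lift (length u) \<alpha>) 0 = []"
  "fibre u (inc_lift (length u) \<alpha>) (Suc i) = fibre u \<alpha> i"
proof -
  show "fibre u (inc_lift (length u) \<alpha>) 0 = []"
    by (auto simp: fibre_def inc_lift_def filter_empty_conv)
  have "filter (\<lambda>j. inc_lift (length u) \<alpha> j = Suc i) [0..<length u] = filter (\<lambda>j. \<alpha> j = i) [0..<length u]"
    by (rule filter_cong) (auto simp: inc_lift_def)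
  then show "fibre u (inc_lift (length u) \<alpha>) (Suc i) = fibre u \<alpha> i" by (simp add: fibre_def)
qed

lemma fibre_map: "fibre (map f u) \<alpha> i = map f (fibre u \<alpha> i)"
  by (auto simp: fibre_def)

lemma fibre_append_glue:
  "map ((!) (u @ v)) (filter (\<lambda>j. glue (length u) \<alpha> \<beta> j = i) [0..<length (u @ v)]) = fibre u \<alpha> i @ fibre v \<beta> i"
proof -
  have "[0..<length (u @ v)] = [0..<length u] @ map (\<lambda>j. length u + j) [0..<length v]"
    by (rule nth_equalityI) (auto simp: nth_append)
  moreover have "filter (\<lambda>j. glue (length u) \<alpha> \<beta> j = i) [0..<length u] = filter (\<lambda>j. \<alpha> j = i) [0..<length u]"
    by (rule filter_cong) (auto simp: glue_def)
  moreover have "filter (\<lambda>j. glue (length u) \<alpha> \<beta> (length u + j) = i) [0..<length v] = filter (\<lambda>j. \<beta> j = i) [0..<length v]"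
    by (rule filter_cong) (auto simp: glue_def)
  ultimately show ?thesis
    by (auto simp: fibre_def filter_map o_def nth_append)
qed

text \<open>The default is never reached for a quasi-shuffle: the two images cover all positions, so
  the joint fibres are nonempty.\<close>

fun nonempty_sum :: "'b list \<Rightarrow> 'b::ab_semigroup_add" where
  "nonempty_sum [] = undefined"
| "nonempty_sum [x] = x"
| "nonempty_sum (x # y # xs) = x + nonempty_sum (y # xs)"

definition qs_letters :: "'b list \<Rightarrow> 'b list \<Rightarrow> (nat \<Rightarrow> nat) \<Rightarrow> (nat \<Rightarrow> nat) \<Rightarrow> nat \<Rightarrow> 'b::ab_semigroup_add list" where
  "qs_letters u v \<alpha> \<beta> n = map (\<lambda>i. nonempty_sum (fibre u \<alpha> i @ fibre v \<beta> i)) [0..<n]"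

lemma qs_letters_Suc:
  "qs_letters (a # u) v (inc_cons (length u) \<alpha>) (inc_lift (length v) \<beta>) (Suc n) = a # qs_letters u v \<alpha> \<beta> n"
  "qs_letters u (b # v) (inc_lift (length u) \<alpha>) (inc_cons (length v) \<beta>) (Suc n) = b # qs_letters u v \<alpha> \<beta> n"
  "qs_letters (a # u) (b # v) (inc_cons (length u) \<alpha>) (inc_cons (length v) \<beta>) (Suc n) = (a + b) # qs_letters u v \<alpha> \<beta> n"
  by (simp_all add: qs_letters_def upt_Suc_shift fibre_cons fibre_lift o_def del: upt_Suc)

definition qs_sum :: "'b list \<Rightarrow> 'b list \<Rightarrow> nat \<Rightarrow> 'b::ab_semigroup_add qsh" where
  "qs_sum u v n = (\<Sum>(\<alpha>, \<beta>)\<in>quasi_shuffles (length u) (length v) n. word (qs_letters u v \<alpha> \<beta> n))"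

lemma pre_case_sum: "pre a (\<Sum>(\<alpha>, \<beta>)\<in>S. f \<alpha> \<beta>) = (\<Sum>(\<alpha>, \<beta>)\<in>S. pre a (f \<alpha> \<beta>))"
  by (simp add: pre_sum case_prod_beta)

lemma qs_sum_simps:
  "qs_sum u v 0 = (if u = [] \<and> v = [] then 1 else 0)"
  "qs_sum [] [] (Suc n) = 0"
  "qs_sum (a # u) [] (Suc n) = pre a (qs_sum u [] n)"
  "qs_sum [] (b # v) (Suc n) = pre b (qs_sum [] v n)"
  "qs_sum (a # u) (b # v) (Suc n) = pre a (qs_sum u (b # v) n) + pre b (qs_sum (a # u) v n) + pre (a + b) (qs_sum u v n)"
proof -
  show "qs_sum u v 0 = (if u = [] \<and> v = [] then 1 else 0)"
    by (auto simp: qs_sum_def quasi_shuffles_0 qs_letters_def word_Nil)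
  note s = qs_sum_def sum_quasi_shuffles_Suc pre_case_sum
  show "qs_sum [] [] (Suc n) = 0" by (simp add: s)
  show "qs_sum (a # u) [] (Suc n) = pre a (qs_sum u [] n)"
    using qs_letters_Suc(1)[of a u "[]"] by (simp add: s)
  show "qs_sum [] (b # v) (Suc n) = pre b (qs_sum [] v n)"
    using qs_letters_Suc(2)[of "[]" b v] by (simp add: s)
  show "qs_sum (a # u) (b # v) (Suc n) = pre a (qs_sum u (b # v) n) + pre b (qs_sum (a # u) v n) + pre (a + b) (qs_sum u v n)"
    using qs_letters_Suc(1)[of a u "b # v"] qs_letters_Suc(2)[of "a # u" b v] qs_letters_Suc(3)[of a u b v]
    by (simp add: s add.assoc)
qed

text \<open>N is any bound on the total length, so that one induction hypothesis serves all three
  shorter pairs of words.\<close>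

lemma sum_qs_sum:
  assumes "length u + length v \<le> N"
  shows "(\<Sum>n\<le>N. qs_sum u v n) = word u * word v"
  using assms
proof (induction N arbitrary: u v)
  case 0 then show ?case by (simp add: qs_sum_simps word_Nil)
next
  case (Suc N)
  have "(\<Sum>n\<le>Suc N. qs_sum u v n) = qs_sum u v 0 + (\<Sum>n\<le>N. qs_sum u v (Suc n))"
    by (rule sum.atMost_Suc_shift)
  also have "\<dots> = word u * word v"
  proof (cases u; cases v)
    fix a u' b v' assume uv: "u = a # u'" "v = b # v'"
    show ?thesis using Suc.IH[of u' v] Suc.IH[of u v'] Suc.IH[of u' v'] Suc.prems
      by (simp add: uv qs_sum_simps sum.distrib word_Cons_mult flip: pre_sum)
  next
    fix a u' assume uv: "u = a # u'" "v = []"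
    show ?thesis using Suc.IH[of u' v] Suc.prems
      by (simp add: uv qs_sum_simps word_Nil flip: pre_sum)
  next
    fix b v' assume uv: "u = []" "v = b # v'"
    show ?thesis using Suc.IH[of u v'] Suc.prems
      by (simp add: uv qs_sum_simps word_Nil flip: pre_sum)
  qed (simp add: qs_sum_simps word_Nil)
  finally show ?case .
qed

section \<open>Nonempty multisets\<close>

text \<open>The free commutative semigroup. Quasi-shuffle rings are a type only over a type of class
  \<open>ab_semigroup_add\<close>, which the positive degree part of \<open>A\<close> is not; so the letters are formal
  products, which \<open>ev\<close> below evaluates in \<open>A\<close>.\<close>

typedef 'x nemset = "{M :: 'x multiset. M \<noteq> {#}}"
  by (auto intro: exI[of _ "{#_#}"])

instantiation nemset :: (type) ab_semigroup_add
begin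
definition "a + b = Abs_nemset (Rep_nemset a + Rep_nemset b)"
lemma Rep_nemset_add: "Rep_nemset (a + b) = Rep_nemset a + Rep_nemset b"
  using Rep_nemset[of a] by (simp add: plus_nemset_def Abs_nemset_inverse)
instance
  by standard (simp_all add: Rep_nemset_add add_ac flip: Rep_nemset_inject)
end

definition single_nemset :: "'x \<Rightarrow> 'x nemset" where "single_nemset x = Abs_nemset {#x#}"

lemma Rep_single_nemset [simp]: "Rep_nemset (single_nemset x) = {#x#}"
  by (simp add: single_nemset_def Abs_nemset_inverse)

section \<open>Coefficient functionals\<close>

context even_graded_ring
begin

text \<open>Folding over multisets requires left-commutativity for all arguments, so ill-formed ones
  are sent to \<zero>; words with ill-formed letters thereby fall into \<open>null\<close>.\<close>

definition fmul :: "nat \<times> 'a \<Rightarrow> 'a \<Rightarrow> 'a" where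
  "fmul x y = (if 0 < fst x \<and> snd x \<in> G (fst x) \<and> y \<in> carrier A then snd x \<otimes> y else \<zero>)"

lemma fmul_commute: "fmul x (fmul y z) = fmul y (fmul x z)"
proof (cases "0 < fst x \<and> snd x \<in> G (fst x) \<and> 0 < fst y \<and> snd y \<in> G (fst y) \<and> z \<in> carrier A")
  case True
  then have c: "snd x \<in> carrier A" "snd y \<in> carrier A" "z \<in> carrier A" using G_sub by auto
  have "snd x \<otimes> (snd y \<otimes> z) = snd y \<otimes> (snd x \<otimes> z)"
    using m_assoc[OF c] m_assoc[OF c(2,1,3)] carrier_comm[OF c(1,2)] by simp
  then show ?thesis using True c by (simp add: fmul_def)
next
  case False
  then show ?thesis using G_sub by (auto simp: fmul_def)
qed

sublocale fmul: comp_fun_commute fmul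
  by standard (auto simp: fmul_commute)

definition evm :: "(nat \<times> 'a) multiset \<Rightarrow> 'a" where "evm M = fold_mset fmul \<one> M"

definition good :: "nat \<times> 'a \<Rightarrow> bool" where "good x \<longleftrightarrow> 0 < fst x \<and> snd x \<in> G (fst x)"

lemma evm_empty [simp]: "evm {#} = \<one>" by (simp add: evm_def)

lemma evm_add_mset: "evm (add_mset x M) = fmul x (evm M)" by (simp add: evm_def)

lemma evm_carrier [simp]: "evm M \<in> carrier A"
  by (induction M) (auto simp: evm_add_mset fmul_def G_sub)

lemma fmul_mult: "y \<in> carrier A \<Longrightarrow> z \<in> carrier A \<Longrightarrow> fmul x (y \<otimes> z) = fmul x y \<otimes> z"
  by (auto simp: fmul_def G_sub m_assoc)

lemma evm_add: "evm (M + M') = evm M \<otimes> evm M'"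
  by (induction M) (simp_all add: evm_add_mset fmul_mult)

lemma evm_single: "evm {#x#} = (if good x then snd x else \<zero>)"
  by (auto simp: evm_add_mset fmul_def good_def G_sub)

definition ev :: "(nat \<times> 'a) nemset \<Rightarrow> 'a" where "ev m = evm (Rep_nemset m)"
definition dg :: "(nat \<times> 'a) nemset \<Rightarrow> nat" where "dg m = sum_mset (image_mset fst (Rep_nemset m))"

lemma ev_carrier [simp]: "ev m \<in> carrier A" by (simp add: ev_def)
lemma ev_add: "ev (a + b) = ev a \<otimes> ev b" by (simp add: ev_def Rep_nemset_add evm_add)
lemma ev_single: "ev (single_nemset x) = (if good x then snd x else \<zero>)" by (simp add: ev_def evm_single)
lemma dg_single [simp]: "dg (single_nemset x) = fst x" by (simp add: dg_def)

lemma evm_cases: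
  "evm M = \<zero> \<or> evm M \<in> G (sum_mset (image_mset fst M)) \<and> (M \<noteq> {#} \<longrightarrow> 0 < sum_mset (image_mset fst M))"
proof (induction M)
  case empty then show ?case using one_grade by simp
next
  case (add x M)
  show ?case
  proof (cases "good x \<and> evm M \<noteq> \<zero>")
    case True
    then have "snd x \<otimes> evm M \<in> G (fst x + sum_mset (image_mset fst M))"
      using add by (intro mult_grade) (auto simp: good_def)
    then show ?thesis using True by (simp add: evm_add_mset fmul_def good_def)
  next
    case False
    then show ?thesis using G_sub by (auto simp: evm_add_mset fmul_def good_def)
  qed
qed

lemma ev_cases: "ev m = \<zero> \<or> ev m \<in> G (dg m) \<and> 0 < dg m"
  using evm_cases[of "Rep_nemset m"] Rep_nemset[of m] by (simp add: ev_def dg_def)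

text \<open>Formal products with the same value in A agree under every \<open>K c\<close>. In this
  way dividing by \<open>null\<close> imposes the multiplication of A on letters.\<close>

definition K :: "nat \<times> nat \<Rightarrow> (nat \<times> 'a) nemset \<Rightarrow> int" where "K c m = coord c (ev m)"

definition splits :: "nat \<times> nat \<Rightarrow> ((nat \<times> nat) \<times> (nat \<times> nat)) set" where
  "splits c = {(d, e). snd d < rk (fst d) \<and> snd e < rk (fst e) \<and> 0 < fst d \<and> 0 < fst e \<and> fst d + fst e = fst c}"

lemma K_add: "K c (a + b) = (\<Sum>t\<in>splits c. coord c (bas (fst t) \<otimes> bas (snd t)) * K (fst t) a * K (snd t) b)"
proof (cases "ev a = \<zero> \<or> ev b = \<zero>")
  case True
  then show ?thesis by (auto simp: K_def ev_add)
next
  case False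
  then show ?thesis
    using ev_cases[of a] ev_cases[of b] coord_mult[of "ev a" "dg a" "ev b" "dg b" c]
    by (auto simp: K_def ev_add splits_def case_prod_beta)
qed

lemma K_invalid: "\<not> (0 < fst c \<and> snd c < rk (fst c)) \<Longrightarrow> K c m = 0"
  using ev_cases[of m] coord_other[of "ev m" "dg m" c] coord_big[of "ev m" c] by (auto simp: K_def)

lemma K_degree: "fst c \<noteq> dg m \<Longrightarrow> K c m = 0"
  using ev_cases[of m] coord_other[of "ev m" "dg m" c] by (auto simp: K_def)

lemma lderiv_K_mult:
  "lderiv (K c) (x * y) = lderiv (K c) x * y + x * lderiv (K c) y +
    (\<Sum>t\<in>splits c. of_int (coord c (bas (fst t) \<otimes> bas (snd t))) * lderiv (K (fst t)) x * lderiv (K (snd t)) y)"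
  by (rule lderiv_mult) (rule K_add)

definition valid :: "(nat \<times> nat) list \<Rightarrow> bool" where
  "valid k \<longleftrightarrow> (\<forall>c\<in>set k. 0 < fst c \<and> snd c < rk (fst c))"

definition kdeg :: "(nat \<times> nat) list \<Rightarrow> nat" where "kdeg k = sum_list (map fst k)"

lemma kdeg_simps [simp]: "kdeg [] = 0" "kdeg (c # k) = fst c + kdeg k" "kdeg (k @ l) = kdeg k + kdeg l"
  by (simp_all add: kdeg_def)

lemma lderiv_K_invalid: "\<not> (0 < fst c \<and> snd c < rk (fst c)) \<Longrightarrow> lderiv (K c) x = 0"
proof -
  assume "\<not> (0 < fst c \<and> snd c < rk (fst c))"
  then have "K c m = 0" for m by (rule K_invalid)
  then have w: "lderiv (K c) (word w) = 0" for w
    by (cases w rule: qsh_pre_cases) (simp_all del: pre_word)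
  show ?thesis
    by (rule qsh_additive_eq[where g = "\<lambda>_. 0", OF lderiv_additive]) (simp_all add: additive_def w)
qed

lemma coef_invalid: "\<not> valid k \<Longrightarrow> coef K k x = 0"
proof (induction k arbitrary: x)
  case (Cons c k)
  then show ?case
    by (cases "0 < fst c \<and> snd c < rk (fst c)")
      (auto simp: coef_Cons valid_def lderiv_K_invalid additive.zero[OF coef_additive])
qed (simp add: valid_def)

text \<open>The coordinates of J(A) in degree n with respect to tensor words on the chosen bases.
  \<open>valid\<close> makes the set finite, and by \<open>coef_invalid\<close> it drops only the
  zero functional.\<close>

definition C :: "nat \<Rightarrow> ((nat \<times> 'a) nemset qsh \<Rightarrow> int) set" where
  "C n = {coef K k | k. valid k \<and> kdeg k = n}"

lemma length_le_kdeg: "valid k \<Longrightarrow> length k \<le> kdeg k"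
  by (induction k) (auto simp: valid_def)

lemma fst_le_kdeg: "c \<in> set k \<Longrightarrow> fst c \<le> kdeg k"
  by (induction k) auto

lemma finite_valid: "finite {k. valid k \<and> kdeg k \<le> n}"
proof (rule finite_subset)
  let ?B = "Sigma {..n} (\<lambda>n. {..<rk n})"
  show "{k. valid k \<and> kdeg k \<le> n} \<subseteq> {k. set k \<subseteq> ?B \<and> length k \<le> n}"
  proof
    fix k assume k: "k \<in> {k. valid k \<and> kdeg k \<le> n}"
    have "set k \<subseteq> ?B"
    proof
      fix c assume c: "c \<in> set k"
      have "fst c \<in> {..n}" "snd c \<in> {..<rk (fst c)}" using k c fst_le_kdeg[OF c] by (auto simp: valid_def)
      from SigmaI[where B = "\<lambda>n. {..<rk n}", OF this] show "c \<in> ?B" by simp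
    qed
    then show "k \<in> {k. set k \<subseteq> ?B \<and> length k \<le> n}" using k length_le_kdeg[of k] by auto
  qed
  show "finite {k. set k \<subseteq> ?B \<and> length k \<le> n}" by (rule finite_lists_length_le) simp
qed

sublocale functional_grading C
proof (rule functional_grading.intro)
  show "additive c" if "c \<in> C n" for c n using that by (auto simp: C_def coef_additive)
  have "C n \<subseteq> coef K ` {k. valid k \<and> kdeg k \<le> n}" for n by (auto simp: C_def)
  then show "finite (C n)" for n by (rule finite_subset) (intro finite_imageI finite_valid)
qed

lemma null_iff: "x \<in> null \<longleftrightarrow> (\<forall>k. coef K k x = 0)"
  unfolding null_def C_def using coef_invalid by blast

lemma grade_iff: "x \<in> grade n \<longleftrightarrow> (\<forall>k. kdeg k \<noteq> n \<longrightarrow> coef K k x = 0)"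
  unfolding grade_def C_def using coef_invalid by blast

text \<open>Integer degrees avoid a case distinction when a left derivative lowers the degree below \<open>0\<close>.\<close>

definition zgrade :: "int \<Rightarrow> (nat \<times> 'a) nemset qsh set" where
  "zgrade z = {x. \<forall>k. int (kdeg k) \<noteq> z \<longrightarrow> coef K k x = 0}"

lemma zgrade_int: "x \<in> zgrade (int n) \<longleftrightarrow> x \<in> grade n"
  by (auto simp: zgrade_def grade_iff)

lemma zgrade_neg: "z < 0 \<Longrightarrow> x \<in> zgrade z \<Longrightarrow> x \<in> null"
  by (force simp: zgrade_def null_iff)

lemma zgrade_lderivs: "x \<in> zgrade z \<Longrightarrow> lderivs K k x \<in> zgrade (z - int (kdeg k))"
  unfolding zgrade_def by (simp flip: coef_append)

lemma zgrade_lderiv: "x \<in> zgrade z \<Longrightarrow> lderiv (K c) x \<in> zgrade (z - int (fst c))"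
  using zgrade_lderivs[of x z "[c]"] by simp

lemma null_lderivs: "x \<in> null \<Longrightarrow> lderivs K k x \<in> null"
  by (simp add: null_iff flip: coef_append)

lemma coef_sum: "coef K k (\<Sum>t\<in>T. f t) = (\<Sum>t\<in>T. coef K k (f t))"
  by (rule additive.sum[OF coef_additive])

text \<open>By the product rule, a left derivative of the product is a sum of products each
  containing x or a left derivative of x, and these all lie in \<open>null\<close>.\<close>

lemma coef_mult_null: "x \<in> null \<Longrightarrow> coef K k (x * y) = 0"
proof (induction k arbitrary: x y)
  case Nil
  then have "qsh_eps x = 0" using null_iff[of x] coef_Nil[of K x] by metis
  then show ?case by (simp add: coef_Nil qsh_eps_mult)
next
  case (Cons c k)
  have n: "lderiv (K d) x \<in> null" for d using null_lderivs[OF Cons.prems, of "[d]"] by simp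
  have "coef K k (of_int a * lderiv (K d) x * z) = 0" for a d z
    using coef_of_int[of K k a "lderiv (K d) x * z"] Cons.IH[OF n] by (simp add: mult.assoc)
  then show ?case using Cons.IH[OF n] Cons.IH[OF Cons.prems]
    by (simp add: coef_Cons lderiv_K_mult additive.add[OF coef_additive] coef_sum)
qed

text \<open>Pairs in \<open>splits c\<close> have total degree \<open>fst c\<close>, so every term
  of the product rule lowers the degree by the same amount.\<close>

lemma coef_mult_zgrade:
  "x \<in> zgrade a \<Longrightarrow> y \<in> zgrade b \<Longrightarrow> int (kdeg k) \<noteq> a + b \<Longrightarrow> coef K k (x * y) = 0"
proof (induction k arbitrary: x y a b)
  case Nil
  then have "a \<noteq> 0 \<or> b \<noteq> 0" by auto
  then have "qsh_eps x = 0 \<or> qsh_eps y = 0" 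
    using Nil.prems(1,2) coef_Nil[of K] by (auto simp: zgrade_def dest!: spec[of _ "[]"])
  then show ?case by (auto simp: coef_Nil qsh_eps_mult)
next
  case (Cons c k)
  have 1: "coef K k (lderiv (K c) x * y) = 0"
    by (rule Cons.IH[OF zgrade_lderiv[OF Cons.prems(1)] Cons.prems(2)]) (use Cons.prems(3) in auto)
  have 2: "coef K k (x * lderiv (K c) y) = 0"
    by (rule Cons.IH[OF Cons.prems(1) zgrade_lderiv[OF Cons.prems(2)]]) (use Cons.prems(3) in auto)
  have "coef K k (lderiv (K (fst t)) x * lderiv (K (snd t)) y) = 0" if "t \<in> splits c" for t
    by (rule Cons.IH[OF zgrade_lderiv[OF Cons.prems(1)] zgrade_lderiv[OF Cons.prems(2)]])
      (use Cons.prems(3) that in \<open>auto simp: splits_def\<close>)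
  then have "coef K k (of_int s * lderiv (K (fst t)) x * lderiv (K (snd t)) y) = 0" if "t \<in> splits c" for t s
    using coef_of_int[of K k s "lderiv (K (fst t)) x * lderiv (K (snd t)) y"] that by (simp add: mult.assoc)
  then show ?case using 1 2
    by (simp add: coef_Cons lderiv_K_mult additive.add[OF coef_additive] coef_sum)
qed

lemma coef_one: "coef K k 1 = (if k = [] then 1 else 0)"
  by (cases k) (simp_all add: coef_Nil coef_Cons additive.zero[OF coef_additive])

definition wdeg :: "(nat \<times> 'a) nemset list \<Rightarrow> nat" where "wdeg w = sum_list (map dg w)"

lemma word_null_or_grade:
  "word w \<in> null \<or> word w \<in> grade (wdeg w) \<and> (w \<noteq> [] \<longrightarrow> 0 < wdeg w)"
proof (cases "\<exists>m\<in>set w. ev m = \<zero>")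
  case True
  then obtain i where i: "i < length w" "ev (w ! i) = \<zero>" by (auto simp: in_set_conv_nth)
  have "coef K k (word w) = 0" for k
    using i by (auto simp: coef_word K_def intro!: bexI[of _ i])
  then show ?thesis by (simp add: null_iff)
next
  case False
  have "coef K k (word w) = 0" if "kdeg k \<noteq> wdeg w" for k
  proof (cases "length k = length w")
    case True
    have "\<exists>i<length w. fst (k ! i) \<noteq> dg (w ! i)"
    proof (rule ccontr)
      assume "\<not> ?thesis"
      then have "map fst k = map dg w" using True by (intro nth_equalityI) auto
      then show False using that by (simp add: kdeg_def wdeg_def)
    qed
    then obtain i where "i < length w" "fst (k ! i) \<noteq> dg (w ! i)" by blast
    then show ?thesis using K_degree[of "k ! i" "w ! i"] by (auto simp: coef_word intro!: bexI[of _ i])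
  qed (simp add: coef_word)
  then have "word w \<in> grade (wdeg w)" by (simp add: grade_iff)
  moreover have "0 < wdeg w" if "w \<noteq> []"
  proof -
    have "0 < dg (hd w)" using ev_cases[of "hd w"] False that hd_in_set by blast
    then show ?thesis using that by (cases w) (auto simp: wdeg_def)
  qed
  ultimately show ?thesis by blast
qed

lemma exists_decomp: "\<exists>f M. (\<forall>n. f n \<in> grade n) \<and> x - (\<Sum>n\<le>M::nat. f n) \<in> null"
proof (induction x rule: qsh_induct)
  case zero
  then show ?case by (intro exI[of _ "\<lambda>_. 0"] exI[of _ 0]) simp
next
  case (word w)
  show ?case
  proof (cases "word w \<in> null")
    case True
    then show ?thesis by (intro exI[of _ "\<lambda>_. 0"] exI[of _ 0]) simp
  next
    case False
    then have g: "word w \<in> grade (wdeg w)" using word_null_or_grade by blast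
    show ?thesis
      by (rule exI[of _ "\<lambda>n. if n = wdeg w then word w else 0"], rule exI[of _ "wdeg w"]) (simp add: g)
  qed
next
  case (diff x y)
  obtain f M where f: "\<And>n. f n \<in> grade n" "x - (\<Sum>n\<le>M. f n) \<in> null" using diff by blast
  obtain g L where g: "\<And>n. g n \<in> grade n" "y - (\<Sum>n\<le>L. g n) \<in> null" using diff by blast
  define f' g' where "f' n = (if n \<le> M then f n else 0)" and "g' n = (if n \<le> L then g n else 0)" for n
  have "(\<Sum>n\<le>M + L. f' n) = (\<Sum>n\<le>M. f n)" "(\<Sum>n\<le>M + L. g' n) = (\<Sum>n\<le>L. g n)"
    unfolding f'_def g'_def by (rule sum.mono_neutral_cong_right; auto)+
  then have eq: "(x - y) - (\<Sum>n\<le>M + L. f' n - g' n) = (x - (\<Sum>n\<le>M. f n)) - (y - (\<Sum>n\<le>L. g n))"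
    by (simp add: sum_subtractf)
  have 1: "(x - y) - (\<Sum>n\<le>M + L. f' n - g' n) \<in> null"
    unfolding eq by (rule null_diff[OF f(2) g(2)])
  have 2: "f' n - g' n \<in> grade n" for n
    using f(1) g(1) by (intro grade_diff) (auto simp: f'_def g'_def)
  show ?case
    by (rule exI[of _ "\<lambda>n. f' n - g' n"], rule exI[of _ "M + L"]) (simp only: 1 2 simp_thms)
qed

definition basis_word :: "(nat \<times> nat) list \<Rightarrow> (nat \<times> 'a) nemset qsh" where
  "basis_word k = word (map (\<lambda>c. single_nemset (fst c, bas c)) k)"

lemma coef_basis_word:
  assumes "valid l"
  shows "coef K k (basis_word l) = (if k = l then 1 else 0)"
proof -
  have "K c (single_nemset (fst d, bas d)) = (if c = d then 1 else 0)" if "d \<in> set l" for c d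
    using that assms bas_G[of d] by (simp add: K_def ev_single good_def valid_def coord_bas)
  then have K: "K c (single_nemset (fst (l ! i), bas (l ! i))) = (if c = l ! i then 1 else 0)" if "i < length l" for c i
    using that by simp
  show ?thesis
  proof (cases "length k = length l")
    case True
    have "(\<Prod>i<length l. K (k ! i) (single_nemset (fst (l ! i), bas (l ! i)))) = (\<Prod>i<length l. if k ! i = l ! i then 1 else 0)"
      by (rule prod.cong) (auto simp: K)
    also have "\<dots> = (if k = l then 1 else 0)"
    proof (cases "k = l")
      case False
      then obtain i where "i < length l" "k ! i \<noteq> l ! i" using True nth_equalityI by metis
      then show ?thesis using False by (auto intro!: bexI[of _ i])
    qed simp
    finally show ?thesis using True by (simp add: basis_word_def coef_word)
  qed (auto simp: basis_word_def coef_word)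
qed

text \<open>Modulo \<open>null\<close>, x is the sum of the basis words weighted by its coordinates;
  the sum is finite because the coordinates vanish above some degree.\<close>

lemma null_mod_if_coef:
  assumes "\<And>k. int p dvd coef K k x"
  shows "x \<in> null_mod p"
proof -
  obtain f M where f: "\<And>n. f n \<in> grade n" "x - (\<Sum>n\<le>M. f n) \<in> null" using exists_decomp[of x] by blast
  let ?S = "{k. valid k \<and> kdeg k \<le> M}"
  have big: "coef K k x = 0" if "M < kdeg k" for k
  proof -
    have "coef K k x = (\<Sum>n\<le>M. coef K k (f n))"
      using f(2) by (simp add: null_iff additive.diff[OF coef_additive] coef_sum)
    also have "\<dots> = 0"
    proof (rule sum.neutral, rule ballI)
      fix n assume "n \<in> {..M}"
      then show "coef K k (f n) = 0" using f(1)[of n] that by (simp add: grade_iff)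
    qed
    finally show ?thesis .
  qed
  have "x - (\<Sum>l\<in>?S. of_int (coef K l x) * basis_word l) \<in> null"
    unfolding null_iff
  proof
    fix k
    have "coef K k (\<Sum>l\<in>?S. of_int (coef K l x) * basis_word l) = (\<Sum>l\<in>?S. if l = k then coef K k x else 0)"
      unfolding coef_sum coef_of_int by (rule sum.cong) (auto simp: coef_basis_word)
    also have "\<dots> = coef K k x"
      using finite_valid[of M] big[of k] coef_invalid[of k x] by (auto simp: not_le)
    finally show "coef K k (x - (\<Sum>l\<in>?S. of_int (coef K l x) * basis_word l)) = 0"
      by (simp add: additive.diff[OF coef_additive])
  qed
  moreover have "(of_nat p :: (nat \<times> 'a) nemset qsh) dvd (\<Sum>l\<in>?S. of_int (coef K l x) * basis_word l)"
  proof (intro dvd_sum dvd_mult2)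
    fix l
    have "of_int (int p) dvd (of_int (coef K l x) :: (nat \<times> 'a) nemset qsh)" by (rule of_int_dvd_of_intI) (rule assms)
    then show "of_nat p dvd (of_int (coef K l x) :: (nat \<times> 'a) nemset qsh)" by simp
  qed
  then obtain y where "(\<Sum>l\<in>?S. of_int (coef K l x) * basis_word l) = of_nat p * y" by (elim dvdE)
  ultimately show ?thesis by (auto simp: null_mod_def)
qed

lemma coef_if_null_mod: "x \<in> null_mod p \<Longrightarrow> int p dvd coef K k x"
proof -
  assume "x \<in> null_mod p"
  then obtain y where "x - of_int (int p) * y \<in> null" by (auto simp: null_mod_def)
  then have "coef K k (x - of_int (int p) * y) = 0" unfolding null_iff by blast
  then show ?thesis unfolding additive.diff[OF coef_additive] coef_of_int by simp
qed

lemma ev_repeat_add: "ev (repeat_add j m) = ev m [^] Suc j"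
proof (induction j)
  case (Suc j)
  then show ?case using carrier_comm by (simp add: ev_add)
qed simp

end

section \<open>Injectivity of Frobenius on J(A) modulo p, and verification of the criterion\<close>

locale reduced_graded_ring = even_graded_ring +
  assumes red: "Factorial_Ring.prime (p::nat) \<Longrightarrow> x \<in> carrier A \<Longrightarrow> zero_mod A p (x [^] p) \<Longrightarrow> zero_mod A p x"
begin

text \<open>Frobenius acts letter by letter, so stripping a letter after Frobenius and applying the
  left inverse \<gamma> amounts to stripping it beforehand.\<close>

lemma lderiv_frob:
  assumes p: "Factorial_Ring.prime p" and c: "0 < fst c" "snd c < rk (fst c)"
  shows "\<exists>\<gamma>. \<forall>x. of_nat p dvd (\<Sum>j<rk (p * fst c). of_int (\<gamma> j) * lderiv (K (p * fst c, j)) (qsh_frob p x))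
    - qsh_frob p (lderiv (K c) x)"
proof -
  have p0: "p > 0" by (rule prime_gt_0_nat[OF p])
  obtain \<gamma> where \<gamma>: "\<And>a. a \<in> G (fst c) \<Longrightarrow>
      int p dvd (\<Sum>j<rk (p * fst c). \<gamma> j * coord (p * fst c, j) (a [^] p)) - coord (fst c, snd c) a"
    using frob_left_inverse[OF red[OF p] p c(2)] by blast
  have g: "int p dvd (\<Sum>j<rk (p * fst c). \<gamma> j * K (p * fst c, j) (repeat_add (p - 1) m)) - K c m" for m
  proof (cases "ev m \<in> G (fst c)")
    case True
    then show ?thesis using \<gamma>[OF True] p0 by (simp add: K_def ev_repeat_add del: nat_pow_Suc)
  next
    case False
    then have m: "ev m \<in> G (dg m)" "dg m \<noteq> fst c" using ev_cases[of m] by (auto intro: G_zero)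
    have "K (p * fst c, j) (repeat_add (p - 1) m) = 0" for j
      using coord_other[OF G_pow[OF m(1), of p], of "(p * fst c, j)"] m(2) p0
      by (simp add: K_def ev_repeat_add del: nat_pow_Suc)
    moreover have "K c m = 0" using coord_other[OF m(1), of c] m(2) by (simp add: K_def)
    ultimately show ?thesis by simp
  qed
  have frob_pre: "qsh_frob p (word (m # w)) = pre (repeat_add (p - 1) m) (qsh_frob p (word w))" for m w
    by (simp add: qsh_frob_def)
  have frob_add: "qsh_frob p (x - y) = qsh_frob p x - qsh_frob p y" for x y
    by (rule additive.diff[OF qsh_frob_additive])
  let ?D = "\<lambda>x. (\<Sum>j<rk (p * fst c). of_int (\<gamma> j) * lderiv (K (p * fst c, j)) (qsh_frob p x))
      - qsh_frob p (lderiv (K c) x)"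
  have "of_nat p dvd ?D x" for x
  proof (induction x rule: qsh_induct)
    case zero then show ?case by (simp add: additive.zero[OF qsh_frob_additive])
  next
    case (word w)
    show ?case
    proof (cases w)
      case Nil
      then show ?thesis by (simp add: word_Nil qsh_frob_def)
    next
      case (Cons m w')
      let ?F = "qsh_frob p (word w')"
      have "lderiv (K c) (word w) = of_int (K c m) * word w'"
        using lderiv_simps(2)[of "K c" m "word w'"] by (simp add: Cons)
      then have "qsh_frob p (lderiv (K c) (word w)) = of_int (K c m) * ?F"
        by (simp add: additive_of_int[OF qsh_frob_additive])
      moreover have "(\<Sum>j<rk (p * fst c). of_int (\<gamma> j) * lderiv (K (p * fst c, j)) (qsh_frob p (word w)))
         = of_int (\<Sum>j<rk (p * fst c). \<gamma> j * K (p * fst c, j) (repeat_add (p - 1) m)) * ?F"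
        unfolding Cons frob_pre lderiv_simps of_int_sum sum_distrib_right of_int_mult mult.assoc ..
      ultimately have "?D (word w) = of_int ((\<Sum>j<rk (p * fst c). \<gamma> j * K (p * fst c, j) (repeat_add (p - 1) m)) - K c m) * ?F"
        by (simp only: of_int_diff left_diff_distrib)
      moreover have "of_nat p dvd (of_int ((\<Sum>j<rk (p * fst c). \<gamma> j * K (p * fst c, j) (repeat_add (p - 1) m)) - K c m) :: (nat \<times> 'a) nemset qsh)"
        using of_int_dvd_of_intI[OF g[of m]] unfolding of_int_of_nat_eq .
      ultimately show ?thesis by (simp only: dvd_mult2)
    qed
  next
    case (diff x y)
    have "?D (x - y) = ?D x - ?D y"
      by (simp add: frob_add additive.diff[OF lderiv_additive] right_diff_distrib sum_subtractf)
    then show ?case using dvd_diff[OF diff] by simp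
  qed
  then show ?thesis by blast
qed

text \<open>Injectivity of Frobenius modulo p, obtained by undoing it on one letter at a
  time.\<close>

lemma coef_frob: "Factorial_Ring.prime p \<Longrightarrow> (\<And>l. int p dvd coef K l (qsh_frob p x)) \<Longrightarrow> int p dvd coef K k x"
proof (induction k arbitrary: x)
  case Nil
  have "qsh_eps (qsh_frob p x) = qsh_eps x"
  proof (rule qsh_additive_eq[where f = "\<lambda>x. qsh_eps (qsh_frob p x)"])
    show "qsh_eps (qsh_frob p (word w)) = qsh_eps (word w)" for w by (simp add: qsh_frob_def qsh_eps_def)
  qed (intro additive_comp[OF qsh_eps_additive qsh_frob_additive] qsh_eps_additive)+
  then show ?case using Nil.prems(2)[of "[]"] by (simp add: coef_Nil)
next
  case (Cons c k)
  note p = Cons.prems(1)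
  show ?case
  proof (cases "0 < fst c \<and> snd c < rk (fst c)")
    case False
    then show ?thesis by (simp add: coef_Cons lderiv_K_invalid additive.zero[OF coef_additive])
  next
    case True
    obtain \<gamma> where \<gamma>: "\<forall>x. of_nat p dvd (\<Sum>j<rk (p * fst c). of_int (\<gamma> j) * lderiv (K (p * fst c, j)) (qsh_frob p x))
      - qsh_frob p (lderiv (K c) x)" using lderiv_frob[OF p conjunct1[OF True] conjunct2[OF True]] by (elim exE)
    have "int p dvd coef K l (qsh_frob p (lderiv (K c) x))" for l
    proof -
      let ?s = "(\<Sum>j<rk (p * fst c). of_int (\<gamma> j) * lderiv (K (p * fst c, j)) (qsh_frob p x))"
      have 1: "int p dvd coef K l ?s - coef K l (qsh_frob p (lderiv (K c) x))"
        using additive_of_nat_dvd[OF coef_additive \<gamma>[THEN spec]] unfolding additive.diff[OF coef_additive] .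
      have 2: "int p dvd coef K l ?s"
        unfolding coef_sum coef_of_int coef_Cons[symmetric] by (intro dvd_sum dvd_mult Cons.prems(2))
      from dvd_diff[OF 2 1] show ?thesis by simp
    qed
    from Cons.IH[OF p this] show ?thesis by (simp add: coef_Cons)
  qed
qed

text \<open>Discharges the hypothesis of \<open>qsh_der_mult\<close>: a nonempty word is null or
  homogeneous of positive degree, and \<xi> kills decomposables of degree n and everything in other
  degrees.\<close>

lemma word_mult_functional:
  assumes \<xi>: "additive \<xi>" "\<And>x. x \<in> null \<Longrightarrow> \<xi> x = (0::int)"
    "\<And>m x. m \<noteq> n \<Longrightarrow> x \<in> grade m \<Longrightarrow> \<xi> x = 0"
    "\<And>i j x y. \<lbrakk>0 < i; 0 < j; i + j = n; x \<in> grade i; y \<in> grade j\<rbrakk> \<Longrightarrow> \<xi> (x * y) = 0"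
  shows "\<xi> (pre a x * pre b y) = 0"
proof (rule qsh_additive2_eq[where f = "\<lambda>x y. \<xi> (pre a x * pre b y)" and g = "\<lambda>_ _. 0"])
  fix u v
  let ?u = "word (a # u)" and ?v = "word (b # v)"
  have "\<xi> (?u * ?v) = 0"
  proof (cases "?u \<in> null \<or> ?v \<in> null")
    case True
    then have "?u * ?v \<in> null"
      using coef_mult_null[of ?u _ ?v] coef_mult_null[of ?v _ ?u] by (auto simp: null_iff mult.commute)
    then show ?thesis by (rule \<xi>(2))
  next
    case False
    then have g: "?u \<in> grade (wdeg (a # u))" "0 < wdeg (a # u)" "?v \<in> grade (wdeg (b # v))" "0 < wdeg (b # v)"
      using word_null_or_grade[of "a # u"] word_null_or_grade[of "b # v"] by auto
    show ?thesis
    proof (cases "wdeg (a # u) + wdeg (b # v) = n")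
      case True
      then show ?thesis by (intro \<xi>(4)[OF g(2,4) _ g(1,3)])
    next
      case False
      have "?u * ?v \<in> grade (wdeg (a # u) + wdeg (b # v))"
        unfolding zgrade_int[symmetric] zgrade_def
        using coef_mult_zgrade[of ?u "int (wdeg (a # u))" ?v "int (wdeg (b # v))"] g(1,3) by (simp add: zgrade_int)
      then show ?thesis by (rule \<xi>(3)[OF False])
    qed
  qed
  then show "\<xi> (pre a (word u) * pre b (word v)) = 0" by simp
qed (simp_all add: additive_def pre_add distrib_left distrib_right additive.add[OF \<xi>(1)])

sublocale polynomial_criterion C
proof (intro polynomial_criterion.intro polynomial_criterion_axioms.intro)
  show "functional_grading C" by (rule functional_grading_axioms)
  show "x * y \<in> null" if "x \<in> null" for x y using coef_mult_null[OF that] by (simp add: null_iff)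
  show "1 \<in> grade 0" by (auto simp: grade_iff coef_one)
  show "x * y \<in> grade (m + n)" if "x \<in> grade m" "y \<in> grade n" for x y m n
    unfolding zgrade_int[symmetric] zgrade_def
    using coef_mult_zgrade[of x "int m" y "int n"] that by (simp add: zgrade_int)
  show "\<exists>f M. (\<forall>n. f n \<in> grade n) \<and> x - (\<Sum>n\<le>M::nat. f n) \<in> null" for x by (rule exists_decomp)
  show "\<exists>c. x - of_int c \<in> null" if x: "x \<in> grade 0" for x
  proof (rule exI[of _ "qsh_eps x"])
    have "coef K k (x - of_int (qsh_eps x)) = 0" for k
    proof (cases "k = []")
      case True
      then show ?thesis by (simp add: coef_Nil additive.diff[OF qsh_eps_additive])
    next
      case False
      have "coef K k x = 0"
      proof (cases "kdeg k = 0")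
        case True
        then have "\<not> valid k" using False length_le_kdeg[of k] by auto
        then show ?thesis by (rule coef_invalid)
      next
        case False
        then show ?thesis using x by (simp add: grade_iff)
      qed
      then show ?thesis using False coef_of_int[of K k "qsh_eps x" 1]
        by (simp add: additive.diff[OF coef_additive] coef_one)
    qed
    then show "x - of_int (qsh_eps x) \<in> null" by (simp add: null_iff)
  qed
  show "\<exists>c\<in>C 0. c 1 = 1"
    by (rule bexI[of _ "coef K []"]) (auto simp: coef_one C_def valid_def intro!: exI[of _ "[]"])
  show "x \<in> null_mod p" if p: "Factorial_Ring.prime p" and x: "x ^ p \<in> null_mod p" for p x
  proof (rule null_mod_if_coef, rule coef_frob[OF p])
    fix l
    \<comment> \<open>The power is exchanged for its additive lift, to which
      \<open>coef_frob\<close> applies.\<close>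
    have 1: "int p dvd coef K l (x ^ p) - coef K l (qsh_frob p x)"
      using additive_of_nat_dvd[OF coef_additive prime_dvd_power_qsh_frob[OF p]]
      unfolding additive.diff[OF coef_additive] .
    from dvd_diff[OF coef_if_null_mod[OF x, of l] 1] show "int p dvd coef K l (qsh_frob p x)" by simp
  qed
  fix n and \<xi> :: "(nat \<times> 'a) nemset qsh \<Rightarrow> int"
  assume n: "0 < n" and \<xi>: "additive \<xi>" "\<And>x. x \<in> null \<Longrightarrow> \<xi> x = (0::int)"
    "\<And>m x. m \<noteq> n \<Longrightarrow> x \<in> grade m \<Longrightarrow> \<xi> x = 0"
    "\<And>i j x y. \<lbrakk>0 < i; 0 < j; i + j = n; x \<in> grade i; y \<in> grade j\<rbrakk> \<Longrightarrow> \<xi> (x * y) = 0"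
  have \<xi>1: "\<xi> 1 = 0"
    by (rule \<xi>(3)[of 0]) (use n in \<open>auto simp: grade_iff coef_one\<close>)
  \<comment> \<open>Left derivatives lower the degree by \<open>kdeg k\<close>, and \<xi> vanishes
    outside degree n; this decides all coordinates of the derivation.\<close>
  have cD: "coef K k (qsh_der \<xi> x) = \<xi> (lderivs K k x)" for k x by (rule coef_qsh_der[OF \<xi>(1) \<xi>1])
  have \<xi>z: "\<xi> x = 0" if "x \<in> zgrade z" "z \<noteq> int n" for x z
  proof (cases "z < 0")
    case True then show ?thesis using zgrade_neg[OF True that(1)] \<xi>(2) by blast
  next
    case False
    then show ?thesis using \<xi>(3)[of "nat z" x] that zgrade_int[of x "nat z"] by auto
  qed
  show "\<exists>D. derivation D \<and> (\<forall>x\<in>null. D x \<in> null) \<and> (\<forall>m<n. \<forall>x\<in>grade m. D x \<in> null) \<and>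
          (\<forall>x\<in>grade n. D x - of_int (\<xi> x) \<in> null)"
  proof (intro exI conjI ballI allI impI)
    show "derivation (qsh_der \<xi>)"
      by (intro derivation.intro derivation_axioms.intro qsh_der_additive qsh_der_mult \<xi>(1)
          word_mult_functional[OF \<xi>])
    show "qsh_der \<xi> x \<in> null" if "x \<in> null" for x
      using \<xi>(2)[OF null_lderivs[OF that]] by (simp add: null_iff cD)
    show "qsh_der \<xi> x \<in> null" if "m < n" "x \<in> grade m" for m x
    proof -
      have "\<xi> (lderivs K k x) = 0" for k
        by (rule \<xi>z[OF zgrade_lderivs[of x "int m"]]) (use that in \<open>auto simp: zgrade_int\<close>)
      then show ?thesis by (simp add: null_iff cD)
    qed
    show "qsh_der \<xi> x - of_int (\<xi> x) \<in> null" if x: "x \<in> grade n" for x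
    proof -
      have "coef K k (qsh_der \<xi> x - of_int (\<xi> x)) = 0" for k
      proof (cases "k = []")
        case True
        then show ?thesis using cD[of "[]" x] by (simp add: coef_Nil additive.diff[OF qsh_eps_additive])
      next
        case False
        have "coef K k (qsh_der \<xi> x) = 0"
        proof (cases "kdeg k = 0")
          case True
          then have "\<not> valid k" using False length_le_kdeg[of k] by auto
          then show ?thesis by (rule coef_invalid)
        next
          case False
          then show ?thesis unfolding cD
            by (intro \<xi>z[OF zgrade_lderivs[of x "int n"]]) (use x in \<open>auto simp: zgrade_int\<close>)
        qed
        then show ?thesis using False coef_of_int[of K k "\<xi> x" 1]
          by (simp add: additive.diff[OF coef_additive] coef_one)
      qed
      then show ?thesis by (simp add: null_iff)
    qed
  qed
qed

end

section \<open>The graded ring $J^\vee(A)$ as a quotient of a quasi-shuffle ring\<close>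

definition prefix :: "'x \<Rightarrow> ('x list \<Rightarrow>\<^sub>0 int) \<Rightarrow> ('x list \<Rightarrow>\<^sub>0 int)" where
  "prefix x = frag_extend (\<lambda>w. frag_of (x # w))"

lemma prefix_of [simp]: "prefix x (frag_of w) = frag_of (x # w)" by (simp add: prefix_def)

lemma lookup_prefix:
  "lookup (prefix x f) v =
    (case v of [] \<Rightarrow> 0 | y # v' \<Rightarrow> if y = x then lookup f v' else 0)"
  using subset_UNIV[of "keys f"]
proof (induction f rule: frag_induction)
  case (diff a b)
  then show ?case by (cases v) (auto simp: prefix_def frag_extend_diff lookup_minus)
qed (auto simp: prefix_def split: list.splits)

lemma prefix_diff: "prefix x (f - g) = prefix x f - prefix x g"
  by (simp add: prefix_def frag_extend_diff)

lemma frag_cmul_diff_right: "frag_cmul c (f - g) = frag_cmul c f - frag_cmul c g"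
  by (rule poly_mapping_eqI) (simp add: lookup_minus right_diff_distrib)

lemma coef_word_simps:
  "coef K [] (word []) = 1" "coef K [] (word (m # w)) = 0" "coef K (c # k) (word []) = 0"
  "coef K (c # k) (word (m # w)) = K c m * coef K k (word w)"
  by (simp_all add: coef_word lessThan_Suc_eq_insert_0 prod.reindex zero_notin_Suc_image
      del: prod.lessThan_Suc)

lemma coef_word_letter_add:
  assumes "\<And>c. K c m = K c m' + (K c m'' :: int)"
  shows "coef K k (word (u @ m # v)) = coef K k (word (u @ m' # v)) + coef K k (word (u @ m'' # v))"
proof (induction u arbitrary: k)
  case Nil
  then show ?case by (cases k) (simp_all add: coef_word_simps assms distrib_right)
next
  case (Cons x u)
  then show ?case by (cases k) (simp_all add: coef_word_simps distrib_left)
qed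

context connected_graded_comm_ring
begin

abbreviation "WR \<equiv> word_ring A G"
abbreviation "TR \<equiv> tensor_relations A G"

lemma carrier_WR: "f \<in> carrier WR \<longleftrightarrow> keys f \<subseteq> words G"
  by (simp add: word_ring_def free_Abelian_group_def)

lemma add_monoid_WR: "add_monoid WR = free_Abelian_group (words G)"
  by (simp add: word_ring_def free_Abelian_group_def)

lemma WR_plus: "f \<oplus>\<^bsub>WR\<^esub> g = f + g"
  by (simp add: word_ring_def)

lemma WR_diff: "f \<in> carrier WR \<Longrightarrow> g \<in> carrier WR \<Longrightarrow> f - g \<in> carrier WR"
  unfolding carrier_WR using keys_diff[of f g] by blast

lemma WR_add: "f \<in> carrier WR \<Longrightarrow> g \<in> carrier WR \<Longrightarrow> f + g \<in> carrier WR"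
  unfolding carrier_WR using keys_add[of f g] by blast

lemma WR_of [simp]: "frag_of w \<in> carrier WR \<longleftrightarrow> w \<in> words G"
  by (simp add: carrier_WR)

lemma WR_frag_cmul: "f \<in> carrier WR \<Longrightarrow> frag_cmul c f \<in> carrier WR"
  unfolding carrier_WR using keys_cmul[of c f] by blast

lemma WR_sum: "(\<And>i. i \<in> S \<Longrightarrow> f i \<in> carrier WR) \<Longrightarrow> sum f S \<in> carrier WR"
proof (induction S rule: infinite_finite_induct)
  case (insert i S) then show ?case by (simp add: WR_add)
qed (simp_all add: carrier_WR)

lemma words_simps [simp]:
  "[] \<in> words G" "x # w \<in> words G \<longleftrightarrow> 0 < fst x \<and> snd x \<in> G (fst x) \<and> w \<in> words G"
  "u @ v \<in> words G \<longleftrightarrow> u \<in> words G \<and> v \<in> words G"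
  by (auto simp: words_def)

lemma relators_carrier: "tensor_relators A G \<subseteq> carrier WR"
proof
  fix f assume "f \<in> tensor_relators A G"
  then obtain u v n a b where f: "f = frag_of (u @ (n, a \<oplus> b) # v) - frag_of (u @ (n, a) # v) - frag_of (u @ (n, b) # v)"
    and "u \<in> words G" "v \<in> words G" "0 < n" "a \<in> G n" "b \<in> G n"
    by (auto simp: tensor_relators_def)
  then show "f \<in> carrier WR" unfolding f by (intro WR_diff) (auto simp: G_add)
qed

lemma TR_subgroup: "subgroup TR (free_Abelian_group (words G))"
proof -
  interpret F: group "free_Abelian_group (words G)" by simp
  show ?thesis
    unfolding tensor_relations_def add_monoid_WR
    by (rule F.generate_is_subgroup) (use relators_carrier in \<open>auto simp: subset_iff carrier_WR free_Abelian_group_def\<close>)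
qed

lemma TR_carrier: "f \<in> TR \<Longrightarrow> f \<in> carrier WR"
  using subgroup.subset[OF TR_subgroup] by (auto simp: carrier_WR free_Abelian_group_def)

lemma TR_zero [simp]: "0 \<in> TR"
  using subgroup.one_closed[OF TR_subgroup] by (simp add: free_Abelian_group_def)

lemma TR_add: "f \<in> TR \<Longrightarrow> g \<in> TR \<Longrightarrow> f + g \<in> TR"
  using subgroup.m_closed[OF TR_subgroup, of f g] by (simp add: free_Abelian_group_def)

lemma TR_uminus: "f \<in> TR \<Longrightarrow> - f \<in> TR"
  using subgroup.m_inv_closed[OF TR_subgroup, of f] TR_carrier[of f]
  by (simp add: carrier_WR)

lemma TR_diff: "f \<in> TR \<Longrightarrow> g \<in> TR \<Longrightarrow> f - g \<in> TR"
  using TR_add[of f "- g"] TR_uminus[of g] by simp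

lemma TR_frag_cmul: "f \<in> TR \<Longrightarrow> frag_cmul c f \<in> TR"
  by (rule frag_closure_minus_cmul[where P = "\<lambda>f. f \<in> TR"]) (auto intro: TR_diff)

lemma TR_sum: "(\<And>i. i \<in> S \<Longrightarrow> f i \<in> TR) \<Longrightarrow> sum f S \<in> TR"
  by (induction S rule: infinite_finite_induct) (auto intro: TR_add)

lemma TR_relator:
  "u \<in> words G \<Longrightarrow> v \<in> words G \<Longrightarrow> 0 < n \<Longrightarrow> a \<in> G n \<Longrightarrow> b \<in> G n \<Longrightarrow>
    frag_of (u @ (n, a \<oplus> b) # v) - frag_of (u @ (n, a) # v) - frag_of (u @ (n, b) # v) \<in> TR"
  unfolding tensor_relations_def by (rule generate.incl) (unfold tensor_relators_def, blast)

lemma TR_induct [consumes 1, case_names zero relator diff]: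
  assumes "f \<in> TR" "P 0"
    "\<And>u v n a b. u \<in> words G \<Longrightarrow> v \<in> words G \<Longrightarrow> 0 < n \<Longrightarrow> a \<in> G n \<Longrightarrow> b \<in> G n \<Longrightarrow>
      P (frag_of (u @ (n, a \<oplus> b) # v) - frag_of (u @ (n, a) # v) - frag_of (u @ (n, b) # v))"
    "\<And>f g. P f \<Longrightarrow> P g \<Longrightarrow> P (f - g)"
  shows "P f"
proof -
  have rel: "P h" if "h \<in> tensor_relators A G" for h using that assms(3) by (auto simp: tensor_relators_def)
  have neg: "P (- h)" if "P h" for h using assms(4)[OF assms(2) that] by simp
  have "f \<in> generate (free_Abelian_group (words G)) (tensor_relators A G)"
    using assms(1) unfolding tensor_relations_def add_monoid_WR .
  then show ?thesis
  proof (induction rule: generate.induct)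
    case one then show ?case using assms(2) by (simp add: free_Abelian_group_def)
  next
    case (incl h) then show ?case by (rule rel)
  next
    case (inv h)
    then have "keys h \<subseteq> words G" using relators_carrier carrier_WR by blast
    then show ?case using neg[OF rel[OF inv]] by simp
  next
    case (eng h1 h2)
    then show ?case using assms(4)[OF eng.IH(1) neg[OF eng.IH(2)]] by (simp add: free_Abelian_group_def)
  qed
qed

lemma TR_prefix:
  assumes "f \<in> TR" "0 < fst x" "snd x \<in> G (fst x)"
  shows "prefix x f \<in> TR"
  using assms(1)
proof (induction rule: TR_induct)
  case (relator u v n a b)
  then show ?case using TR_relator[of "x # u" v n a b] assms(2,3) by (simp add: prefix_def frag_extend_diff)
next
  case (diff f g)
  then show ?case by (simp add: prefix_def frag_extend_diff TR_diff)
qed (simp add: prefix_def)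

text \<open>Multilinear expansion in basis words. It serves to show that the relators exhaust the
  kernel of the coordinate functionals.\<close>

fun nf :: "'a word \<Rightarrow> ('a word \<Rightarrow>\<^sub>0 int)" where
  "nf [] = frag_of []"
| "nf (x # w) = (\<Sum>i<rk (fst x). frag_cmul (coord (fst x, i) (snd x)) (prefix (fst x, bas (fst x, i)) (nf w)))"

lemma letter_expand:
  assumes "w \<in> words G" "0 < n" "a \<in> G n"
  shows "frag_of ((n, a) # w) - (\<Sum>i<rk n. frag_cmul (coord (n, i) a) (frag_of ((n, bas (n, i)) # w))) \<in> TR"
proof -
  have rel: "frag_of ((n, a \<oplus> b) # w) - frag_of ((n, a) # w) - frag_of ((n, b) # w) \<in> TR" if "a \<in> G n" "b \<in> G n" for a b
    using TR_relator[of "[]" w n a b] that assms by simp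
  obtain f where f: "keys f \<subseteq> {..<rk n}" "a = param n f" using G_paramE[OF assms(3)] .
  have "keys f \<subseteq> {..<rk n} \<and> frag_of ((n, param n f) # w)
    - (\<Sum>i<rk n. frag_cmul (lookup f i) (frag_of ((n, bas (n, i)) # w))) \<in> TR"
    using f(1)
  proof (induction f rule: frag_induction)
    case zero
    have "param n 0 \<oplus> param n 0 = param n 0" using param_add[of 0 n 0] by simp
    then show ?case using rel[of "param n 0" "param n 0"] param_G[of 0 n] TR_uminus by fastforce
  next
    case (one j)
    have "(\<Sum>i<rk n. frag_cmul (lookup (frag_of j) i) (frag_of ((n, bas (n, i)) # w)))
      = (\<Sum>i<rk n. if i = j then frag_of ((n, bas (n, j)) # w) else 0)"
      by (rule sum.cong) auto
    then show ?case using one by (simp add: bas_def)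
  next
    case (diff p q)
    define S where "S h = (\<Sum>i<rk n. frag_cmul (lookup h i) (frag_of ((n, bas (n, i)) # w)))" for h
    have S: "S (p - q) = S p - S q" by (simp add: S_def lookup_minus frag_cmul_diff_distrib sum_subtractf)
    have k: "keys (p - q) \<subseteq> {..<rk n}" using diff keys_diff[of p q] by blast
    let ?F = "\<lambda>h. frag_of ((n, param n h) # w)"
    have "param n (p - q) \<oplus> param n q = param n p" using param_add[OF k, of q] diff by simp
    then have r: "?F p - ?F (p - q) - ?F q \<in> TR"
      using rel[of "param n (p - q)" "param n q"] param_G[OF k] param_G[of q n] diff by simp
    have "?F p - S p \<in> TR" "?F q - S q \<in> TR" using diff by (auto simp: S_def)
    from TR_diff[OF TR_diff[OF this] r] have "?F (p - q) - S (p - q) \<in> TR" by (simp add: S algebra_simps)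
    then show ?case using k by (simp add: S_def)
  qed
  then show ?thesis unfolding f(2) by (simp add: coord_param[OF f(1)])
qed

lemma nf_TR: "w \<in> words G \<Longrightarrow> frag_of w - nf w \<in> TR"
proof (induction w)
  case (Cons x w)
  obtain n a where x: "x = (n, a)" by (cases x)
  have w: "w \<in> words G" "0 < n" "a \<in> G n" using Cons.prems by (auto simp: x)
  let ?c = "\<lambda>i. coord (n, i) a" and ?y = "\<lambda>i. (n, bas (n, i))"
  have "(\<Sum>i<rk n. frag_cmul (?c i) (prefix (?y i) (frag_of w - nf w))) \<in> TR"
    using Cons.IH[OF w(1)] w(2) bas_G[of "(n, _)"] by (intro TR_sum TR_frag_cmul TR_prefix) auto
  moreover have "(\<Sum>i<rk n. frag_cmul (?c i) (prefix (?y i) (frag_of w - nf w))) =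
      (\<Sum>i<rk n. frag_cmul (?c i) (frag_of (?y i # w))) - nf (x # w)"
    by (simp add: x prefix_diff frag_cmul_diff_right sum_subtractf)
  ultimately have "(\<Sum>i<rk n. frag_cmul (?c i) (frag_of (?y i # w))) - nf (x # w) \<in> TR" by simp
  from TR_add[OF letter_expand[OF w] this] show ?case by (simp add: x)
qed simp

text \<open>Coordinates of one-letter words respect the relators, so A in positive degree embeds
  into J(A). This form is available before odd degrees are known to vanish.\<close>

lemma letter_functional_TR:
  assumes "f \<in> TR"
  shows "int_extend (\<lambda>w. case w of [x] \<Rightarrow> coord c (snd x) | _ \<Rightarrow> 0) f = 0"
  using assms
proof (induction rule: TR_induct)
  case (relator u v n a b)
  then show ?case using G_sub
    by (cases u; cases v) (auto simp: int_extend_diff coord_add split: list.splits)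
qed (simp_all add: int_extend_diff)

end

section \<open>Comparison of the word ring with the quasi-shuffle ring\<close>

context even_graded_ring
begin

text \<open>Each letter becomes a formal product with one factor. A merged letter is thus not sent
  to the product of its parts, and \<open>iota\<close> is multiplicative only modulo
  \<open>null\<close>.\<close>

definition iota :: "('a word \<Rightarrow>\<^sub>0 int) \<Rightarrow> (nat \<times> 'a) nemset qsh" where
  "iota = int_extend (\<lambda>w. word (map single_nemset w))"

lemma iota_additive: "additive iota" unfolding iota_def by (rule int_extend_additive)

lemmas iota_add = additive.add[OF iota_additive]
  and iota_0 [simp] = additive.zero[OF iota_additive]
  and iota_diff = additive.diff[OF iota_additive]
  and iota_sum = additive.sum[OF iota_additive]

lemma iota_of [simp]: "iota (frag_of w) = word (map single_nemset w)" by (simp add: iota_def)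

lemma iota_frag_cmul: "iota (frag_cmul c f) = of_int c * iota f"
  by (simp add: iota_def int_extend_frag_cmul)

lemma K_single: "good x \<Longrightarrow> K c (single_nemset x) = coord c (snd x)" by (simp add: K_def ev_single)

lemma good_words: "w \<in> words G \<longleftrightarrow> (\<forall>x\<in>set w. good x)"
  by (auto simp: words_def good_def)

lemma iota_TR: "f \<in> TR \<Longrightarrow> iota f \<in> null"
proof (induction rule: TR_induct)
  case (relator u v n a b)
  have "K c (single_nemset (n, a \<oplus> b)) = K c (single_nemset (n, a)) + K c (single_nemset (n, b))" for c
    using relator G_sub by (simp add: K_single good_def G_add coord_add)
  from coef_word_letter_add[where K = K, OF this] show ?case
    by (simp add: null_iff iota_diff additive.diff[OF coef_additive])
next
  case (diff f g) then show ?case by (simp add: iota_diff null_diff)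
qed simp

definition basis_letters :: "(nat \<times> nat) list \<Rightarrow> 'a word" where
  "basis_letters = map (\<lambda>c. (fst c, bas c))"

lemma basis_letters_Cons: "basis_letters (c # k) = (fst c, bas c) # basis_letters k"
  by (simp add: basis_letters_def)

lemma bas_inj: "snd c < rk (fst c) \<Longrightarrow> bas c = bas c' \<Longrightarrow> snd c' < rk (fst c') \<Longrightarrow> c = c'"
  using coord_bas[of c c] coord_bas[of c' c] by (simp split: if_splits)

text \<open>Distinct indices give distinct basis words, so each coefficient of a normal form is a
  single coordinate.\<close>

lemma lookup_nf:
  assumes "valid k" "w \<in> words G"
  shows "lookup (nf w) (basis_letters k) = coef K k (iota (frag_of w))"
  using assms
proof (induction k arbitrary: w)
  case Nil
  then show ?case by (cases w) (simp_all add: basis_letters_def coef_word_simps lookup_sum lookup_prefix)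
next
  case (Cons c k)
  show ?case
  proof (cases w)
    case Nil then show ?thesis by (simp add: basis_letters_def coef_word_simps)
  next
    case (Cons x w')
    have c: "0 < fst c" "snd c < rk (fst c)" "valid k" using Cons.prems(1) by (auto simp: valid_def)
    have w': "w' \<in> words G" "good x" using Cons.prems(2) Cons by (auto simp: good_def)
    have "lookup (nf w) (basis_letters (c # k)) =
      (\<Sum>i<rk (fst x). coord (fst x, i) (snd x) * (if (fst c, bas c) = (fst x, bas (fst x, i))
        then lookup (nf w') (basis_letters k) else 0))"
      by (simp add: Cons lookup_sum lookup_prefix basis_letters_Cons)
    also have "\<dots> = (\<Sum>i<rk (fst x). if c = (fst x, i) then coord c (snd x) * coef K k (iota (frag_of w')) else 0)"
    proof (rule sum.cong)
      fix i assume i: "i \<in> {..<rk (fst x)}"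
      have "(fst c, bas c) = (fst x, bas (fst x, i)) \<longleftrightarrow> c = (fst x, i)"
        using bas_inj[OF c(2), of "(fst x, i)"] i by auto
      then show "coord (fst x, i) (snd x) * (if (fst c, bas c) = (fst x, bas (fst x, i))
        then lookup (nf w') (basis_letters k) else 0) =
        (if c = (fst x, i) then coord c (snd x) * coef K k (iota (frag_of w')) else 0)"
        using Cons.IH[OF c(3) w'(1)] by auto
    qed simp
    also have "\<dots> = coord c (snd x) * coef K k (iota (frag_of w'))"
    proof (cases "fst c = fst x")
      case True
      then have "c = (fst x, i) \<longleftrightarrow> i = snd c" for i by (cases c) auto
      then show ?thesis using c(2) True by simp
    next
      case False
      then have "coord c (snd x) = 0" using coord_other[of "snd x" "fst x" c] w'(2) by (auto simp: good_def)
      moreover have "c \<noteq> (fst x, i)" for i using False by auto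
      ultimately show ?thesis by simp
    qed
    also have "\<dots> = coef K (c # k) (iota (frag_of w))"
      by (simp add: Cons coef_word_simps K_single w'(2))
    finally show ?thesis .
  qed
qed

lemma lookup_nf_other:
  assumes "w \<in> words G" "lookup (nf w) v \<noteq> 0"
  shows "\<exists>k. valid k \<and> v = basis_letters k"
  using assms
proof (induction w arbitrary: v)
  case Nil
  then show ?case by (intro exI[of _ "[]"]) (auto simp: valid_def basis_letters_def lookup_single when_def split: if_splits)
next
  case (Cons x w)
  have "(\<Sum>i<rk (fst x). coord (fst x, i) (snd x) * lookup (prefix (fst x, bas (fst x, i)) (nf w)) v) \<noteq> 0"
    using Cons.prems(2) by (simp add: lookup_sum)
  then obtain i where i: "i < rk (fst x)" "lookup (prefix (fst x, bas (fst x, i)) (nf w)) v \<noteq> 0"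
    by (metis (no_types, lifting) lessThan_iff mult_zero_right sum.neutral)
  then obtain v' where v: "v = (fst x, bas (fst x, i)) # v'" "lookup (nf w) v' \<noteq> 0"
    by (cases v) (auto simp: lookup_prefix split: if_splits)
  then obtain k where "valid k" "v' = basis_letters k" using Cons by auto
  then show ?case using v i Cons.prems(1)
    by (intro exI[of _ "(fst x, i) # k"]) (auto simp: valid_def basis_letters_def)
qed

text \<open>Modulo \<open>TR\<close> an element equals its normal form, whose coefficients are the
  values of the \<open>coef K k\<close>; when these vanish, so does the normal form.\<close>

lemma TR_iff: "f \<in> TR \<longleftrightarrow> f \<in> carrier WR \<and> iota f \<in> null"
proof (intro iffI conjI)
  assume f: "f \<in> carrier WR \<and> iota f \<in> null"
  then have k: "keys f \<subseteq> words G" by (simp add: carrier_WR)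
  have 1: "f - frag_extend nf f \<in> TR"
    using k
  proof (induction f rule: frag_induction)
    case (diff a b)
    from TR_diff[OF diff] show ?case by (simp add: frag_extend_diff algebra_simps)
  qed (simp_all add: nf_TR)
  have 2: "lookup (frag_extend nf f) (basis_letters l) = coef K l (iota f)" if "valid l" for l
    using k
  proof (induction f rule: frag_induction)
    case (one w) then show ?case using lookup_nf[OF that] by simp
  next
    case (diff a b)
    then show ?case by (simp add: frag_extend_diff lookup_minus iota_diff additive.diff[OF coef_additive])
  qed (simp add: additive.zero[OF coef_additive])
  have 3: "lookup (frag_extend nf f) v = 0" if "\<nexists>l. valid l \<and> v = basis_letters l" for v
    using k
  proof (induction f rule: frag_induction)
    case (one w) then show ?case using lookup_nf_other[of w v] that by auto
  qed (simp_all add: frag_extend_diff lookup_minus)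
  have "frag_extend nf f = 0"
    using 2 3 f by (intro poly_mapping_eqI) (metis null_iff lookup_zero)
  then show "f \<in> TR" using 1 by simp
qed (auto simp: TR_carrier iota_TR)

text \<open>Up to \<open>null\<close>, a formal product may be replaced by the single letter
  carrying its degree and value.\<close>

lemma iota_surj: "\<exists>f\<in>carrier WR. iota f - x \<in> null"
proof (induction x rule: qsh_induct)
  case zero then show ?case by (intro bexI[of _ 0]) (auto simp: carrier_WR)
next
  case (word w)
  show ?case
  proof (cases "\<exists>m\<in>set w. ev m = \<zero>")
    case True
    then obtain i where i: "i < length w" "ev (w ! i) = \<zero>" by (auto simp: in_set_conv_nth)
    have "coef K k (word w) = 0" for k using i by (auto simp: coef_word K_def intro!: bexI[of _ i])
    then have "- word w \<in> null" by (intro null_uminus) (simp add: null_iff)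
    then show ?thesis by (intro bexI[of _ 0]) (auto simp: carrier_WR)
  next
    case False
    let ?w = "map (\<lambda>m. (dg m, ev m)) w"
    have g: "good (dg m, ev m)" if "m \<in> set w" for m using that False ev_cases[of m] by (auto simp: good_def)
    have "K c (single_nemset (dg m, ev m)) = K c m" if "m \<in> set w" for c m
      using K_single[OF g[OF that]] by (simp add: K_def)
    then have "coef K k (word (map single_nemset ?w)) = coef K k (word w)" for k
      unfolding coef_word by (auto intro!: prod.cong)
    then have "iota (frag_of ?w) - word w \<in> null" by (simp add: null_iff additive.diff[OF coef_additive])
    moreover have "?w \<in> words G" using g by (auto simp: good_words)
    ultimately show ?thesis by (intro bexI[of _ "frag_of ?w"]) auto
  qed
next
  case (diff x y)
  then obtain f g where fg: "f \<in> carrier WR" "g \<in> carrier WR" "iota f - x \<in> null" "iota g - y \<in> null" by blast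
  then show ?case using null_diff[OF fg(3,4)]
    by (intro bexI[of _ "f - g"]) (auto simp: iota_diff WR_diff algebra_simps)
qed

lemma foldr_letters:
  "\<forall>x\<in>set xs. good x \<Longrightarrow> foldr (\<lambda>x y. snd x \<otimes> y) xs \<one> \<in> G (word_degree xs)"
proof (induction xs)
  case Nil then show ?case by (simp add: word_degree_def one_grade)
next
  case (Cons x xs)
  then show ?case using mult_grade[of "snd x" "fst x"] by (simp add: word_degree_def good_def)
qed

lemma letter_prod_good:
  assumes "\<forall>x\<in>set xs. good x" "xs \<noteq> []"
  shows "good (letter_prod A xs)"
proof -
  have "0 < word_degree xs" using assms by (cases xs) (auto simp: word_degree_def good_def)
  then show ?thesis using foldr_letters[OF assms(1)] by (simp add: good_def letter_prod_def)
qed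

lemma ev_nonempty_sum:
  "\<forall>x\<in>set xs. good x \<Longrightarrow> xs \<noteq> [] \<Longrightarrow> ev (nonempty_sum (map single_nemset xs)) = snd (letter_prod A xs)"
proof (induction xs rule: induct_list012)
  case (2 x)
  then show ?case using G_sub by (auto simp: ev_single letter_prod_def good_def)
next
  case (3 x y xs)
  then show ?case by (simp add: ev_add ev_single letter_prod_def)
qed simp

lemma foldr_zero:
  "\<forall>x\<in>set xs. good x \<Longrightarrow> \<exists>x\<in>set xs. snd x = \<zero> \<Longrightarrow> foldr (\<lambda>x y. snd x \<otimes> y) xs \<one> = \<zero>"
proof (induction xs)
  case (Cons x xs)
  have c: "foldr (\<lambda>x y. snd x \<otimes> y) xs \<one> \<in> carrier A" "snd x \<in> carrier A"
    using foldr_letters[of xs] Cons.prems(1) G_sub by (auto simp: good_def)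
  then show ?case using Cons by (cases "snd x = \<zero>") simp_all
qed simp

context
  fixes u v :: "'a word" and \<alpha> \<beta> n
  assumes u: "u \<in> words G" and v: "v \<in> words G" and qs: "(\<alpha>, \<beta>) \<in> quasi_shuffles (length u) (length v) n"
begin

lemma fibres_good: "\<forall>x\<in>set (fibre u \<alpha> i @ fibre v \<beta> i). good x"
  using u v by (auto simp: fibre_def good_words)

lemma fibres_nonempty: "i < n \<Longrightarrow> fibre u \<alpha> i @ fibre v \<beta> i \<noteq> []"
proof -
  assume "i < n"
  then have "i \<in> \<alpha> ` {..<length u} \<or> i \<in> \<beta> ` {..<length v}" using qs by (auto simp: quasi_shuffles_def)
  then show ?thesis by (auto simp: fibre_def filter_empty_conv)
qed

lemma collapse_eq:
  "collapse A (u @ v) (glue (length u) \<alpha> \<beta>) n = map (\<lambda>i. letter_prod A (fibre u \<alpha> i @ fibre v \<beta> i)) [0..<n]"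
  unfolding collapse_def fibre_append_glue ..

lemma collapse_words: "collapse A (u @ v) (glue (length u) \<alpha> \<beta>) n \<in> words G"
  unfolding good_words collapse_eq using letter_prod_good[OF fibres_good fibres_nonempty] by auto

text \<open>The Koszul sign is harmless: a letter of odd degree is \<zero>, so a word with such a
  letter collapses to one on which all coordinates vanish; otherwise the sign is 1.\<close>

lemma coef_collapse:
  "coef K k (iota (frag_cmul (koszul_sign (u @ v) (glue (length u) \<alpha> \<beta>))
      (frag_of (collapse A (u @ v) (glue (length u) \<alpha> \<beta>) n)))) =
   coef K k (word (qs_letters (map single_nemset u) (map single_nemset v) \<alpha> \<beta> n))"
proof -
  let ?xs = "\<lambda>i. fibre u \<alpha> i @ fibre v \<beta> i"
  let ?\<gamma> = "glue (length u) \<alpha> \<beta>"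
  have Keq: "K c (single_nemset (letter_prod A (?xs i))) = K c (nonempty_sum (map single_nemset (?xs i)))" if "i < n" for c i
    using ev_nonempty_sum[OF fibres_good fibres_nonempty[OF that]] letter_prod_good[OF fibres_good fibres_nonempty[OF that]]
    by (simp add: K_single) (simp add: K_def)
  have eq: "coef K k (word (map single_nemset (collapse A (u @ v) ?\<gamma> n))) =
     coef K k (word (qs_letters (map single_nemset u) (map single_nemset v) \<alpha> \<beta> n))"
    unfolding coef_word collapse_eq qs_letters_def
    by (auto intro!: prod.cong simp: Keq fibre_map)
  have "koszul_sign (u @ v) ?\<gamma> = 1 \<or> coef K k (word (map single_nemset (collapse A (u @ v) ?\<gamma> n))) = 0"
  proof (cases "\<forall>x\<in>set (u @ v). even (fst x)")
    case True
    have "koszul_sign (u @ v) ?\<gamma> = 1"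
      unfolding koszul_sign_def
    proof (rule prod.neutral, clarify)
      fix j l assume "j < l" "l < length (u @ v)"
      then have "(u @ v) ! j \<in> set (u @ v)" by (intro nth_mem) simp
      then have "even (fst ((u @ v) ! j))" using True by blast
      then show "(-1 :: int) ^ (fst ((u @ v) ! j) * fst ((u @ v) ! l)) = 1" by simp
    qed
    then show ?thesis ..
  next
    case False
    then obtain j where j: "j < length (u @ v)" "odd (fst ((u @ v) ! j))" by (metis in_set_conv_nth)
    have gj: "good ((u @ v) ! j)" using u v nth_mem[OF j(1)] by (auto simp: good_words)
    then have z: "snd ((u @ v) ! j) = \<zero>" using G_odd[OF j(2)] by (simp add: good_def)
    define i where "i = ?\<gamma> j"
    have i: "i < n"
      using qs j(1) by (auto simp: i_def glue_def quasi_shuffles_def PiE_iff)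
    have "j \<in> set (filter (\<lambda>j. ?\<gamma> j = i) [0..<length (u @ v)])" using j(1) by (simp add: i_def)
    then have "(u @ v) ! j \<in> set (?xs i)" unfolding fibre_append_glue[symmetric] by auto
    then have "snd (letter_prod A (?xs i)) = \<zero>"
      using foldr_zero[OF fibres_good] z unfolding letter_prod_def snd_conv by blast
    then have zK: "K c (single_nemset (letter_prod A (?xs i))) = 0" for c
      using letter_prod_good[OF fibres_good fibres_nonempty[OF i]] by (simp add: K_single)
    have "coef K k (word (map single_nemset (collapse A (u @ v) ?\<gamma> n))) = 0"
      unfolding coef_word collapse_eq using i zK[of "k ! i"] by (auto intro!: bexI[of _ i])
    then show ?thesis ..
  qed
  then show ?thesis using eq by (auto simp: iota_frag_cmul coef_of_int)
qed

end

lemma word_mult_WR: 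
  assumes "u \<in> words G" "v \<in> words G"
  shows "word_mult A u v \<in> carrier WR"
  unfolding word_mult_def
  by (intro WR_sum) (auto intro!: WR_sum WR_frag_cmul simp: collapse_words[OF assms])

lemma iota_word_mult:
  assumes "u \<in> words G" "v \<in> words G"
  shows "iota (word_mult A u v) - iota (frag_of u) * iota (frag_of v) \<in> null"
proof -
  have "coef K k (iota (word_mult A u v)) = coef K k (iota (frag_of u) * iota (frag_of v))" for k
  proof -
    let ?u = "map single_nemset u" and ?v = "map single_nemset v"
    have "coef K k (iota (word_mult A u v)) = (\<Sum>n\<le>length u + length v. \<Sum>(\<alpha>, \<beta>)\<in>quasi_shuffles (length u) (length v) n.
        coef K k (word (qs_letters ?u ?v \<alpha> \<beta> n)))"
      unfolding word_mult_def iota_sum coef_sum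
      by (intro sum.cong refl) (auto simp: coef_collapse[OF assms])
    also have "\<dots> = coef K k (\<Sum>n\<le>length u + length v. qs_sum ?u ?v n)"
      by (simp add: coef_sum qs_sum_def case_prod_beta)
    also have "(\<Sum>n\<le>length u + length v. qs_sum ?u ?v n) = word ?u * word ?v"
      by (rule sum_qs_sum) simp
    finally show ?thesis by simp
  qed
  then show ?thesis by (simp add: null_iff additive.diff[OF coef_additive])
qed

lemma WR_mult: "f \<otimes>\<^bsub>WR\<^esub> g = frag_extend (\<lambda>u. frag_extend (word_mult A u) g) f"
  by (simp add: word_ring_def)

lemma iota_mult:
  assumes "f \<in> carrier WR" "g \<in> carrier WR"
  shows "f \<otimes>\<^bsub>WR\<^esub> g \<in> carrier WR \<and> iota (f \<otimes>\<^bsub>WR\<^esub> g) - iota f * iota g \<in> null"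
proof -
  have kf: "keys f \<subseteq> words G" and kg: "keys g \<subseteq> words G" using assms by (auto simp: carrier_WR)
  have 1: "frag_extend (word_mult A u) g \<in> carrier WR \<and>
      iota (frag_extend (word_mult A u) g) - iota (frag_of u) * iota g \<in> null" if u: "u \<in> words G" for u
    using kg
  proof (induction g rule: frag_induction)
    case (one v) then show ?case using iota_word_mult[OF u] word_mult_WR[OF u] by simp
  next
    case (diff a b)
    let ?M = "frag_extend (word_mult A u)" and ?u = "iota (frag_of u)"
    have eq: "iota (?M (a - b)) - ?u * iota (a - b) = (iota (?M a) - ?u * iota a) - (iota (?M b) - ?u * iota b)"
      by (simp add: frag_extend_diff iota_diff right_diff_distrib)
    show ?case
    proof
      show "?M (a - b) \<in> carrier WR" unfolding frag_extend_diff using diff by (blast intro: WR_diff)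
      show "iota (?M (a - b)) - ?u * iota (a - b) \<in> null" unfolding eq using diff by (blast intro: null_diff)
    qed
  qed (simp add: carrier_WR)
  show ?thesis
    unfolding WR_mult using kf
  proof (induction f rule: frag_induction)
    case (one u) then show ?case using 1 by simp
  next
    case (diff a b)
    let ?M = "frag_extend (\<lambda>u. frag_extend (word_mult A u) g)"
    have eq: "iota (?M (a - b)) - iota (a - b) * iota g = (iota (?M a) - iota a * iota g) - (iota (?M b) - iota b * iota g)"
      by (simp add: frag_extend_diff iota_diff left_diff_distrib)
    show ?case
    proof
      show "?M (a - b) \<in> carrier WR" unfolding frag_extend_diff using diff by (blast intro: WR_diff)
      show "iota (?M (a - b)) - iota (a - b) * iota g \<in> null" unfolding eq using diff by (blast intro: null_diff)
    qed
  qed (simp add: carrier_WR)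
qed

text \<open>The coset of \<open>TR\<close> represented by x; by \<open>iota_surj\<close> and
  \<open>TR_iff\<close> this identifies the quotient of \<open>qsh\<close> by \<open>null\<close>
  with J(A).\<close>

definition proj :: "(nat \<times> 'a) nemset qsh \<Rightarrow> ('a word \<Rightarrow>\<^sub>0 int) set" where
  "proj x = {f \<in> carrier WR. iota f - x \<in> null}"

lemma proj_eq_iff: "proj x = proj y \<longleftrightarrow> x - y \<in> null"
proof
  assume eq: "proj x = proj y"
  obtain f where f: "f \<in> carrier WR" "iota f - x \<in> null" using iota_surj by blast
  then have "f \<in> proj y" using eq by (auto simp: proj_def)
  then have "iota f - y \<in> null" by (simp add: proj_def)
  from null_diff[OF this f(2)] show "x - y \<in> null" by simp
next
  assume xy: "x - y \<in> null"
  have "iota f - x \<in> null \<longleftrightarrow> iota f - y \<in> null" for f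
    using null_trans[of "iota f" x y] null_trans[of "iota f" y x] xy null_sym[OF xy] by blast
  then show "proj x = proj y" by (simp add: proj_def)
qed

lemma proj_coset:
  assumes "f \<in> carrier WR"
  shows "TR +>\<^bsub>WR\<^esub> f = proj (iota f)"
proof -
  have "TR +>\<^bsub>WR\<^esub> f = {h + f |h. h \<in> TR}"
    by (auto simp: a_r_coset_def r_coset_def WR_plus)
  also have "\<dots> = proj (iota f)"
  proof (intro equalityI subsetI)
    fix g assume "g \<in> proj (iota f)"
    then have "g - f \<in> TR" using assms by (simp add: TR_iff proj_def WR_diff iota_diff)
    then show "g \<in> {h + f |h. h \<in> TR}" by (auto intro!: exI[of _ "g - f"])
  next
    fix g assume "g \<in> {h + f |h. h \<in> TR}"
    then obtain h where "h \<in> TR" "g = h + f" by blast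
    then show "g \<in> proj (iota f)" using assms by (simp add: TR_iff proj_def WR_add iota_add)
  qed
  finally show ?thesis .
qed

lemma proj_repr: obtains f where "f \<in> carrier WR" "iota f - x \<in> null" "proj x = TR +>\<^bsub>WR\<^esub> f"
proof -
  obtain f where f: "f \<in> carrier WR" "iota f - x \<in> null" using iota_surj by blast
  then have "proj x = TR +>\<^bsub>WR\<^esub> f" using proj_eq_iff[of "iota f" x] proj_coset[OF f(1)] by simp
  with f show thesis by (rule that)
qed

lemma carrier_J: "carrier (J_ring A G) = range proj"
proof -
  have "carrier (J_ring A G) = {TR +>\<^bsub>WR\<^esub> f |f. f \<in> carrier WR}"
    by (auto simp: J_ring_def FactRing_def A_RCOSETS_def RCOSETS_def a_r_coset_def)
  also have "\<dots> = range proj"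
  proof (intro equalityI subsetI)
    fix y assume "y \<in> range proj"
    then obtain x where "y = proj x" by blast
    then show "y \<in> {TR +>\<^bsub>WR\<^esub> f |f. f \<in> carrier WR}" by (metis (mono_tags, lifting) mem_Collect_eq proj_repr)
  qed (auto simp: proj_coset)
  finally show ?thesis .
qed

lemma proj_add: "proj x \<oplus>\<^bsub>J_ring A G\<^esub> proj y = proj (x + y)"
proof -
  have "proj x \<oplus>\<^bsub>J_ring A G\<^esub> proj y = {f + g |f g. f \<in> proj x \<and> g \<in> proj y}"
    by (auto simp: J_ring_def FactRing_def set_add_def set_mult_def WR_plus)
  also have "\<dots> = proj (x + y)"
  proof (intro equalityI subsetI)
    fix h assume "h \<in> {f + g |f g. f \<in> proj x \<and> g \<in> proj y}"
    then obtain f g where fg: "h = f + g" "f \<in> proj x" "g \<in> proj y" by blast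
    then have "(iota f - x) + (iota g - y) \<in> null" by (intro null_add) (auto simp: proj_def)
    then show "h \<in> proj (x + y)" using fg by (simp add: proj_def WR_add iota_add algebra_simps)
  next
    fix h assume h: "h \<in> proj (x + y)"
    obtain f where f: "f \<in> carrier WR" "iota f - x \<in> null" using iota_surj by blast
    have "iota h - (x + y) \<in> null" using h by (simp add: proj_def)
    from null_diff[OF this f(2)] have "h - f \<in> proj y" using h f by (simp add: proj_def WR_diff iota_diff algebra_simps)
    moreover have "f \<in> proj x" using f by (simp add: proj_def)
    ultimately show "h \<in> {f + g |f g. f \<in> proj x \<and> g \<in> proj y}"
      by (intro CollectI exI[of _ f] exI[of _ "h - f"]) simp
  qed
  finally show ?thesis .
qed

lemma proj_one: "\<one>\<^bsub>J_ring A G\<^esub> = proj 1"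
  using proj_coset[of "frag_of []"] by (simp add: J_ring_def FactRing_def word_ring_def word_Nil carrier_WR)

lemma proj_mult: "proj x \<otimes>\<^bsub>J_ring A G\<^esub> proj y = proj (x * y)"
proof -
  have c: "TR +>\<^bsub>WR\<^esub> (f \<otimes>\<^bsub>WR\<^esub> g) = proj (x * y)" if "f \<in> proj x" "g \<in> proj y" for f g
  proof -
    have fg: "f \<in> carrier WR" "g \<in> carrier WR" "iota f - x \<in> null" "iota g - y \<in> null" using that by (auto simp: proj_def)
    have "(iota (f \<otimes>\<^bsub>WR\<^esub> g) - iota f * iota g) + ((iota f - x) * iota g + (iota g - y) * x) \<in> null"
      using iota_mult[OF fg(1,2)] fg(3,4) coef_mult_null by (intro null_add) (auto simp: null_iff)
    then have "iota (f \<otimes>\<^bsub>WR\<^esub> g) - x * y \<in> null" by (simp add: algebra_simps)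
    then show ?thesis using proj_coset[of "f \<otimes>\<^bsub>WR\<^esub> g"] iota_mult[OF fg(1,2)] by (simp add: proj_eq_iff)
  qed
  have "\<exists>f. f \<in> proj x" for x using iota_surj[of x] by (auto simp: proj_def)
  then obtain f g where fg: "f \<in> proj x" "g \<in> proj y" by blast
  have "proj x \<otimes>\<^bsub>J_ring A G\<^esub> proj y = (\<Union>f\<in>proj x. \<Union>g\<in>proj y. TR +>\<^bsub>WR\<^esub> (f \<otimes>\<^bsub>WR\<^esub> g))"
    by (simp add: J_ring_def FactRing_def rcoset_mult_def)
  also have "\<dots> = (\<Union>f\<in>proj x. \<Union>g\<in>proj y. proj (x * y))" using c by simp
  also have "\<dots> = proj (x * y)" using fg by blast
  finally show ?thesis .
qed

lemma wdeg_single: "wdeg (map single_nemset w) = word_degree w"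
  by (induction w) (simp_all add: wdeg_def word_degree_def)

lemma iota_grade:
  assumes "\<And>w. w \<in> keys f \<Longrightarrow> word_degree w = n"
  shows "iota f \<in> grade n"
proof -
  have "word (map single_nemset w) \<in> grade n" if "w \<in> keys f" for w
    using word_null_or_grade[of "map single_nemset w"] assms[OF that] null_grade by (auto simp: wdeg_single)
  then show ?thesis unfolding iota_def int_extend_def by (intro grade_sum grade_of_int)
qed

lemma J_grade_eq: "J_grade A G n = proj ` grade n"
proof (intro equalityI subsetI)
  fix y assume "y \<in> J_grade A G n"
  then obtain f where "f \<in> carrier WR" "\<And>w. w \<in> keys f \<Longrightarrow> word_degree w = n" "y = TR +>\<^bsub>WR\<^esub> f"
    by (auto simp: J_grade_def)
  then show "y \<in> proj ` grade n" using proj_coset iota_grade by auto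
next
  fix y assume "y \<in> proj ` grade n"
  then obtain x where x: "x \<in> grade n" "y = proj x" by blast
  obtain f where f: "f \<in> carrier WR" "iota f - x \<in> null" using iota_surj by blast
  \<comment> \<open>Discarding words of other degrees leaves the coordinates of degree n untouched,
    and x has no others.\<close>
  define g where "g = frag_extend (\<lambda>w. if word_degree w = n then frag_of w else 0) f"
  have keys_g: "w \<in> keys f \<and> word_degree w = n" if "w \<in> keys g" for w
    using subsetD[OF keys_frag_extend that[unfolded g_def]] by (auto split: if_splits)
  have gW: "g \<in> carrier WR" using keys_g f(1) by (auto simp: carrier_WR)
  have g_grade: "iota g \<in> grade n" using keys_g by (intro iota_grade) auto
  have "coef K k (iota (f - g)) = 0" if "kdeg k = n" for k
  proof -
    have "coef K k (iota f) = coef K k (iota g)"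
      unfolding g_def using f(1)[unfolded carrier_WR]
    proof (induction f rule: frag_induction)
      case (one w)
      show ?case
      proof (cases "word_degree w = n")
        case False
        have "word (map single_nemset w) \<in> grade (word_degree w)"
          using word_null_or_grade[of "map single_nemset w"] null_grade by (auto simp: wdeg_single)
        then show ?thesis using False that by (simp add: grade_iff additive.zero[OF coef_additive])
      qed simp
    next
      case (diff a b)
      then show ?case by (simp add: frag_extend_diff iota_diff additive.diff[OF coef_additive])
    qed simp
    then show ?thesis by (simp add: iota_diff additive.diff[OF coef_additive])
  qed
  moreover have "coef K k (iota g - x) = 0" if "kdeg k \<noteq> n" for k
    using grade_diff[OF g_grade x(1)] that by (simp add: grade_iff)
  moreover have "coef K k (iota f - x) = 0" for k using f(2) by (simp add: null_iff)
  ultimately have "coef K k (iota g - x) = 0" for k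
    by (cases "kdeg k = n") (auto simp: iota_diff additive.diff[OF coef_additive])
  then have "iota g - x \<in> null" by (simp add: null_iff)
  then have "y = TR +>\<^bsub>WR\<^esub> g" using x(2) proj_coset[OF gW] proj_eq_iff by metis
  then show "y \<in> J_grade A G n" using gW keys_g by (auto simp: J_grade_def)
qed

end

lemma carrier_int_mpoly_ring: "carrier (int_mpoly_ring I) = poly_over I"
  by (simp add: int_mpoly_ring_def poly_over_def)

lemma int_mpoly_ring_simps:
  "f \<otimes>\<^bsub>int_mpoly_ring I\<^esub> g = f * g" "f \<oplus>\<^bsub>int_mpoly_ring I\<^esub> g = f + g" "\<one>\<^bsub>int_mpoly_ring I\<^esub> = 1"
  by (simp_all add: int_mpoly_ring_def)

section \<open>Reduced rings give polynomial rings\<close>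

context reduced_graded_ring
begin

lemma eval_mono_grade:
  assumes "\<And>i. i \<in> keys m \<Longrightarrow> e i \<in> grade (d i)"
  shows "eval_mono e m \<in> grade (monom_degree d m)"
proof -
  have power: "x ^ k \<in> grade (k * n)" if "x \<in> grade n" for x k n
    by (induction k) (use grade_one that grade_mult in auto)
  have "(\<Prod>i\<in>S. e i ^ lookup m i) \<in> grade (\<Sum>i\<in>S. lookup m i * d i)"
    if "finite S" "S \<subseteq> keys m" for S
    using that
  proof (induction S)
    case (insert i S)
    then show ?case using grade_mult[OF power[OF assms]] by simp
  qed (simp add: grade_one)
  from this[of "keys m"] show ?thesis by (simp add: eval_mono_def monom_degree_def)
qed

lemma polynomial_J_ring: "polynomial_graded_ring (J_ring A G) (J_grade A G)"
proof -
  have lab: "x - y \<in> null" if "proj x = proj y" for x y using that by (simp add: proj_eq_iff)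
  show ?thesis
  \<comment> \<open>Cosets serve as names of the variables, since the definition draws variables
    from the element type of the ring.\<close>
  proof (rule polynomial_generators[of proj, OF lab])
    fix I :: "('a word \<Rightarrow>\<^sub>0 int) set set" and d e
    assume d: "\<And>i. i \<in> I \<Longrightarrow> 0 < d i" and e: "\<And>i. i \<in> I \<Longrightarrow> e i \<in> grade (d i)"
      and inj: "\<And>f. f \<in> poly_over I \<Longrightarrow> poly_eval e f \<in> null \<Longrightarrow> f = 0"
      and surj: "\<And>x. \<exists>f\<in>poly_over I. x - poly_eval e f \<in> null"
    define \<phi> where "\<phi> f = proj (poly_eval e f)" for f
    have mono: "eval_mono e m \<in> grade (monom_degree d m)" if "keys m \<subseteq> I" for m
      using that e by (intro eval_mono_grade) auto
    have hom: "\<phi> \<in> ring_hom (int_mpoly_ring I) (J_ring A G)"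
    proof (rule ring_hom_memI)
      show "\<phi> f \<in> carrier (J_ring A G)" for f by (simp add: \<phi>_def carrier_J)
      show "\<phi> (f \<otimes>\<^bsub>int_mpoly_ring I\<^esub> g) = \<phi> f \<otimes>\<^bsub>J_ring A G\<^esub> \<phi> g" for f g
        unfolding int_mpoly_ring_simps \<phi>_def proj_mult poly_eval_mult ..
      show "\<phi> (f \<oplus>\<^bsub>int_mpoly_ring I\<^esub> g) = \<phi> f \<oplus>\<^bsub>J_ring A G\<^esub> \<phi> g" for f g
        unfolding int_mpoly_ring_simps \<phi>_def proj_add poly_eval_add ..
      show "\<phi> \<one>\<^bsub>int_mpoly_ring I\<^esub> = \<one>\<^bsub>J_ring A G\<^esub>"
        unfolding int_mpoly_ring_simps \<phi>_def proj_one poly_eval_1 ..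
    qed
    have "inj_on \<phi> (poly_over I)"
    proof (rule inj_onI)
      fix f g assume fg: "f \<in> poly_over I" "g \<in> poly_over I" "\<phi> f = \<phi> g"
      then have "poly_eval e (f - g) \<in> null" by (simp add: \<phi>_def proj_eq_iff poly_eval_diff)
      then show "f = g" using inj[OF poly_over_diff[OF fg(1,2)]] by simp
    qed
    moreover have "\<phi> ` poly_over I = range proj"
    proof (intro equalityI subsetI)
      fix y assume "y \<in> range proj"
      then obtain x where x: "y = proj x" by blast
      obtain f where f: "f \<in> poly_over I" "x - poly_eval e f \<in> null" using surj by blast
      then show "y \<in> \<phi> ` poly_over I" using x by (auto simp: \<phi>_def proj_eq_iff)
    qed (auto simp: \<phi>_def)
    ultimately have iso: "\<phi> \<in> ring_iso (int_mpoly_ring I) (J_ring A G)"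
      using hom by (simp add: ring_iso_def bij_betw_def carrier_int_mpoly_ring carrier_J)
    have eval_grade: "poly_eval e f \<in> grade n"
      if "f \<in> poly_over I" "\<And>m. m \<in> keys f \<Longrightarrow> monom_degree d m = n" for f n
      unfolding poly_eval_def int_extend_def
    proof (intro grade_sum grade_of_int)
      fix m assume m: "m \<in> keys f"
      then have "keys m \<subseteq> I" using that(1) by (auto simp: poly_over_def)
      from mono[OF this] show "eval_mono e m \<in> grade n" by (simp add: that(2)[OF m])
    qed
    have "\<phi> ` int_mpoly_grade I d n = J_grade A G n" for n
      unfolding J_grade_eq
    proof (intro equalityI subsetI)
      fix y assume "y \<in> \<phi> ` int_mpoly_grade I d n"
      then obtain f where f: "f \<in> poly_over I" "\<And>m. m \<in> keys f \<Longrightarrow> monom_degree d m = n" "y = \<phi> f"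
        by (auto simp: int_mpoly_grade_def carrier_int_mpoly_ring)
      then show "y \<in> proj ` grade n" using eval_grade[of f n] by (auto simp: \<phi>_def)
    next
      fix y assume "y \<in> proj ` grade n"
      then obtain x where x: "x \<in> grade n" "y = proj x" by blast
      obtain f where f: "f \<in> poly_over I" "x - poly_eval e f \<in> null" using surj by blast
      \<comment> \<open>Monomials of other degrees evaluate into other degrees, so the part of f in
        degree n already represents x.\<close>
      define g where "g = frag_extend (\<lambda>m. if monom_degree d m = n then frag_of m else 0) f"
      have keys_g: "m \<in> keys f \<and> monom_degree d m = n" if "m \<in> keys g" for m
        using subsetD[OF keys_frag_extend that[unfolded g_def]] by (auto split: if_splits)
      have g: "g \<in> poly_over I" using keys_g f(1) by (auto simp: poly_over_def)
      have g_grade: "poly_eval e g \<in> grade n" using keys_g g by (intro eval_grade) auto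
      have low: "coef K k (poly_eval e f) = coef K k (poly_eval e g)" if k: "kdeg k = n" for k
        unfolding g_def using f(1)[unfolded poly_over_def mem_Collect_eq Ball_Collect]
      proof (induction f rule: frag_induction)
        case (one m)
        then have "eval_mono e m \<in> grade (monom_degree d m)" by (intro mono) simp
        then show ?case using k by (auto simp: grade_iff additive.zero[OF coef_additive])
      next
        case (diff a b)
        then show ?case by (simp add: frag_extend_diff poly_eval_diff additive.diff[OF coef_additive])
      qed simp
      have "coef K k (x - poly_eval e g) = 0" for k
      proof (cases "kdeg k = n")
        case True
        have "coef K k (x - poly_eval e f) = 0" using f(2) by (simp add: null_iff)
        then show ?thesis using low[OF True] by (simp add: additive.diff[OF coef_additive])
      next
        case False
        then show ?thesis using grade_diff[OF x(1) g_grade] by (simp add: grade_iff)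
      qed
      then have "y = \<phi> g" using x(2) by (simp add: \<phi>_def proj_eq_iff null_iff)
      then show "y \<in> \<phi> ` int_mpoly_grade I d n"
        using g keys_g by (auto simp: int_mpoly_grade_def carrier_int_mpoly_ring)
    qed
    then show ?thesis using iso d unfolding polynomial_graded_ring_def by blast
  qed
qed

end

section \<open>Polynomial rings are reduced modulo every prime\<close>

lemma of_nat_dvd_poly_iff:
  fixes f :: "('i \<Rightarrow>\<^sub>0 nat) \<Rightarrow>\<^sub>0 int"
  shows "of_nat p dvd f \<longleftrightarrow> (\<forall>m. int p dvd lookup f m)"
proof
  assume "of_nat p dvd f"
  then obtain g where "f = of_nat p * g" by auto
  then have "f = frag_cmul (int p) g" by (simp add: frag_cmul_eq_of_int_mult)
  then show "\<forall>m. int p dvd lookup f m" by simp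
next
  assume "\<forall>m. int p dvd lookup f m"
  then obtain g where "f = frag_cmul (int p) g" using frag_dvdE[of "int p" f] by auto
  then show "of_nat p dvd f" by (simp add: frag_cmul_eq_of_int_mult)
qed

text \<open>Modulo p the power is the sum of the p-th powers of the terms, and no cancellation
  occurs, because distinct monomials have distinct p-th powers.\<close>

lemma prime_dvd_poly_power:
  fixes f :: "('i \<Rightarrow>\<^sub>0 nat) \<Rightarrow>\<^sub>0 int"
  assumes p: "Factorial_Ring.prime p" and dvd: "of_nat p dvd f ^ p"
  shows "of_nat p dvd f"
proof -
  have p0: "p > 0" by (rule prime_gt_0_nat[OF p])
  define q where "q m = Poly_Mapping.map (\<lambda>k. p * k) m" for m :: "'i \<Rightarrow>\<^sub>0 nat"
  have lookup_q: "lookup (q m) i = p * lookup m i" for m i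
    by (simp add: q_def map.rep_eq when_def)
  have q_inj: "q m = q n \<longleftrightarrow> m = n" for m n
    using p0 lookup_q by (auto intro!: poly_mapping_eqI) (metis mult_left_cancel not_gr_zero)
  have power: "frag_of m ^ k = frag_of (Poly_Mapping.map (\<lambda>j. k * j) m)" for m :: "'i \<Rightarrow>\<^sub>0 nat" and k
  proof (induction k)
    case 0
    have "Poly_Mapping.map (\<lambda>j. 0 * j) m = 0" by (intro poly_mapping_eqI) (simp add: map.rep_eq when_def)
    then show ?case by simp
  next
    case (Suc k)
    have "m + Poly_Mapping.map (\<lambda>j. k * j) m = Poly_Mapping.map (\<lambda>j. Suc k * j) m"
      by (intro poly_mapping_eqI) (simp add: map.rep_eq lookup_add when_def)
    then show ?case using Suc frag_of_mult[of m "Poly_Mapping.map (\<lambda>j. k * j) m"] by simp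
  qed
  let ?t = "\<lambda>m. of_int (lookup f m) * frag_of m"
  have f: "f = (\<Sum>m\<in>keys f. ?t m)"
    using frag_expansion[of f] by (simp add: frag_extend_def frag_cmul_eq_of_int_mult)
  have "of_nat p dvd f ^ p - (\<Sum>m\<in>keys f. ?t m ^ p)"
    using prime_dvd_power_sum[OF p finite_keys, of ?t f] unfolding f[symmetric] .
  from dvd_diff[OF dvd this] have s: "of_nat p dvd (\<Sum>m\<in>keys f. ?t m ^ p)" by simp
  have t: "?t m ^ p = frag_cmul (lookup f m ^ p) (frag_of (q m))" for m
    by (simp only: power_mult_distrib power frag_cmul_eq_of_int_mult q_def of_int_power)
  have "int p dvd lookup f m" for m
  proof (cases "m \<in> keys f")
    case True
    have "lookup (\<Sum>m\<in>keys f. ?t m ^ p) (q m)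
       = (\<Sum>n\<in>keys f. if n = m then lookup f m ^ p else 0)"
      unfolding t lookup_sum by (rule sum.cong) (auto simp: q_inj)
    then have "int p dvd lookup f m ^ p"
      using s True by (simp add: of_nat_dvd_poly_iff) (metis (no_types, lifting))
    then show ?thesis using p prime_dvd_power_int[of "int p"] by simp
  qed (simp add: in_keys_iff)
  then show ?thesis by (simp add: of_nat_dvd_poly_iff)
qed

text \<open>All higher powers vanish too, so every coefficient is divisible by all primes.\<close>

lemma poly_square_zero:
  fixes f :: "('i \<Rightarrow>\<^sub>0 nat) \<Rightarrow>\<^sub>0 int"
  assumes "f * f = 0"
  shows "f = 0"
proof (rule poly_mapping_eqI)
  fix m
  obtain p where p: "Factorial_Ring.prime p" "p > nat \<bar>lookup f m\<bar>" using bigger_prime by blast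
  obtain k where k: "p = Suc (Suc k)" using prime_ge_2_nat[OF p(1)] by (metis add_2_eq_Suc le_Suc_ex)
  have "f ^ p = 0" using assms by (simp add: k flip: mult.assoc)
  then have "int p dvd lookup f m"
    using prime_dvd_poly_power[OF p(1), of f] by (simp add: of_nat_dvd_poly_iff)
  then show "lookup f m = lookup 0 m"
    using p(2) zdvd_imp_le[of "int p" "\<bar>lookup f m\<bar>"] by fastforce
qed

section \<open>Polynomial rings come from reduced rings\<close>

lemma inc_lift_empty: "inc_lift 0 \<alpha> = (\<lambda>_. undefined)"
  by (auto simp: inc_lift_def)

lemma sum_quasi_shuffles_1_1:
  fixes F :: "(nat \<Rightarrow> nat) \<times> (nat \<Rightarrow> nat) \<Rightarrow> 'r::comm_monoid_add"
  defines "\<iota> \<equiv> inc_cons 0 (\<lambda>_. undefined)"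
  shows "sum F (quasi_shuffles (Suc 0) (Suc 0) 0) = 0"
    "sum F (quasi_shuffles (Suc 0) (Suc 0) (Suc 0)) = F (\<iota>, \<iota>)"
    "sum F (quasi_shuffles (Suc 0) (Suc 0) (Suc (Suc 0))) = F (\<iota>, inc_lift (Suc 0) \<iota>) + F (inc_lift (Suc 0) \<iota>, \<iota>)"
  by (simp_all add: sum_quasi_shuffles_Suc quasi_shuffles_0 inc_lift_empty \<iota>_def)

lemma koszul_sign_2:
  "koszul_sign [y, y'] \<gamma> = (if \<gamma> 1 < \<gamma> 0 then (-1) ^ (fst y * fst y') else 1)"
proof -
  have "{(j, k). j < k \<and> k < length [y, y'] \<and> \<gamma> k < \<gamma> j} = (if \<gamma> 1 < \<gamma> 0 then {(0, 1)} else {})"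
    by (auto simp: less_Suc_eq)
  then show ?thesis by (simp add: koszul_sign_def)
qed

context connected_graded_comm_ring
begin

text \<open>The two orderings of the letters carry opposite Koszul signs and cancel; the merged
  letter is the square of x, which is \<zero>.\<close>

lemma odd_word_square:
  assumes x: "x \<in> G n" and n: "odd n"
  shows "word_mult A [(n, x)] [(n, x)] \<in> TR"
proof -
  let ?i = "inc_cons 0 (\<lambda>_. undefined)"
  let ?F = "\<lambda>k (\<alpha>, \<beta>). frag_cmul (koszul_sign ([(n, x)] @ [(n, x)]) (glue (Suc 0) \<alpha> \<beta>))
     (frag_of (collapse A ([(n, x)] @ [(n, x)]) (glue (Suc 0) \<alpha> \<beta>) k))"
  have i: "?i 0 = 0" "inc_lift (Suc 0) ?i 0 = 1" by (simp_all add: inc_cons_def inc_lift_def)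
  have "word_mult A [(n, x)] [(n, x)] = ?F (Suc 0) (?i, ?i) +
    (?F (Suc (Suc 0)) (?i, inc_lift (Suc 0) ?i) + ?F (Suc (Suc 0)) (inc_lift (Suc 0) ?i, ?i))"
    by (simp add: word_mult_def numeral_2_eq_2 sum_quasi_shuffles_1_1)
  also have "?F (Suc (Suc 0)) (?i, inc_lift (Suc 0) ?i) + ?F (Suc (Suc 0)) (inc_lift (Suc 0) ?i, ?i) = 0"
    using n by (simp add: koszul_sign_2 glue_def i collapse_def upt_rec)
  also have "?F (Suc 0) (?i, ?i) = frag_of [(n + n, \<zero>)]"
    using odd_square[OF x n] G_sub[OF x]
    by (simp add: koszul_sign_2 glue_def i collapse_def upt_rec letter_prod_def word_degree_def)
  finally have eq: "word_mult A [(n, x)] [(n, x)] = frag_of [(n + n, \<zero>)]" by simp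
  have "0 < n" using n by (cases n) auto
  \<comment> \<open>The relator for the sum of \<zero> and \<zero> is the negative of the word with
    letter \<zero>.\<close>
  then have "- frag_of [(n + n, \<zero>)] \<in> TR"
    using TR_relator[of "[]" "[]" "n + n" \<zero> \<zero>] by simp
  from TR_uminus[OF this] show ?thesis unfolding eq by simp
qed

lemma TR_coset: "f \<in> TR +>\<^bsub>WR\<^esub> g \<longleftrightarrow> f - g \<in> TR"
  by (auto simp: a_r_coset_def r_coset_def WR_plus) (metis diff_add_cancel)

lemma TR_coset_eq:
  assumes "f - g \<in> TR"
  shows "TR +>\<^bsub>WR\<^esub> f = TR +>\<^bsub>WR\<^esub> g"
proof (rule Set.set_eqI)
  fix h
  show "h \<in> TR +>\<^bsub>WR\<^esub> f \<longleftrightarrow> h \<in> TR +>\<^bsub>WR\<^esub> g"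
    unfolding TR_coset using TR_add[of "h - f" "f - g"] TR_diff[of "h - g" "f - g"] assms by auto
qed

lemma J_carrierE:
  assumes "y \<in> carrier (J_ring A G)"
  obtains f where "f \<in> carrier WR" "y = TR +>\<^bsub>WR\<^esub> f"
  using assms by (auto simp: J_ring_def FactRing_def A_RCOSETS_def RCOSETS_def a_r_coset_def)

lemma J_carrierI: "f \<in> carrier WR \<Longrightarrow> TR +>\<^bsub>WR\<^esub> f \<in> carrier (J_ring A G)"
  by (auto simp: J_ring_def FactRing_def A_RCOSETS_def RCOSETS_def a_r_coset_def)

text \<open>The one-letter word on x squares to 0 in J(A), and a polynomial ring has no nilpotents,
  so the word lies in \<open>TR\<close>. Cosets are handled directly because \<open>proj\<close>
  presupposes even degrees.\<close>

lemma G_odd_if_polynomial: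
  fixes I :: "'i set"
  assumes iso: "\<phi> \<in> ring_iso (int_mpoly_ring I) (J_ring A G)" and x: "x \<in> G n" and n: "odd n"
  shows "x = \<zero>"
proof -
  have mult: "\<phi> (f * g) = \<phi> f \<otimes>\<^bsub>J_ring A G\<^esub> \<phi> g" if "f \<in> poly_over I" "g \<in> poly_over I" for f g
    using iso that by (auto simp: ring_iso_def ring_hom_def carrier_int_mpoly_ring int_mpoly_ring_simps)
  have add: "\<phi> (f + g) = \<phi> f \<oplus>\<^bsub>J_ring A G\<^esub> \<phi> g" if "f \<in> poly_over I" "g \<in> poly_over I" for f g
    using iso that by (auto simp: ring_iso_def ring_hom_def carrier_int_mpoly_ring int_mpoly_ring_simps)
  have bij: "bij_betw \<phi> (poly_over I) (carrier (J_ring A G))"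
    using iso by (simp add: ring_iso_def carrier_int_mpoly_ring)
  have \<phi>_carrier: "\<phi> f \<in> carrier (J_ring A G)" if "f \<in> poly_over I" for f using bij_betw_apply[OF bij that] .
  let ?z = "TR +>\<^bsub>WR\<^esub> 0"
  have \<phi>0: "\<phi> 0 = ?z"
  proof -
    \<comment> \<open>An element of \<open>ring_iso\<close> is given as respecting sums, products
      and the unit, so the image of 0 is recognised as a coset equal to its own double.\<close>
    obtain h where h: "\<phi> 0 = TR +>\<^bsub>WR\<^esub> h" using J_carrierE[OF \<phi>_carrier[of 0]] by auto
    have "h + h \<in> \<phi> 0 \<oplus>\<^bsub>J_ring A G\<^esub> \<phi> 0"
      unfolding h by (auto simp: J_ring_def FactRing_def set_add_def set_mult_def WR_plus TR_coset intro!: bexI[of _ h])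
    then have "h + h \<in> TR +>\<^bsub>WR\<^esub> h" using add[of 0 0] h by simp
    then have "h - 0 \<in> TR" by (simp add: TR_coset)
    then show ?thesis unfolding h by (rule TR_coset_eq)
  qed
  have npos: "0 < n" using n by (cases n) auto
  let ?w = "frag_of [(n, x)]"
  have w: "?w \<in> carrier WR" using x npos by simp
  obtain f where f: "f \<in> poly_over I" "\<phi> f = TR +>\<^bsub>WR\<^esub> ?w"
    using bij J_carrierI[OF w] unfolding bij_betw_def by (metis imageE)
  have "\<phi> (f * f) = ?z"
  proof -
    obtain h where h: "\<phi> (f * f) = TR +>\<^bsub>WR\<^esub> h"
      using J_carrierE[OF \<phi>_carrier[OF poly_over_mult[OF f(1) f(1)]]] by blast
    have prod: "?w \<otimes>\<^bsub>WR\<^esub> ?w = word_mult A [(n, x)] [(n, x)]" by (simp add: word_ring_def)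
    have "?w \<in> \<phi> f" unfolding f(2) by (simp add: TR_coset)
    then have "TR +>\<^bsub>WR\<^esub> (?w \<otimes>\<^bsub>WR\<^esub> ?w) \<subseteq> \<phi> f \<otimes>\<^bsub>J_ring A G\<^esub> \<phi> f"
      by (auto simp: J_ring_def FactRing_def rcoset_mult_def)
    moreover have "0 \<in> TR +>\<^bsub>WR\<^esub> (?w \<otimes>\<^bsub>WR\<^esub> ?w)"
      unfolding prod TR_coset using TR_uminus[OF odd_word_square[OF x n]] by simp
    ultimately have "0 \<in> TR +>\<^bsub>WR\<^esub> h" using h mult[OF f(1) f(1)] by auto
    then have "0 - h \<in> TR" by (simp add: TR_coset)
    from TR_coset_eq[OF this] show ?thesis using h by simp
  qed
  then have "\<phi> (f * f) = \<phi> 0" by (simp add: \<phi>0)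
  then have "f * f = 0" using bij poly_over_mult[OF f(1) f(1)] by (auto simp: bij_betw_def inj_on_def)
  then have "f = 0" by (rule poly_square_zero)
  then have "?w \<in> ?z" using f(2) \<phi>0 TR_coset[of ?w ?w] by simp
  then have "?w \<in> TR" by (simp add: TR_coset)
  from letter_functional_TR[OF this] show ?thesis
    using G_sub[OF x] by (intro eq_zero_if_coord) auto
qed

end

text \<open>For the word \<xi> with the single letter x, the p-th power is modulo p the word on the
  p-th power of x, hence divisible by p. Polynomial rings are reduced modulo p, so p divides \<xi>,
  whose one-letter coordinates are those of x.\<close>

lemma (in even_graded_ring) reduced_if_polynomial:
  fixes I :: "'i set"
  assumes iso: "\<phi> \<in> ring_iso (int_mpoly_ring I) (J_ring A G)"
    and p: "Factorial_Ring.prime p" and x: "x \<in> carrier A" "zero_mod A p (x [^] p)"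
  shows "zero_mod A p x"
  using _ p x
proof (rule reduced_if_homogeneous)
  fix p n x c
  assume p: "Factorial_Ring.prime p" and n: "0 < n" and x: "x \<in> G n" and dvd: "\<And>c. int p dvd coord c (x [^] p)"
  have p0: "p > 0" by (rule prime_gt_0_nat[OF p])
  have mult: "\<phi> (f * g) = \<phi> f \<otimes>\<^bsub>J_ring A G\<^esub> \<phi> g" if "f \<in> poly_over I" "g \<in> poly_over I" for f g
    using iso that by (auto simp: ring_iso_def ring_hom_def carrier_int_mpoly_ring int_mpoly_ring_simps)
  have add: "\<phi> (f + g) = \<phi> f \<oplus>\<^bsub>J_ring A G\<^esub> \<phi> g" if "f \<in> poly_over I" "g \<in> poly_over I" for f g
    using iso that by (auto simp: ring_iso_def ring_hom_def carrier_int_mpoly_ring int_mpoly_ring_simps)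
  have one: "\<phi> 1 = proj 1"
    using iso by (simp add: ring_iso_def ring_hom_def int_mpoly_ring_simps proj_one)
  have bij: "bij_betw \<phi> (poly_over I) (range proj)"
    using iso by (simp add: ring_iso_def carrier_int_mpoly_ring carrier_J)
  have lift: "\<exists>f\<in>poly_over I. \<phi> f = proj y" for y
    using bij unfolding bij_betw_def by (metis imageE rangeI)
  have proj: "\<exists>y. \<phi> f = proj y" if "f \<in> poly_over I" for f
    using bij_betw_apply[OF bij that] by blast
  have zero: "\<phi> 0 = proj 0"
  proof -
    obtain y where y: "\<phi> 0 = proj y" using proj[of 0] by auto
    then have "proj y = proj (y + y)" using add[of 0 0] by (simp add: proj_add)
    then have "y - (y + y) \<in> null" by (simp only: proj_eq_iff)
    then have "y - 0 \<in> null" using null_uminus by force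
    then show ?thesis unfolding y proj_eq_iff .
  qed
  have of_nat: "of_nat k * f \<in> poly_over I \<and> \<phi> (of_nat k * f) = proj (of_nat k * y)"
    if "f \<in> poly_over I" "\<phi> f = proj y" for k f y
    by (induction k) (use that in \<open>auto simp: zero distrib_right poly_over_add add proj_add\<close>)
  define \<xi> where "\<xi> = word [single_nemset (n, x)]"
  obtain f where f: "f \<in> poly_over I" "\<phi> f = proj \<xi>" using lift by blast
  have one_poly: "1 \<in> poly_over I" using poly_over_frag_of[of 0 I] by simp
  have fk: "f ^ k \<in> poly_over I \<and> \<phi> (f ^ k) = proj (\<xi> ^ k)" for k
    by (induction k) (use f in \<open>auto simp: one one_poly poly_over_mult mult proj_mult\<close>)
  have g: "good (n, x)" using n x by (simp add: good_def)
  have "\<xi> ^ p \<in> null_mod p"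
  proof (rule null_mod_if_coef)
    fix k
    have "int p dvd coef K k (\<xi> ^ p) - coef K k (word [repeat_add (p - 1) (single_nemset (n, x))])"
      using additive_of_nat_dvd[OF coef_additive prime_dvd_word_power[OF p, of "[single_nemset (n, x)]"], of K k]
      unfolding additive.diff[OF coef_additive] by (simp add: \<xi>_def)
    moreover have "K c (repeat_add (p - 1) (single_nemset (n, x))) = coord c (x [^] p)" for c
      using g p0 by (simp add: K_def ev_repeat_add ev_single del: nat_pow_Suc)
    then have "int p dvd coef K k (word [repeat_add (p - 1) (single_nemset (n, x))])"
      using dvd by (auto simp: coef_word)
    ultimately have "int p dvd (coef K k (\<xi> ^ p) - coef K k (word [repeat_add (p - 1) (single_nemset (n, x))]))
      + coef K k (word [repeat_add (p - 1) (single_nemset (n, x))])" by (rule dvd_add)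
    then show "int p dvd coef K k (\<xi> ^ p)" by simp
  qed
  then obtain y where y: "\<xi> ^ p - of_nat p * y \<in> null" by (auto simp: null_mod_def)
  obtain h where h: "h \<in> poly_over I" "\<phi> h = proj y" using lift by blast
  have "\<phi> (f ^ p) = \<phi> (of_nat p * h)"
    using fk[of p] of_nat[OF h, of p] y proj_eq_iff by simp
  then have fp: "f ^ p = of_nat p * h"
    using bij fk[of p] of_nat[OF h, of p] by (auto simp: bij_betw_def inj_on_def)
  have "of_nat p dvd f" by (rule prime_dvd_poly_power[OF p]) (simp add: fp)
  then obtain r where r: "f = frag_cmul (int p) r" 
    using frag_dvdE[of "int p" f] of_nat_dvd_poly_iff[of p f] by blast
  have r_poly: "r \<in> poly_over I" using f(1) p0 by (simp add: r poly_over_def)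
  obtain z where z: "\<phi> r = proj z" using proj[OF r_poly] by blast
  have "f = of_nat p * r" by (simp add: r frag_cmul_eq_of_int_mult)
  then have "proj \<xi> = proj (of_nat p * z)" using of_nat[OF r_poly z, of p] f(2) by simp
  then have "\<xi> \<in> null_mod p" by (auto simp: proj_eq_iff null_mod_def)
  then have "int p dvd coef K [c] \<xi>" by (rule coef_if_null_mod)
  then show "int p dvd coord c x" by (simp add: \<xi>_def coef_word K_single[OF g])
qed

theorem corollary7p6:
  fixes A :: "('a, 'm) ring_scheme" and G :: "nat \<Rightarrow> 'a set"
  assumes "connected_graded_comm_ring A G"
  shows "polynomial_graded_ring (J_ring A G) (J_grade A G) \<longleftrightarrow>
    (\<forall>p::nat. \<forall>x\<in>carrier A. Factorial_Ring.prime p \<longrightarrow>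
       zero_mod A p (x [^]\<^bsub>A\<^esub> p) \<longrightarrow> zero_mod A p x)"
proof -
  interpret connected_graded_comm_ring A G by (fact assms)
  show ?thesis
  proof
    assume "polynomial_graded_ring (J_ring A G) (J_grade A G)"
    then obtain I :: "('a word \<Rightarrow>\<^sub>0 int) set set" and \<phi>
      where iso: "\<phi> \<in> ring_iso (int_mpoly_ring I) (J_ring A G)"
      by (auto simp: polynomial_graded_ring_def)
    interpret even_graded_ring A G
      by unfold_locales (rule G_odd_if_polynomial[OF iso])
    show "\<forall>p::nat. \<forall>x\<in>carrier A. Factorial_Ring.prime p \<longrightarrow>
       zero_mod A p (x [^]\<^bsub>A\<^esub> p) \<longrightarrow> zero_mod A p x"
      using reduced_if_polynomial[OF iso] by blast
  next
    assume red: "\<forall>p::nat. \<forall>x\<in>carrier A. Factorial_Ring.prime p \<longrightarrow>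
       zero_mod A p (x [^]\<^bsub>A\<^esub> p) \<longrightarrow> zero_mod A p x"
    interpret even_graded_ring A G
      by unfold_locales (rule G_odd_if_reduced; use red in blast)
    interpret reduced_graded_ring A G
      by unfold_locales (use red in blast)
    show "polynomial_graded_ring (J_ring A G) (J_grade A G)" by (rule polynomial_J_ring)
  qed
qed

end
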